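(* Let $\delta\in(0,1/3)$ and $\kappa:=R/r$. Let $(\ell_t)$ be any adversarial sequence of convex losses on $\mathcal{C}$, let $(x_t)$ be the iterates of the Projection-Free Wrapper in response to $(\ell_t)$, and let $g_s\in\partial\ell_s(x_s)$, $s\ge1$, be the observed subgradients. If the Wrapper is run with subroutine $\mathsf{A}$ set to FTRL-proximal with parameter $R$, with oracle $\mathcal{O}_{\mathcal{C}^\circ}=1\mathsf{D}\text{-}\mathsf{OPT}_{\mathcal{C}^\circ}$, and with tolerances $\delta_t=\delta/t^2$, $t\ge1$, then $x_t\in\mathcal{C}$ for all $t$ and, for all $T\ge1$, $$\forall x\in\mathcal{C},\qquad \sum_{t=1}^T\mathbb{E}[\langle g_t,x_t-x\rangle]\le 4R\sqrt{(1+d\cdot(\kappa+\delta)^2)\sum_{t=1}^T\mathbb{E}[\|g_t\|^2]}+6\delta R\cdot\mathbb{E}\Big[\max_{t\in[T]}\|g_t\|\Big].$$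
   Context: **Setting.** $\mathbb{R}^d$ carries the standard inner product and Euclidean norm $\|\cdot\|$; $\mathcal{B}(\rho)$ is the closed Euclidean ball of radius $\rho$ centered at $0$; $\mathcal{B}_\infty(u,\nu)$ is the closed $\ell_\infty$-ball of radius $\nu$ centered at $u$; $[n]=\{1,\dots,n\}$; $\mathbb{I}$ denotes an indicator; $\Pi_{\mathcal{B}(D)}$ is Euclidean projection onto $\mathcal{B}(D)$. $\mathcal{C}\subseteq\mathbb{R}^d$ is a closed convex set with $\mathcal{B}(r)\subseteq\mathcal{C}\subseteq\mathcal{B}(R)$ for some $0<r\le R$. **Online protocol.** At round $t\ge1$ the learner outputs $x_t\in\mathcal{C}$, then a convex loss $\ell_t:\mathcal{C}\to\mathbb{R}$ is revealed and a subgradient $g_t\in\partial\ell_t(x_t)$ is observed. The sequence is adversarial: $\ell_t$ may depend on $x_t$ and on $(x_s,\ell_s)_{s\in[t-1]}$ (but not otherwise on the learner's internal random draws), and $g_t$ is determined by $\ell_t$ and $x_t$. **Approximate Membership Oracle.** For $\epsilon>0$ let $\mathcal{B}(\mathcal{C},\epsilon)=\{x:\exists y\in\mathcal{C},\|x-y\|\le\epsilon\}$ and $\mathcal{B}(\mathcal{C},-\epsilon)=\{x:x+y\in\mathcal{C}\ \forall y\in\mathcal{B}(\epsilon)\}$. $\mathsf{MEM}(\cdot;\epsilon):\mathbb{R}^d\to\{0,1\}$ is any (deterministic) map equal to $1$ on $\mathcal{B}(\mathcal{C},-\epsilon)$ and to $0$ outside $\mathcal{B}(\mathcal{C},\epsilon)$.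 **$\mathsf{GAU}(w;\delta)$** (for $\delta\in(0,1)$, $w\in\mathcal{B}(6R/5)$): let $\epsilon=\delta r/(4\kappa)^2$. If $\mathsf{MEM}(2w;\epsilon)=1$ or $\|w\|\le r/2$, return $0$. Otherwise set $\alpha=0,\beta=2,\mu=1$; while $\beta-\alpha>\delta/(8\kappa^2)$: set $\alpha=\mu$ if $\mathsf{MEM}(\mu w;\epsilon)=1$ and $\beta=\mu$ otherwise, then $\mu=(\alpha+\beta)/2$. Return $(\alpha-\delta/(8\kappa^2))^{-1}$. **$1\mathsf{D}\text{-}\mathsf{OPT}_{\mathcal{C}^\circ}(w;\delta)$** (for $w\in\mathcal{B}(R)$, $\delta\in(0,1/3)$): let $\varepsilon=\frac{r^2\delta^3}{10^3d^{7/2}R^2}$, $\nu_1=\frac{r\delta}{10d}$, $\nu_2=\sqrt{\varepsilon\nu_1r/d^{1/2}}$. Sample (with fresh randomness at each call) $I$ uniformly in $[d]$, and independently $u$ uniformly in $\mathcal{B}_\infty(w,\nu_1)$ and then $z$ uniformly in $\mathcal{B}_\infty(u,\nu_2)$. Let $w_I,w_I'$ be the endpoints of $\mathcal{B}_\infty(u,\nu_2)\cap\{z+\lambda e_I:\lambda\in\mathbb{R}\}$, $w_I'$ having the larger $I$-th coordinate, and $\tilde s_I=\frac1{2\nu_2}(\mathsf{GAU}(w_I';\varepsilon)-\mathsf{GAU}(w_I;\varepsilon))$. Return $(\hat\gamma,\hat s)$ with $\hat\gamma=\mathsf{GAU}(w;\delta)$, $\hat s=d\,\tilde s_I\,e_I$.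 **Projection-Free Wrapper** (inputs: an OCO algorithm $\mathsf{A}$ with outputs in $\mathcal{B}(R)$, tolerances $(\delta_t)\subset(0,1/3)$, oracle $\mathcal{O}_{\mathcal{C}^\circ}$ returning a pair in $\mathbb{R}_{\ge0}\times\mathbb{R}^d$). Let $w_1$ be the first output of $\mathsf{A}$. For $t=1,2,\dots$: set $(\gamma_t,s_t)=\mathcal{O}_{\mathcal{C}^\circ}(w_t;\delta_t)$ and $\nu_t=\mathbb{I}_{\{\gamma_t\ge1\}}s_t$; play $x_t=w_t/\gamma_t$ if $\gamma_t\ge1$ and $x_t=w_t$ otherwise; observe $g_t\in\partial\ell_t(x_t)$; set $\tilde g_t=g_t-\mathbb{I}_{\{\langle g_t,w_t\rangle<0\}}\langle g_t,x_t\rangle\nu_t$; give $\mathsf{A}$ the $t$-th loss $f_t(w)=\langle\tilde g_t,w\rangle$ and let $w_{t+1}$ be its next output. **FTRL-proximal with parameter $D$.** Outputs $w_1=0$; $G_0=0,V_0=0,\eta_0=\infty,\Sigma_0=0$. Upon observing a subgradient $\nabla_t$ of the $t$-th loss at $w_t$: $G_t=G_{t-1}+\nabla_t$, $V_t=V_{t-1}+\|\nabla_t\|^2$, $\eta_t=\sqrt2D/\sqrt{V_t}$, $\sigma_t=1/\eta_t-1/\eta_{t-1}$ (with $1/\infty=0$), $\Sigma_t=\Sigma_{t-1}+\sigma_t$, and $w_{t+1}=\Pi_{\mathcal{B}(D)}\big((-G_t+\sum_{s\le t}\sigma_sw_s)/\Sigma_t\big)$ (with $w_{t+1}=0$ if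 $\Sigma_t=0$). *)

theory Defs
  imports "HOL-Probability.Probability" "HOL-Library.While_Combinator"
begin

section \<open>Approximate membership oracles and convex losses\<close>

definition enlarge :: "'v::real_inner set \<Rightarrow> real \<Rightarrow> 'v set" where
  "enlarge C \<epsilon> = {x. \<exists>y\<in>C. norm (x - y) \<le> \<epsilon>}"

definition shrink :: "'v::real_inner set \<Rightarrow> real \<Rightarrow> 'v set" where
  "shrink C \<epsilon> = {x. \<forall>y\<in>cball 0 \<epsilon>. x + y \<in> C}"

definition approx_membership_oracle :: "'v::real_inner set \<Rightarrow> ('v \<Rightarrow> real \<Rightarrow> bool) \<Rightarrow> bool" where
  "approx_membership_oracle C MEM \<longleftrightarrow>
     (\<forall>\<epsilon>>0. (\<forall>x\<in>shrink C \<epsilon>. MEM x \<epsilon>) \<and> (\<forall>x. x \<notin> enlarge C \<epsilon> \<longrightarrow> \<not> MEM x \<epsilon>))"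

text \<open>Losses live on \<open>C\<close>; as functions on the whole type they are only ever constrained on \<open>C\<close>.
  Membership of \<open>x\<close> in \<open>C\<close> is deliberately not part of the following definition, so that a
  hypothesis that some vector is a subgradient at \<open>x\<close> does not smuggle in \<open>x \<in> C\<close>.\<close>

definition subdifferential :: "'v::real_inner set \<Rightarrow> ('v \<Rightarrow> real) \<Rightarrow> 'v \<Rightarrow> 'v set" where
  "subdifferential C l x = {g. \<forall>y\<in>C. l y \<ge> l x + g \<bullet> (y - x)}"


section \<open>The approximate gauge\<close>

definition gau ::
  "('v::real_inner \<Rightarrow> real \<Rightarrow> bool) \<Rightarrow> real \<Rightarrow> real \<Rightarrow> 'v \<Rightarrow> real \<Rightarrow> real" where
  "gau MEM r R w \<delta> =
     (let \<kappa> = R / r; \<epsilon> = \<delta> * r / (4 * \<kappa>)\<^sup>2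
      in if MEM (2 *\<^sub>R w) \<epsilon> \<or> norm w \<le> r / 2 then 0
         else
           let (\<alpha>, \<beta>, \<mu>) =
             while (\<lambda>(\<alpha>, \<beta>, \<mu>). \<beta> - \<alpha> > \<delta> / (8 * \<kappa>\<^sup>2))
               (\<lambda>(\<alpha>, \<beta>, \<mu>).
                  let (\<alpha>', \<beta>') = (if MEM (\<mu> *\<^sub>R w) \<epsilon> then (\<mu>, \<beta>) else (\<alpha>, \<mu>))
                  in (\<alpha>', \<beta>', (\<alpha>' + \<beta>') / 2))
               (0, 2, 1)
           in inverse (\<alpha> - \<delta> / (8 * \<kappa>\<^sup>2)))"


section \<open>The randomized one-dimensional optimization oracle\<close>

definition linf_ball :: "real^'n \<Rightarrow> real \<Rightarrow> (real^'n) set" where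
  "linf_ball u \<nu> = {x. infnorm (x - u) \<le> \<nu>}"

text \<open>The randomness of one oracle call is a triple \<open>(i, a, b)\<close> with \<open>i\<close> a uniform coordinate and
  \<open>a\<close>, \<open>b\<close> uniform in the unit \<open>\<ell>\<^sub>\<infinity>\<close>-ball, all independent. The points used by the oracle are
  \<open>u = w + \<nu>\<^sub>1 a\<close> and \<open>z = u + \<nu>\<^sub>2 b\<close>. By \<open>distr_scaled_draw\<close> below, \<open>u\<close> is uniform in
  \<open>linf_ball w \<nu>\<^sub>1\<close> and, given \<open>u\<close>, \<open>z\<close> is uniform in \<open>linf_ball u \<nu>\<^sub>2\<close>. Separating the
  randomness from the query point \<open>w\<close> lets the draws of all rounds be independent.\<close>

definition unit_draw :: "(real^'n) measure" where
  "unit_draw = uniform_measure lborel (linf_ball 0 1)"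

definition draw_measure :: "('n::finite \<times> (real^'n) \<times> (real^'n)) measure" where
  "draw_measure = uniform_count_measure UNIV \<Otimes>\<^sub>M (unit_draw \<Otimes>\<^sub>M unit_draw)"

text \<open>\<open>face u z i c\<close> is the point of the line through \<open>z\<close> in direction \<open>e\<^sub>i\<close> whose \<open>i\<close>-th coordinate
  is \<open>u\<^sub>i + c\<close>; see \<open>linf_ball_Int_line\<close> below.\<close>

definition face :: "real^'n \<Rightarrow> real^'n \<Rightarrow> 'n \<Rightarrow> real \<Rightarrow> real^'n" where
  "face u z i c = (\<chi> j. if j = i then u $ i + c else z $ j)"

definition one_d_opt ::
  "(real^'n \<Rightarrow> real \<Rightarrow> bool) \<Rightarrow> real \<Rightarrow> real \<Rightarrow> 'n \<times> (real^'n) \<times> (real^'n) \<Rightarrow> real^'n \<Rightarrow> real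
    \<Rightarrow> real \<times> (real^'n)" where
  "one_d_opt MEM r R = (\<lambda>(i, a, b) w \<delta>.
     let d = real CARD('n);
         \<epsilon> = r\<^sup>2 * \<delta> ^ 3 / (10 ^ 3 * d powr (7 / 2) * R\<^sup>2);
         \<nu>\<^sub>1 = r * \<delta> / (10 * d);
         \<nu>\<^sub>2 = sqrt (\<epsilon> * \<nu>\<^sub>1 * r / d powr (1 / 2));
         u = w + \<nu>\<^sub>1 *\<^sub>R a;
         z = u + \<nu>\<^sub>2 *\<^sub>R b;
         s = (gau MEM r R (face u z i \<nu>\<^sub>2) \<epsilon> - gau MEM r R (face u z i (- \<nu>\<^sub>2)) \<epsilon>) / (2 * \<nu>\<^sub>2)
     in (gau MEM r R w \<delta>, (d * s) *\<^sub>R axis i 1))"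

lemma linf_ball_eq_cbox:
  fixes u :: "real^'n"
  shows "linf_ball u \<nu> = cbox (u - (\<chi> i. \<nu>)) (u + (\<chi> i. \<nu>))"
proof -
  have "infnorm (x - u) \<le> \<nu> \<longleftrightarrow> (\<forall>i. \<bar>x $ i - u $ i\<bar> \<le> \<nu>)" for x :: "real^'n"
  proof
    assume "infnorm (x - u) \<le> \<nu>"
    then show "\<forall>i. \<bar>x $ i - u $ i\<bar> \<le> \<nu>"
      using component_le_infnorm_cart[of "x - u"] by (auto intro: order_trans)
  next
    assume "\<forall>i. \<bar>x $ i - u $ i\<bar> \<le> \<nu>"
    then show "infnorm (x - u) \<le> \<nu>"
      unfolding infnorm_cart by (auto intro!: cSup_least)
  qed
  then show ?thesis
    by (auto simp: linf_ball_def mem_box_cart abs_le_iff algebra_simps)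
qed

lemma distr_scaled_draw:
  fixes w :: "real^'n"
  assumes "\<nu> > 0"
  shows "distr unit_draw borel (\<lambda>a. w + \<nu> *\<^sub>R a) = uniform_measure lborel (linf_ball w \<nu>)"
proof -
  define T where "T = (\<lambda>a. w + \<nu> *\<^sub>R a)"
  have [measurable]: "T \<in> borel \<rightarrow>\<^sub>M borel"
    unfolding T_def by measurable
  have [measurable]: "linf_ball v \<rho> \<in> sets borel" for v :: "real^'n" and \<rho>
    by (simp add: linf_ball_eq_cbox)
  have scale: "emeasure lborel X = ennreal (\<nu> ^ CARD('n)) * emeasure lborel (T -` X)"
    if [measurable]: "X \<in> sets borel" for X
  proof -
    have "emeasure lborel X =
        emeasure (density (distr lborel borel T) (\<lambda>_. ennreal (\<bar>\<nu>\<bar> ^ DIM(real^'n)))) X"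
      unfolding T_def using lborel_affine[of \<nu> w] assms by simp
    also have "\<dots> = ennreal (\<nu> ^ CARD('n)) * emeasure (distr lborel borel T) X"
      using assms by (subst emeasure_density_const) auto
    also have "emeasure (distr lborel borel T) X = emeasure lborel (T -` X)"
      by (subst emeasure_distr) auto
    finally show ?thesis .
  qed
  have ball: "T -` linf_ball w \<nu> = linf_ball 0 1"
    using assms by (auto simp: T_def linf_ball_def infnorm_mul)
  show ?thesis
  proof (rule measure_eqI)
    fix X assume "X \<in> sets (distr unit_draw borel (\<lambda>a. w + \<nu> *\<^sub>R a))"
    then have [measurable]: "X \<in> sets borel" by simp
    have mB: "linf_ball w \<nu> \<in> sets borel" and mBX: "linf_ball w \<nu> \<inter> X \<in> sets borel"
      by measurable
    have TX[measurable]: "T -` X \<in> sets borel"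
      using measurable_sets[of T borel borel X] by simp
    have "emeasure (distr unit_draw borel T) X = emeasure unit_draw (T -` X)"
      by (subst emeasure_distr) (auto simp: unit_draw_def)
    also have "\<dots> = emeasure lborel (linf_ball 0 1 \<inter> T -` X) / emeasure lborel (linf_ball 0 1 :: (real^'n) set)"
      unfolding unit_draw_def by (subst emeasure_uniform_measure) auto
    also have "\<dots> = (emeasure lborel (linf_ball 0 1 \<inter> T -` X) * ennreal (\<nu> ^ CARD('n))) /
        (emeasure lborel (linf_ball 0 1 :: (real^'n) set) * ennreal (\<nu> ^ CARD('n)))"
      using assms by (intro divide_mult_eq[symmetric]) auto
    also have "\<dots> = emeasure lborel (linf_ball w \<nu> \<inter> X) / emeasure lborel (linf_ball w \<nu>)"
      by (simp only: scale[OF mB] scale[OF mBX] ball vimage_Int mult.commute)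
    also have "\<dots> = emeasure (uniform_measure lborel (linf_ball w \<nu>)) X"
      by (subst emeasure_uniform_measure) auto
    finally show "emeasure (distr unit_draw borel (\<lambda>a. w + \<nu> *\<^sub>R a)) X =
        emeasure (uniform_measure lborel (linf_ball w \<nu>)) X"
      by (simp add: T_def)
  qed simp
qed

lemma linf_ball_Int_line:
  fixes u z :: "real^'n"
  assumes "z \<in> linf_ball u \<nu>"
  shows "linf_ball u \<nu> \<inter> {z + c *\<^sub>R axis i 1 |c. True} =
    closed_segment (face u z i (- \<nu>)) (face u z i \<nu>)"
proof -
  have nn: "0 \<le> \<nu>"
    using assms infnorm_pos_le[of "z - u"] by (simp add: linf_ball_def)
  have bz: "\<bar>z $ j - u $ j\<bar> \<le> \<nu>" for j
    using assms component_le_infnorm_cart[of "z - u" j] by (simp add: linf_ball_def)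
  have memb: "y \<in> linf_ball u \<nu> \<longleftrightarrow> (\<forall>j. \<bar>y $ j - u $ j\<bar> \<le> \<nu>)" for y
    by (auto simp: linf_ball_eq_cbox mem_box_cart abs_le_iff algebra_simps)
  show ?thesis
  proof (intro set_eqI iffI)
    fix y assume "y \<in> linf_ball u \<nu> \<inter> {z + c *\<^sub>R axis i 1 |c. True}"
    then obtain c where y: "y = z + c *\<^sub>R axis i 1" and "y \<in> linf_ball u \<nu>" by blast
    then have le: "\<bar>y $ i - u $ i\<bar> \<le> \<nu>" using memb by blast
    show "y \<in> closed_segment (face u z i (- \<nu>)) (face u z i \<nu>)"
    proof (cases "\<nu> = 0")
      case True
      then have "y = face u z i 0"
        using le by (auto simp: y face_def vec_eq_iff axis_def)
      then show ?thesis using True by simp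
    next
      case False
      define s where "s = (y $ i - u $ i + \<nu>) / (2 * \<nu>)"
      have s01: "0 \<le> s" "s \<le> 1" using le False nn by (auto simp: s_def field_simps)
      have "2 * (s * \<nu>) = y $ i - u $ i + \<nu>" using False by (simp add: s_def)
      then have si: "y $ i = u $ i - \<nu> + 2 * (s * \<nu>)" by linarith
      have "y = (1 - s) *\<^sub>R face u z i (- \<nu>) + s *\<^sub>R face u z i \<nu>"
        unfolding vec_eq_iff
      proof
        fix j
        show "y $ j = ((1 - s) *\<^sub>R face u z i (- \<nu>) + s *\<^sub>R face u z i \<nu>) $ j"
          using si by (cases "j = i") (auto simp: y face_def axis_def algebra_simps)
      qed
      then show ?thesis using s01 unfolding closed_segment_def by blast
    qed
  next
    fix y assume "y \<in> closed_segment (face u z i (- \<nu>)) (face u z i \<nu>)"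
    then obtain s where s: "0 \<le> s" "s \<le> 1"
      and y: "y = (1 - s) *\<^sub>R face u z i (- \<nu>) + s *\<^sub>R face u z i \<nu>"
      unfolding closed_segment_def by blast
    have yi: "y $ i = u $ i + (2 * s - 1) * \<nu>" by (simp add: y face_def algebra_simps)
    have yj: "y $ j = z $ j" if "j \<noteq> i" for j using that by (simp add: y face_def algebra_simps)
    have "\<bar>2 * s - 1\<bar> * \<nu> \<le> 1 * \<nu>" using s nn by (intro mult_right_mono) auto
    then have "\<bar>y $ i - u $ i\<bar> \<le> \<nu>" using nn by (simp add: yi abs_mult)
    then have "y \<in> linf_ball u \<nu>" unfolding memb using bz yj by metis
    moreover have "y = z + (y $ i - z $ i) *\<^sub>R axis i 1"
      using yj by (auto simp: vec_eq_iff axis_def)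
    ultimately show "y \<in> linf_ball u \<nu> \<inter> {z + c *\<^sub>R axis i 1 |c. True}" by blast
  qed
qed


section \<open>Follow the regularized leader, proximal version\<close>

record 'v ftrl_state =
  sum_grads :: 'v
  sum_squares :: real
  sum_weights :: real
  weighted_outputs :: 'v
  ftrl_output :: 'v

text \<open>For \<open>V = 0\<close> the step size is \<open>\<infinity>\<close> with \<open>1 / \<infinity> = 0\<close>. Only reciprocals of step sizes are
  used, and \<open>1 / ftrl_rate D 0 = 0\<close> holds because division by zero yields zero.\<close>

definition ftrl_rate :: "real \<Rightarrow> real \<Rightarrow> real" where
  "ftrl_rate D V = sqrt 2 * D / sqrt V"

definition ftrl_init :: "'v::euclidean_space ftrl_state" where
  "ftrl_init = \<lparr>sum_grads = 0, sum_squares = 0, sum_weights = 0, weighted_outputs = 0,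
     ftrl_output = 0\<rparr>"

definition ftrl_step :: "real \<Rightarrow> 'v::euclidean_space ftrl_state \<Rightarrow> 'v \<Rightarrow> 'v ftrl_state" where
  "ftrl_step D st g =
     (let G = sum_grads st + g;
          V = sum_squares st + (norm g)\<^sup>2;
          \<sigma> = 1 / ftrl_rate D V - 1 / ftrl_rate D (sum_squares st);
          S = sum_weights st + \<sigma>;
          P = weighted_outputs st + \<sigma> *\<^sub>R ftrl_output st
      in \<lparr>sum_grads = G, sum_squares = V, sum_weights = S, weighted_outputs = P,
          ftrl_output =
            (if S = 0 then 0 else closest_point (cball 0 D) ((1 / S) *\<^sub>R (- G + P)))\<rparr>)"

definition ftrl_proximal :: "real \<Rightarrow> 'v::euclidean_space list \<Rightarrow> 'v" where
  "ftrl_proximal D gs = ftrl_output (foldl (ftrl_step D) ftrl_init gs)"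


section \<open>The projection-free wrapper\<close>

record 'v round =
  iterate :: 'v
  loss :: "'v \<Rightarrow> real"
  subgrad :: 'v
  surrogate :: 'v

text \<open>The subroutine \<open>A\<close> maps the list of the losses received so far to its next output; as these
  losses are linear functionals \<open>w \<mapsto> g \<bullet> w\<close>, they are represented by their gradients \<open>g\<close>.
  The adversary \<open>adv\<close> maps the list of past pairs of iterate and loss together with the current
  iterate to the current loss, and \<open>sg\<close> selects the observed subgradient from the loss and the
  iterate. The list \<open>wrapper_rounds \<dots> t\<close> records rounds \<open>1, \<dots>, t\<close> in order; the oracle call of
  round \<open>t\<close> consumes the random draw \<open>\<xi> t\<close>.\<close>

primrec wrapper_rounds ::
  "('v::real_inner list \<Rightarrow> 'v) \<Rightarrow> ('s \<Rightarrow> 'v \<Rightarrow> real \<Rightarrow> real \<times> 'v) \<Rightarrow> (nat \<Rightarrow> real) \<Rightarrow>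
   (('v \<times> ('v \<Rightarrow> real)) list \<Rightarrow> 'v \<Rightarrow> ('v \<Rightarrow> real)) \<Rightarrow> (('v \<Rightarrow> real) \<Rightarrow> 'v \<Rightarrow> 'v) \<Rightarrow>
   (nat \<Rightarrow> 's) \<Rightarrow> nat \<Rightarrow> 'v round list" where
  "wrapper_rounds A orac \<delta> adv sg \<xi> 0 = []"
| "wrapper_rounds A orac \<delta> adv sg \<xi> (Suc t) =
     (let past = wrapper_rounds A orac \<delta> adv sg \<xi> t;
          w = A (map surrogate past);
          (\<gamma>, s) = orac (\<xi> (Suc t)) w (\<delta> (Suc t));
          \<nu> = (if \<gamma> \<ge> 1 then s else 0);
          x = (if \<gamma> \<ge> 1 then (1 / \<gamma>) *\<^sub>R w else w);
          l = adv (map (\<lambda>\<rho>. (iterate \<rho>, loss \<rho>)) past) x;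
          g = sg l x;
          h = g - (if g \<bullet> w < 0 then (g \<bullet> x) *\<^sub>R \<nu> else 0)
      in past @ [\<lparr>iterate = x, loss = l, subgrad = g, surrogate = h\<rparr>])"

text \<open>The sample space is the product of the adversary's private randomness with the independent
  draws of the learner. The adversary sees its own randomness but the learner's draws
  only through the iterates. The last record of \<open>wrapper_rounds \<dots> t\<close> is round \<open>t\<close>, for \<open>t \<ge> 1\<close>.\<close>

definition run_measure ::
  "'a measure \<Rightarrow> ('a \<times> (nat \<Rightarrow> 'n::finite \<times> (real^'n) \<times> (real^'n))) measure" where
  "run_measure N = N \<Otimes>\<^sub>M (\<Pi>\<^sub>M t\<in>UNIV. draw_measure)"

definition run_round ::
  "(real^'n \<Rightarrow> real \<Rightarrow> bool) \<Rightarrow> real \<Rightarrow> real \<Rightarrow> real \<Rightarrow>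
   ('a \<Rightarrow> ((real^'n) \<times> (real^'n \<Rightarrow> real)) list \<Rightarrow> real^'n \<Rightarrow> (real^'n \<Rightarrow> real)) \<Rightarrow>
   ((real^'n \<Rightarrow> real) \<Rightarrow> real^'n \<Rightarrow> real^'n) \<Rightarrow>
   nat \<Rightarrow> 'a \<times> (nat \<Rightarrow> 'n \<times> (real^'n) \<times> (real^'n)) \<Rightarrow> (real^'n) round" where
  "run_round MEM r R \<delta> adv sg t \<omega> =
     last (wrapper_rounds (ftrl_proximal R) (one_d_opt MEM r R) (\<lambda>t. \<delta> / (real t)\<^sup>2)
       (adv (fst \<omega>)) sg (snd \<omega>) t)"

end

theory Submission
  imports Defs
begin

text \<open>The wrapper reduces optimisation over \<open>C\<close> to optimisation over a ball. Let \<open>\<gamma>\<close> be the gauge of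
  \<open>C\<close>. A point \<open>w\<close> of the ball with \<open>\<gamma> w > 1\<close> is pulled back to \<open>w / \<gamma> w\<close>, and if the
  gradient \<open>g\<close> rewards moving outwards (\<open>g \<bullet> w < 0\<close>) a positive multiple of a direction \<open>s\<close> is added to \<open>g\<close>. If \<open>s\<close> is a subgradient of the
  gauge at \<open>w\<close>, then the linear loss of the modified gradient, against any comparator in \<open>C\<close>, dominates
  the original one (\<open>inner_play_le\<close>). It therefore suffices that the oracle supplies a
  good \<open>\<gamma>\<close> and, in conditional expectation, a good \<open>s\<close> of small second moment.

  For the gauge, bisection with a membership oracle gives an upper bound that is accurate up to \<open>\<delta>\<close>
  (\<open>gau_accuracy\<close>); being an upper bound, it keeps the plays in \<open>C\<close>.

  For the direction, consider a continuously differentiable convex function \<open>F\<close>. Its difference quotient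
  across a cube along a line parallel to the \<open>i\<close>-th axis is the average of the \<open>i\<close>-th partial derivative
  over that line. Drawing the line at random and averaging over it amounts to drawing a point of the
  cube. So the difference quotients have the mean gradient as their mean
  (\<open>integral_face_quotient\<close>), and by Jensen's inequality the sum of their second moments is at most the
  mean squared norm of the gradient (\<open>integral_face_quotient_power2\<close>). This is applied to the Moreau
  envelope of the gauge, which is uniformly close to the gauge, differentiable everywhere, and has
  its gradients in the polar of \<open>C\<close>, hence of norm at most \<open>1 / r\<close>. Replacing it by the approximate gauge
  costs little, because the error of the latter is small compared to the side of the cube
  (\<open>inner_radius_eq\<close>). The subgradient inequality of the envelope, averaged over the cube, yields the mean
  (\<open>sample_mean\<close>). Sampling a single coordinate costs a factor \<open>d\<close> in the second moment
  (\<open>sample_second_moment\<close>).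

  What remains is the regret bound \<open>2 * sqrt 2 * R\<close> times the root of the summed squared norms for
  proximal FTRL (\<open>ftrl_regret\<close>), and conditioning. Query point, play and observed gradient of a round do
  not depend on the draw of that round, so redrawing it leaves the joint law and these
  quantities unchanged and only averages the direction (\<open>distr_redraw\<close>, \<open>redraw_simps\<close>).\<close>

section \<open>The gauge of a convex body and its smoothing\<close>

definition polar :: "'v::real_inner set \<Rightarrow> 'v set" where
  "polar C = {s. \<forall>x\<in>C. s \<bullet> x \<le> 1}"

text \<open>The gauge of a closed convex set around the origin, as the support function of its polar. In this
  form sublinearity is immediate, and the subgradients of the gauge are the maximising members of
  the polar.\<close>

definition minkowski :: "'v::real_inner set \<Rightarrow> 'v \<Rightarrow> real" where
  "minkowski C w = (SUP s\<in>polar C. s \<bullet> w)"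

locale convex_body =
  fixes C :: "'v::euclidean_space set" and r R :: real
  assumes closed_C: "closed C" and convex_C: "convex C"
    and inner_ball: "cball 0 r \<subseteq> C" and outer_ball: "C \<subseteq> cball 0 R"
    and r_pos: "0 < r" and r_le_R: "r \<le> R"
begin

lemma R_pos: "0 < R"
  using r_pos r_le_R by simp

lemma zero_in_polar: "0 \<in> polar C"
  by (simp add: polar_def)

text \<open>As \<open>C\<close> contains a ball, a member \<open>s\<close> of the polar can be tested against the point of this ball
  in the direction of \<open>s\<close>.\<close>

lemma norm_polar_le:
  assumes "s \<in> polar C"
  shows "norm s \<le> 1 / r"
proof (cases "s = 0")
  case True
  then show ?thesis using r_pos by simp
next
  case False
  have "(r / norm s) *\<^sub>R s \<in> C"
    using inner_ball r_pos False by (intro subsetD[OF inner_ball]) auto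
  then have "s \<bullet> ((r / norm s) *\<^sub>R s) \<le> 1"
    using assms by (auto simp: polar_def)
  then have "r * norm s \<le> 1"
    using False by (simp add: dot_square_norm power2_eq_square)
  then show ?thesis using r_pos by (simp add: field_simps)
qed

lemma polar_eq_halfspaces: "polar C = (\<Inter>x\<in>C. {s. x \<bullet> s \<le> 1})"
  by (auto simp: polar_def inner_commute)

lemma polar_closed: "closed (polar C)"
  unfolding polar_eq_halfspaces by (auto intro!: closed_INT closed_halfspace_le)

lemma polar_convex: "convex (polar C)"
  unfolding polar_eq_halfspaces by (auto intro!: convex_INT convex_halfspace_le)

lemma polar_inner_le:
  assumes "s \<in> polar C"
  shows "s \<bullet> w \<le> norm w / r"
proof -
  have "s \<bullet> w \<le> norm s * norm w" by (rule norm_cauchy_schwarz)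
  also have "\<dots> \<le> 1 / r * norm w"
    using norm_polar_le[OF assms] by (intro mult_right_mono) auto
  finally show ?thesis by simp
qed

lemma bdd_above_polar: "bdd_above ((\<lambda>s. s \<bullet> w) ` polar C)"
  using polar_inner_le by (auto intro!: bdd_aboveI[where M = "norm w / r"])

lemma inner_le_minkowski: "s \<in> polar C \<Longrightarrow> s \<bullet> w \<le> minkowski C w"
  unfolding minkowski_def by (rule cSUP_upper[OF _ bdd_above_polar])

lemma minkowski_le:
  assumes "\<And>s. s \<in> polar C \<Longrightarrow> s \<bullet> w \<le> b"
  shows "minkowski C w \<le> b"
  unfolding minkowski_def using assms zero_in_polar by (intro cSUP_least) auto

lemma minkowski_nonneg: "0 \<le> minkowski C w"
  using inner_le_minkowski[OF zero_in_polar] by simp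

lemma minkowski_le_norm: "minkowski C w \<le> norm w / r"
  by (intro minkowski_le polar_inner_le)

lemma minkowski_add_le: "minkowski C (v + w) \<le> minkowski C v + minkowski C w"
  by (intro minkowski_le) (auto simp: inner_add_right intro!: add_mono inner_le_minkowski)

lemma minkowski_lipschitz: "minkowski C v \<le> minkowski C w + norm (v - w) / r"
  using minkowski_add_le[of w "v - w"] minkowski_le_norm[of "v - w"] by simp

lemma minkowski_scale:
  assumes "0 \<le> a"
  shows "minkowski C (a *\<^sub>R w) = a * minkowski C w"
proof -
  have le: "minkowski C (b *\<^sub>R v) \<le> b * minkowski C v" if "0 \<le> b" for b v
    using that by (intro minkowski_le) (auto intro!: mult_left_mono inner_le_minkowski)
  show ?thesis
  proof (cases "a = 0")
    case True
    then show ?thesis using minkowski_le_norm[of 0] minkowski_nonneg[of 0] by simp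
  next
    case False
    then have "minkowski C w \<le> inverse a * minkowski C (a *\<^sub>R w)"
      using le[of "inverse a" "a *\<^sub>R w"] assms by simp
    then show ?thesis using le[OF assms, of w] False assms by (simp add: field_simps)
  qed
qed

lemma minkowski_le_one: "w \<in> C \<Longrightarrow> minkowski C w \<le> 1"
  by (intro minkowski_le) (auto simp: polar_def)

text \<open>Bipolar theorem: a hyperplane separating a point from \<open>C\<close> can be normalised to a member
  of the polar because \<open>C\<close> contains the origin.\<close>

lemma one_less_minkowski:
  assumes "w \<notin> C"
  shows "1 < minkowski C w"
proof -
  obtain a b where a: "a \<bullet> w < b" "\<And>x. x \<in> C \<Longrightarrow> b < a \<bullet> x"
    using separating_hyperplane_closed_point[OF convex_C closed_C assms] by auto
  have "0 \<in> C" using inner_ball r_pos by auto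
  then have b: "b < 0" using a(2)[of 0] by simp
  have "a \<bullet> x / b \<le> 1" if "x \<in> C" for x
    using a(2)[OF that] b by (simp add: divide_le_eq)
  then have "(1 / b) *\<^sub>R a \<in> polar C" by (auto simp: polar_def)
  from inner_le_minkowski[OF this, of w] have "a \<bullet> w / b \<le> minkowski C w" by simp
  moreover have "1 < a \<bullet> w / b" using a(1) b by (simp add: less_divide_eq)
  ultimately show ?thesis by linarith
qed

lemma mem_if_minkowski_le_one: "minkowski C w \<le> 1 \<Longrightarrow> w \<in> C"
  using one_less_minkowski by force

text \<open>The gauge is \<open>1 / r\<close>-Lipschitz, so a membership test that is wrong only within distance \<open>\<epsilon>\<close> of the
  boundary bounds the gauge up to \<open>\<epsilon> / r\<close>. This lemma reads a positive answer, the next a negative one.\<close>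

lemma minkowski_enlarge_le:
  assumes "w \<in> enlarge C \<epsilon>"
  shows "minkowski C w \<le> 1 + \<epsilon> / r"
proof -
  obtain y where "y \<in> C" "norm (w - y) \<le> \<epsilon>" using assms by (auto simp: enlarge_def)
  then have "norm (w - y) / r \<le> \<epsilon> / r" using r_pos by (intro divide_right_mono) auto
  then show ?thesis
    using minkowski_lipschitz[of w y] minkowski_le_one[OF \<open>y \<in> C\<close>] by linarith
qed

lemma less_minkowski_if_not_shrink:
  assumes "w \<notin> shrink C \<epsilon>"
  shows "1 - \<epsilon> / r < minkowski C w"
proof -
  obtain e where "norm e \<le> \<epsilon>" "w + e \<notin> C" using assms by (auto simp: shrink_def)
  then have "norm e / r \<le> \<epsilon> / r" using r_pos by (intro divide_right_mono) auto
  then show ?thesis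
    using minkowski_lipschitz[of "w + e" w] one_less_minkowski[OF \<open>w + e \<notin> C\<close>] by simp
qed

text \<open>The gauge need not be differentiable, and an almost-everywhere gradient would be awkward to handle.
  Its Moreau envelope is continuously differentiable at every point, with gradients that are still
  members of the polar. Since the gauge is the support function of the polar, the envelope is the
  maximum of \<open>s \<bullet> z - \<eta> / 2 * (norm s)\<^sup>2\<close> over the polar, attained at the projection of \<open>z / \<eta>\<close>.\<close>

definition smooth_grad :: "real \<Rightarrow> 'v \<Rightarrow> 'v" where
  "smooth_grad \<eta> z = closest_point (polar C) ((1 / \<eta>) *\<^sub>R z)"

definition smooth_gauge :: "real \<Rightarrow> 'v \<Rightarrow> real" where
  "smooth_gauge \<eta> z = smooth_grad \<eta> z \<bullet> z - \<eta> / 2 * (norm (smooth_grad \<eta> z))\<^sup>2"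

lemma smooth_grad_in_polar: "smooth_grad \<eta> z \<in> polar C"
  unfolding smooth_grad_def using polar_closed zero_in_polar by (intro closest_point_in_set) auto

lemma continuous_smooth_grad: "continuous_on S (smooth_grad \<eta>)"
proof -
  have ne: "polar C \<noteq> {}" using zero_in_polar by auto
  have "continuous_on UNIV (closest_point (polar C))"
    by (rule continuous_on_closest_point[OF polar_convex polar_closed ne])
  moreover have "continuous_on S (\<lambda>z. (1 / \<eta>) *\<^sub>R z)"
    by (intro continuous_intros)
  ultimately show ?thesis
    unfolding smooth_grad_def[abs_def] by (rule continuous_on_compose2) simp
qed

text \<open>Expanding the square turns minimality of the distance to \<open>z / \<eta>\<close> into the claimed maximality.\<close>

lemma smooth_gauge_upper:
  assumes "0 < \<eta>" "s \<in> polar C"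
  shows "s \<bullet> z - \<eta> / 2 * (norm s)\<^sup>2 \<le> smooth_gauge \<eta> z"
proof -
  let ?p = "smooth_grad \<eta> z"
  have "dist ((1 / \<eta>) *\<^sub>R z) ?p \<le> dist ((1 / \<eta>) *\<^sub>R z) s"
    unfolding smooth_grad_def by (rule closest_point_le[OF polar_closed assms(2)])
  then have "(norm ((1 / \<eta>) *\<^sub>R z - ?p))\<^sup>2 \<le> (norm ((1 / \<eta>) *\<^sub>R z - s))\<^sup>2"
    by (intro power_mono) (auto simp: dist_norm)
  then have "(norm ?p)\<^sup>2 - 2 * (?p \<bullet> z) / \<eta> \<le> (norm s)\<^sup>2 - 2 * (s \<bullet> z) / \<eta>"
    unfolding power2_norm_eq_inner by (simp add: inner_diff inner_commute algebra_simps)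
  then have "\<eta> / 2 * ((norm ?p)\<^sup>2 - 2 * (?p \<bullet> z) / \<eta>) \<le> \<eta> / 2 * ((norm s)\<^sup>2 - 2 * (s \<bullet> z) / \<eta>)"
    using assms(1) by (intro mult_left_mono) auto
  then show ?thesis using assms(1) by (simp add: smooth_gauge_def right_diff_distrib)
qed

lemma smooth_gauge_subgradient:
  assumes "0 < \<eta>"
  shows "smooth_gauge \<eta> z + smooth_grad \<eta> z \<bullet> (y - z) \<le> smooth_gauge \<eta> y"
  using smooth_gauge_upper[OF assms smooth_grad_in_polar, of \<eta> z y]
  by (simp add: smooth_gauge_def inner_diff_right)

lemma smooth_gauge_le: "0 < \<eta> \<Longrightarrow> smooth_gauge \<eta> z \<le> minkowski C z"
  using inner_le_minkowski[OF smooth_grad_in_polar, of \<eta> z z]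
  by (auto simp: smooth_gauge_def intro: order_trans[rotated])

lemma minkowski_le_smooth_gauge:
  assumes "0 < \<eta>"
  shows "minkowski C z \<le> smooth_gauge \<eta> z + \<eta> / (2 * r\<^sup>2)"
proof (rule minkowski_le)
  fix s assume s: "s \<in> polar C"
  have "(norm s)\<^sup>2 \<le> (1 / r)\<^sup>2"
    using norm_polar_le[OF s] by (intro power_mono) auto
  then have "\<eta> / 2 * (norm s)\<^sup>2 \<le> \<eta> / 2 * (1 / r)\<^sup>2"
    using assms by (intro mult_left_mono) auto
  then show "s \<bullet> z \<le> smooth_gauge \<eta> z + \<eta> / (2 * r\<^sup>2)"
    using smooth_gauge_upper[OF assms s, of z] by (simp add: power_divide)
qed

text \<open>The linearisation error at \<open>z\<close> is nonnegative by the subgradient inequality at \<open>z\<close>. By the one at \<open>y\<close>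
  it is at most the change of the gradient, which is continuous, times the distance of \<open>y\<close> and \<open>z\<close>.\<close>

lemma smooth_gauge_has_derivative:
  assumes "0 < \<eta>"
  shows "(smooth_gauge \<eta> has_derivative (\<lambda>h. smooth_grad \<eta> z \<bullet> h)) (at z)"
proof -
  let ?F = "smooth_gauge \<eta>" and ?p = "smooth_grad \<eta>"
  have p: "((\<lambda>y. norm (?p y - ?p z)) \<longlongrightarrow> 0) (at z)"
    using continuous_smooth_grad[of UNIV \<eta>]
    by (simp add: continuous_on_def tendsto_norm_zero_iff LIM_zero_iff)
  have le: "norm (?F y - ?F z - ?p z \<bullet> (y - z)) / norm (y - z) \<le> norm (?p y - ?p z)" for y
  proof -
    have "?F y - ?F z - ?p z \<bullet> (y - z) \<le> (?p y - ?p z) \<bullet> (y - z)"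
      using smooth_gauge_subgradient[OF assms, of y z]
      by (simp add: inner_diff_left inner_diff_right)
    also have "\<dots> \<le> norm (?p y - ?p z) * norm (y - z)" by (rule norm_cauchy_schwarz)
    finally have "norm (?F y - ?F z - ?p z \<bullet> (y - z)) \<le> norm (?p y - ?p z) * norm (y - z)"
      using smooth_gauge_subgradient[OF assms, of z y] by simp
    then show ?thesis by (cases "y = z") (auto simp: field_simps)
  qed
  have lim: "((\<lambda>y. norm (?F y - ?F z - ?p z \<bullet> (y - z)) / norm (y - z)) \<longlongrightarrow> 0) (at z)"
    by (rule Lim_null_comparison[OF _ p]) (use le in simp)
  show ?thesis
    by (rule has_derivativeI_sandwich[where e = 1, OF _ _ _ lim]) (auto intro: bounded_linear_inner_right)
qed

end

section \<open>The approximate gauge by bisection\<close>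

lemma while_eq_funpow:
  assumes "\<And>j. j < k \<Longrightarrow> b ((c ^^ j) s)" "\<not> b ((c ^^ k) s)"
  shows "while b c s = (c ^^ k) s"
  using assms
proof (induction k arbitrary: s)
  case 0
  then show ?case by (subst while_unfold) simp
next
  case (Suc k)
  have "while b c (c s) = (c ^^ k) (c s)"
    using Suc.prems by (intro Suc.IH) (force simp: funpow_swap1)+
  moreover have "b s" using Suc.prems(1)[of 0] by simp
  ultimately show ?case by (subst while_unfold) (simp add: funpow_swap1)
qed

text \<open>The loop body of \<^const>\<open>gau\<close> for the membership test \<open>Q\<close> at a fixed tolerance.\<close>

definition bisect_step :: "('v::real_inner \<Rightarrow> bool) \<Rightarrow> 'v \<Rightarrow> real \<times> real \<times> real \<Rightarrow> real \<times> real \<times> real" where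
  "bisect_step Q w = (\<lambda>(\<alpha>, \<beta>, \<mu>). let (\<alpha>', \<beta>') = (if Q (\<mu> *\<^sub>R w) then (\<mu>, \<beta>) else (\<alpha>, \<mu>))
     in (\<alpha>', \<beta>', (\<alpha>' + \<beta>') / 2))"

definition bisect_lower :: "('v::real_inner \<Rightarrow> bool) \<Rightarrow> 'v \<Rightarrow> nat \<Rightarrow> real" where
  "bisect_lower Q w k = fst ((bisect_step Q w ^^ k) (0, 2, 1))"

lemma bisect_invariant:
  assumes "\<not> Q (2 *\<^sub>R w)"
  shows "\<exists>\<alpha> \<beta>. (bisect_step Q w ^^ k) (0, 2, 1) = (\<alpha>, \<beta>, (\<alpha> + \<beta>) / 2) \<and> \<beta> - \<alpha> = 2 / 2 ^ k
    \<and> 0 \<le> \<alpha> \<and> \<beta> \<le> 2 \<and> (\<alpha> = 0 \<or> Q (\<alpha> *\<^sub>R w)) \<and> \<not> Q (\<beta> *\<^sub>R w)"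
proof (induction k)
  case 0
  then show ?case using assms by simp
next
  case (Suc k)
  then obtain \<alpha> \<beta> where s: "(bisect_step Q w ^^ k) (0, 2, 1) = (\<alpha>, \<beta>, (\<alpha> + \<beta>) / 2)"
    and inv: "\<beta> - \<alpha> = 2 / 2 ^ k" "0 \<le> \<alpha>" "\<beta> \<le> 2" "\<alpha> = 0 \<or> Q (\<alpha> *\<^sub>R w)" "\<not> Q (\<beta> *\<^sub>R w)"
    by blast
  have "0 < \<beta> - \<alpha>" unfolding inv(1) by simp
  define \<mu> where "\<mu> = (\<alpha> + \<beta>) / 2"
  have \<mu>: "\<beta> - \<mu> = 2 / 2 ^ Suc k" "\<mu> - \<alpha> = 2 / 2 ^ Suc k" "0 \<le> \<mu>" "\<mu> \<le> 2"
    using inv(1-3) \<open>0 < \<beta> - \<alpha>\<close> by (auto simp: \<mu>_def field_simps)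
  have step: "(bisect_step Q w ^^ Suc k) (0, 2, 1) = bisect_step Q w (\<alpha>, \<beta>, \<mu>)"
    by (simp add: s \<mu>_def)
  show ?case
  proof (cases "Q (\<mu> *\<^sub>R w)")
    case True
    then show ?thesis unfolding step using inv \<mu> by (auto simp: bisect_step_def)
  next
    case False
    then show ?thesis unfolding step using inv \<mu> by (auto simp: bisect_step_def)
  qed
qed

definition bisect_rounds :: "real \<Rightarrow> nat" where
  "bisect_rounds \<tau> = (LEAST k. 2 / 2 ^ k \<le> \<tau>)"

lemma bisect_rounds:
  assumes "0 < \<tau>"
  shows "2 / 2 ^ bisect_rounds \<tau> \<le> \<tau>" "k < bisect_rounds \<tau> \<Longrightarrow> \<tau> < 2 / 2 ^ k"
proof -
  obtain n where "(1 / 2 :: real) ^ n < \<tau> / 2"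
    using real_arch_pow_inv[of "\<tau> / 2" "1 / 2"] assms by auto
  then have "2 / 2 ^ n \<le> \<tau>" by (simp add: power_one_over field_simps)
  then show "2 / 2 ^ bisect_rounds \<tau> \<le> \<tau>" unfolding bisect_rounds_def by (rule LeastI)
  show "k < bisect_rounds \<tau> \<Longrightarrow> \<tau> < 2 / 2 ^ k"
    unfolding bisect_rounds_def using not_less_Least[of k] by force
qed

text \<open>The width of the search interval does not depend on the answers of the oracle, so neither does the
  number of rounds. This removes the loop and exhibits the approximate gauge as a finite composition
  of measurable maps.\<close>

lemma gau_eq_bisect_lower:
  fixes MEM :: "'v::real_inner \<Rightarrow> real \<Rightarrow> bool"
  assumes "0 < r" "0 < R" "0 < \<delta>"
  defines "\<tau> \<equiv> \<delta> / (8 * (R / r)\<^sup>2)" and "\<epsilon> \<equiv> \<delta> * r / (4 * (R / r))\<^sup>2"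
  shows "gau MEM r R w \<delta> = (if MEM (2 *\<^sub>R w) \<epsilon> \<or> norm w \<le> r / 2 then 0
    else inverse (bisect_lower (\<lambda>y. MEM y \<epsilon>) w (bisect_rounds \<tau>) - \<tau>))"
proof (cases "MEM (2 *\<^sub>R w) \<epsilon> \<or> norm w \<le> r / 2")
  case True
  then show ?thesis unfolding gau_def Let_def \<epsilon>_def[symmetric] by simp
next
  case False
  let ?Q = "\<lambda>y. MEM y \<epsilon>" and ?b = "\<lambda>(\<alpha>, \<beta>, \<mu>::real). \<tau> < \<beta> - (\<alpha>::real)"
  have \<tau>: "0 < \<tau>" using assms by (simp add: \<tau>_def)
  have b: "?b ((bisect_step ?Q w ^^ k) (0, 2, 1)) \<longleftrightarrow> \<tau> < 2 / 2 ^ k" for k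
    using bisect_invariant[of ?Q w k] False by auto
  have "while ?b (bisect_step ?Q w) (0, 2, 1) = (bisect_step ?Q w ^^ bisect_rounds \<tau>) (0, 2, 1)"
    using bisect_rounds[OF \<tau>] by (intro while_eq_funpow) (auto simp only: b not_less)
  then show ?thesis
    using False
    unfolding gau_def Let_def \<epsilon>_def[symmetric] \<tau>_def[symmetric] bisect_lower_def
    by (simp add: bisect_step_def[abs_def] Let_def case_prod_beta)
qed

lemma measurable_bisect_lower:
  fixes Q :: "real^'n \<Rightarrow> bool"
  assumes [measurable]: "Measurable.pred borel Q"
  shows "(\<lambda>w. bisect_lower Q w k) \<in> borel_measurable borel"
proof -
  have "(\<lambda>w. (bisect_step Q w ^^ k) (0, 2, 1)) \<in> borel \<rightarrow>\<^sub>M (borel \<Otimes>\<^sub>M borel \<Otimes>\<^sub>M borel)"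
  proof (induction k)
    case 0
    then show ?case by simp
  next
    case (Suc k)
    note [measurable] = Suc
    let ?s = "\<lambda>w. (bisect_step Q w ^^ k) (0, 2, 1)"
    have "(bisect_step Q w ^^ Suc k) (0, 2, 1) =
        (if Q (snd (snd (?s w)) *\<^sub>R w)
         then (snd (snd (?s w)), fst (snd (?s w)), (snd (snd (?s w)) + fst (snd (?s w))) / 2)
         else (fst (?s w), snd (snd (?s w)), (fst (?s w) + snd (snd (?s w))) / 2))" for w
      by (simp add: bisect_step_def split_beta)
    then show ?case by simp
  qed
  note [measurable] = this
  show ?thesis unfolding bisect_lower_def by measurable
qed

lemma measurable_gau:
  fixes MEM :: "real^'n \<Rightarrow> real \<Rightarrow> bool"
  assumes meas: "\<And>\<epsilon>. \<epsilon> > 0 \<Longrightarrow> {y. MEM y \<epsilon>} \<in> sets borel"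
    and "0 < r" "0 < R" "0 < \<delta>"
  shows "(\<lambda>w. gau MEM r R w \<delta>) \<in> borel_measurable borel"
proof -
  define \<epsilon> where "\<epsilon> = \<delta> * r / (4 * (R / r))\<^sup>2"
  have "0 < \<epsilon>" using assms by (simp add: \<epsilon>_def)
  then have Q[measurable]: "Measurable.pred borel (\<lambda>y. MEM y \<epsilon>)"
    using meas by (simp add: pred_def)
  note [measurable] = measurable_bisect_lower[OF Q]
  show ?thesis
    unfolding gau_eq_bisect_lower[OF assms(2-4)] \<epsilon>_def[symmetric] by measurable
qed

locale membership_body = convex_body C r R
  for C :: "'v::euclidean_space set" and r R +
  fixes MEM :: "'v \<Rightarrow> real \<Rightarrow> bool"
  assumes oracle_approx: "approx_membership_oracle C MEM"
begin

lemma minkowski_mem_le: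
  assumes "MEM w \<epsilon>" "0 < \<epsilon>"
  shows "minkowski C w \<le> 1 + \<epsilon> / r"
  using assms oracle_approx by (intro minkowski_enlarge_le) (auto simp: approx_membership_oracle_def)

lemma less_minkowski_not_mem:
  assumes "\<not> MEM w \<epsilon>" "0 < \<epsilon>"
  shows "1 - \<epsilon> / r < minkowski C w"
  using assms oracle_approx by (intro less_minkowski_if_not_shrink) (auto simp: approx_membership_oracle_def)

text \<open>Let \<open>\<tau> = \<delta> / (8 * (R / r)\<^sup>2)\<close> and let \<open>g\<close> be the gauge of \<open>w\<close>. The tolerance of the oracle is \<open>\<tau> * r / 2\<close>,
  so for the ends \<open>\<alpha>\<close> and \<open>\<beta>\<close> of the final interval \<open>\<alpha> * g \<le> 1 + \<tau> / 2\<close> and \<open>1 - \<tau> / 2 < \<beta> * g\<close>, while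
  \<open>\<beta> - \<alpha> \<le> \<tau>\<close>. Subtracting \<open>\<tau>\<close> from \<open>\<alpha>\<close> absorbs the error of the upper estimate as soon as \<open>1 / 2 \<le> g\<close>,
  which makes the output an upper bound of \<open>g\<close>. The radius \<open>6 / 5 * R\<close> leaves room for the
  perturbations of a query point; there \<open>g\<close> is at most \<open>6 / 5 * R / r\<close>, so that inverting loses
  only a multiple of \<open>\<tau> * g\<^sup>2\<close>, hence of \<open>\<delta>\<close>.\<close>

lemma gau_accuracy:
  assumes w: "norm w \<le> 6 / 5 * R" and \<delta>: "0 < \<delta>" "\<delta> < 1 / 3"
  shows "gau MEM r R w \<delta> = 0 \<and> minkowski C w \<le> 11 / 20 \<or>
    0 < gau MEM r R w \<delta> \<and> gau MEM r R w \<delta> \<le> minkowski C w + \<delta> \<and>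
      (minkowski C w \<le> 1 / 2 \<or> minkowski C w \<le> gau MEM r R w \<delta>) \<and>
      (gau MEM r R w \<delta> < 1 \<longrightarrow> minkowski C w \<le> 1)"
proof -
  define \<kappa> where "\<kappa> = R / r"
  define \<tau> where "\<tau> = \<delta> / (8 * \<kappa>\<^sup>2)"
  define \<epsilon> where "\<epsilon> = \<delta> * r / (4 * \<kappa>)\<^sup>2"
  define g where "g = minkowski C w"
  note gau_eq = gau_eq_bisect_lower[OF r_pos R_pos \<delta>(1), folded \<kappa>_def, folded \<tau>_def \<epsilon>_def]
  have \<kappa>: "1 \<le> \<kappa>" using r_pos r_le_R by (simp add: \<kappa>_def)
  have \<tau>: "0 < \<tau>" using \<delta> \<kappa> by (simp add: \<tau>_def)
  have \<tau>\<kappa>: "8 * \<kappa>\<^sup>2 * \<tau> = \<delta>" using \<kappa> by (simp add: \<tau>_def)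
  have "\<kappa> \<le> \<kappa>\<^sup>2" using \<kappa> by (simp add: power2_eq_square)
  have "1 * \<tau> \<le> \<kappa> * \<tau>" "\<kappa> * \<tau> \<le> \<kappa>\<^sup>2 * \<tau>"
    using \<kappa> \<tau> \<open>\<kappa> \<le> \<kappa>\<^sup>2\<close> by (intro mult_right_mono; simp)+
  then have \<tau>_le: "\<tau> \<le> \<kappa> * \<tau>" "\<kappa> * \<tau> \<le> \<delta> / 8" "\<tau> \<le> \<delta> / 8" "\<tau> < 1 / 24" "\<kappa> * \<tau> < 1 / 24"
    using \<tau>\<kappa> \<delta> by linarith+
  have \<epsilon>: "0 < \<epsilon>" "\<epsilon> / r = \<tau> / 2"
    using r_pos \<delta> \<kappa> by (simp_all add: \<epsilon>_def \<tau>_def power2_eq_square field_simps)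
  have g_nonneg: "0 \<le> g" unfolding g_def by (rule minkowski_nonneg)
  have g_norm: "g \<le> norm w / r" unfolding g_def by (rule minkowski_le_norm)
  also have "\<dots> \<le> 6 / 5 * R / r" using w r_pos by (intro divide_right_mono) auto
  finally have g_le: "g \<le> 6 / 5 * \<kappa>" by (simp add: \<kappa>_def)
  show ?thesis
  proof (cases "MEM (2 *\<^sub>R w) \<epsilon> \<or> norm w \<le> r / 2")
    case True
    then have "gau MEM r R w \<delta> = 0"
      unfolding gau_eq by simp
    moreover have "g \<le> 11 / 20"
      using True
    proof
      assume "MEM (2 *\<^sub>R w) \<epsilon>"
      then have "2 * g \<le> 1 + \<tau> / 2"
        using minkowski_mem_le[of "2 *\<^sub>R w" \<epsilon>] \<epsilon> by (simp add: minkowski_scale g_def)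
      then show ?thesis using \<tau>_le by linarith
    next
      assume "norm w \<le> r / 2"
      then have "norm w / r \<le> 1 / 2" using r_pos by (simp add: field_simps)
      then show ?thesis using g_norm by linarith
    qed
    ultimately show ?thesis unfolding g_def by blast
  next
    case False
    define \<alpha> where "\<alpha> = bisect_lower (\<lambda>y. MEM y \<epsilon>) w (bisect_rounds \<tau>)"
    have gau: "gau MEM r R w \<delta> = inverse (\<alpha> - \<tau>)"
      unfolding gau_eq \<alpha>_def using False by simp
    obtain \<beta> where \<beta>: "\<beta> - \<alpha> = 2 / 2 ^ bisect_rounds \<tau>"
      and \<alpha>\<beta>: "0 \<le> \<alpha>" "\<alpha> = 0 \<or> MEM (\<alpha> *\<^sub>R w) \<epsilon>" "\<not> MEM (\<beta> *\<^sub>R w) \<epsilon>"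
      using bisect_invariant[of "\<lambda>y. MEM y \<epsilon>" w "bisect_rounds \<tau>"] False
      by (auto simp: \<alpha>_def bisect_lower_def)
    have width: "0 < \<beta> - \<alpha>" "\<beta> - \<alpha> \<le> \<tau>"
      unfolding \<beta> using bisect_rounds(1)[OF \<tau>] by simp_all
    have "\<alpha> = 0 \<or> \<alpha> * g \<le> 1 + \<tau> / 2"
      using \<alpha>\<beta>(1,2) minkowski_mem_le[of "\<alpha> *\<^sub>R w" \<epsilon>] \<epsilon> by (auto simp: minkowski_scale g_def)
    then have \<alpha>g: "\<alpha> * g \<le> 1 + \<tau> / 2" using \<tau> by auto
    have \<beta>_nonneg: "0 \<le> \<beta>" using \<alpha>\<beta>(1) width(1) by linarith
    have \<beta>g: "1 - \<tau> / 2 < \<beta> * g"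
      using less_minkowski_not_mem[OF \<alpha>\<beta>(3) \<epsilon>(1)] \<epsilon> \<beta>_nonneg by (simp add: minkowski_scale g_def)
    then have "0 < \<beta> * g" using \<tau>_le by linarith
    then have g_pos: "0 < g" using g_nonneg by (cases "g = 0") auto
    have \<tau>g: "\<tau> * g \<le> 6 / 5 * (\<kappa> * \<tau>)" using mult_left_mono[OF g_le, of \<tau>] \<tau> by (simp add: algebra_simps)
    have "\<tau> * g * g \<le> 6 / 5 * (\<kappa> * \<tau>) * (6 / 5 * \<kappa>)"
      using mult_mono[OF \<tau>g g_le] g_nonneg \<tau> \<kappa> by simp
    then have \<tau>gg: "\<tau> * g * g \<le> 9 / 50 * \<delta>" using \<tau>\<kappa> by (simp add: power2_eq_square algebra_simps)
    have "(\<beta> - \<alpha>) * g \<le> \<tau> * g" using width(2) g_nonneg by (rule mult_right_mono)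
    then have low: "1 - \<tau> / 2 - 2 * (\<tau> * g) < (\<alpha> - \<tau>) * g"
      using \<beta>g by (simp add: algebra_simps)
    moreover have "\<tau> / 2 + 2 * (\<tau> * g) \<le> 1 / 8" using \<tau>_le \<tau>g by linarith
    ultimately have "0 < (\<alpha> - \<tau>) * g" by linarith
    then have pos: "0 < \<alpha> - \<tau>" using g_pos by (simp add: zero_less_mult_iff)
    have upper: "inverse (\<alpha> - \<tau>) \<le> g + \<delta>"
    proof -
      have "(\<tau> * g) / 2 + 2 * (\<tau> * g * g) \<le> \<delta> * (7 / 8)"
        using \<tau>g \<tau>gg \<tau>_le \<delta> by linarith
      also have "\<dots> \<le> \<delta> * (1 - \<tau> / 2 - 2 * (\<tau> * g))"
        using \<delta> \<open>\<tau> / 2 + 2 * (\<tau> * g) \<le> 1 / 8\<close> by (intro mult_left_mono) auto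
      also have "\<dots> = (g + \<delta>) * (1 - \<tau> / 2 - 2 * (\<tau> * g)) - g + ((\<tau> * g) / 2 + 2 * (\<tau> * g * g))"
        by (simp add: field_simps)
      finally have "g \<le> (g + \<delta>) * (1 - \<tau> / 2 - 2 * (\<tau> * g))"
        by linarith
      also have "\<dots> \<le> (g + \<delta>) * ((\<alpha> - \<tau>) * g)"
        using low \<delta> g_nonneg by (intro mult_left_mono) auto
      finally have "1 \<le> (g + \<delta>) * (\<alpha> - \<tau>)" using g_pos by (simp add: mult.assoc[symmetric])
      then show ?thesis using pos by (simp add: inverse_eq_divide pos_divide_le_eq)
    qed
    have "g \<le> inverse (\<alpha> - \<tau>)" if "1 / 2 < g"
    proof -
      have "\<tau> / 2 \<le> \<tau> * g" using that \<tau> by simp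
      then have "g * (\<alpha> - \<tau>) \<le> 1" using \<alpha>g by (simp add: algebra_simps)
      then show ?thesis using pos by (simp add: inverse_eq_divide pos_le_divide_eq)
    qed
    moreover have "g \<le> 1" if "inverse (\<alpha> - \<tau>) < 1"
    proof -
      have "1 + \<tau> < \<alpha>" using that pos by (simp add: inverse_eq_divide)
      then have "(1 + \<tau>) * g \<le> 1 + \<tau> / 2"
        using \<alpha>g mult_right_mono[of "1 + \<tau>" \<alpha> g] g_nonneg by linarith
      also have "\<dots> \<le> (1 + \<tau>) * 1" using \<tau> by simp
      finally show ?thesis using \<tau> by (subst (asm) mult_le_cancel_left_pos) auto
    qed
    ultimately have "g \<le> 1 / 2 \<or> g \<le> inverse (\<alpha> - \<tau>)"
      and "inverse (\<alpha> - \<tau>) < 1 \<longrightarrow> g \<le> 1" by linarith+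
    moreover have "0 < inverse (\<alpha> - \<tau>)" using pos by simp
    ultimately show ?thesis
      using upper unfolding gau g_def by blast
  qed
qed

end

section \<open>Regret of proximal FTRL\<close>

lemma ftrl_weights:
  fixes gs :: "'v::euclidean_space list" and D :: real
  defines "st \<equiv> foldl (ftrl_step D) ftrl_init gs"
  shows "sum_grads st = sum_list gs" "sum_squares st = (\<Sum>g\<leftarrow>gs. (norm g)\<^sup>2)"
    "sum_weights st = sqrt (sum_squares st) / (sqrt 2 * D)"
  unfolding st_def
  by (induction gs rule: rev_induct) (simp_all add: ftrl_init_def ftrl_step_def Let_def ftrl_rate_def)

text \<open>Up to a constant this is the linear loss received so far plus the proximal regularisers
  \<open>\<sigma>\<^sub>s / 2 * (norm (w - w\<^sub>s))\<^sup>2\<close>, with the squares expanded.\<close>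

definition ftrl_objective :: "'v::euclidean_space ftrl_state \<Rightarrow> 'v \<Rightarrow> real" where
  "ftrl_objective st w =
     (sum_grads st - weighted_outputs st) \<bullet> w + sum_weights st / 2 * (norm w)\<^sup>2"

text \<open>Completing the square, the objective is a multiple of the squared distance to its unconstrained
  minimiser. Its minimiser over the ball is therefore the projection of that point, and the obtuse
  angle at the projection gives the quadratic growth. With zero weight all gradients
  received so far vanish, and so does the objective.\<close>

lemma ftrl_objective_min:
  fixes gs :: "'v::euclidean_space list" and D :: real
  defines "st \<equiv> foldl (ftrl_step D) ftrl_init gs"
  assumes D: "0 < D" and w: "w \<in> cball 0 D"
  shows "ftrl_objective st (ftrl_output st) + sum_weights st / 2 * (norm (w - ftrl_output st))\<^sup>2
    \<le> ftrl_objective st w"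
proof (cases gs rule: rev_cases)
  case Nil
  then show ?thesis by (simp add: st_def ftrl_init_def ftrl_objective_def)
next
  case (snoc hs h)
  let ?S = "sum_weights st" and ?L = "sum_grads st - weighted_outputs st" and ?w = "ftrl_output st"
  define c where "c = (1 / ?S) *\<^sub>R (- sum_grads st + weighted_outputs st)"
  have out: "?w = (if ?S = 0 then 0 else closest_point (cball 0 D) c)"
    by (simp add: st_def snoc ftrl_step_def Let_def c_def)
  have S: "?S = sqrt (sum_squares st) / (sqrt 2 * D)" and V: "sum_squares st = (\<Sum>g\<leftarrow>gs. (norm g)\<^sup>2)"
    unfolding st_def by (rule ftrl_weights)+
  have "0 \<le> sum_squares st" unfolding V by (intro sum_list_nonneg) auto
  then have S_nonneg: "0 \<le> ?S" unfolding S using D by auto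
  show ?thesis
  proof (cases "?S = 0")
    case True
    then have V0: "sum_squares st = 0" using S D by simp
    have "\<forall>g\<in>set gs. g = 0"
      using V0 unfolding V by (subst (asm) sum_list_nonneg_eq_0_iff) auto
    then have zero: "foldl (ftrl_step D) ftrl_init gs = (ftrl_init :: 'v ftrl_state)"
      by (induction gs)
        (auto simp: ftrl_step_def ftrl_init_def Let_def ftrl_rate_def)
    then have "st = ftrl_init" by (simp only: st_def)
    then show ?thesis by (simp add: ftrl_init_def ftrl_objective_def)
  next
    case False
    then have "0 < ?S" using S_nonneg by simp
    have L: "?L = - ?S *\<^sub>R c" using False by (simp add: c_def)
    have "(c - ?w) \<bullet> (w - ?w) \<le> 0"
      using closest_point_dot[of "cball 0 D" w c] w D False unfolding out by auto
    then have "0 \<le> ?S * ((?w - c) \<bullet> (w - ?w))"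
      using \<open>0 < ?S\<close> by (auto simp: zero_le_mult_iff inner_diff_left)
    moreover have "ftrl_objective st w - ftrl_objective st ?w - ?S / 2 * (norm (w - ?w))\<^sup>2
        = ?S * ((?w - c) \<bullet> (w - ?w))"
      unfolding ftrl_objective_def L power2_norm_eq_inner
      by (simp add: inner_diff inner_commute algebra_simps add_divide_distrib diff_divide_distrib)
    ultimately show ?thesis by linarith
  qed
qed

lemma ftrl_output_in_ball:
  assumes "0 < D"
  shows "ftrl_proximal D gs \<in> cball 0 D"
proof -
  have cp: "closest_point (cball 0 D) c \<in> cball 0 D" for c :: 'a
    using assms by (intro closest_point_in_set) auto
  have z: "(0::'a) \<in> cball 0 D" using assms by simp
  show ?thesis
    by (cases gs rule: rev_cases)
      (simp_all add: ftrl_proximal_def ftrl_init_def ftrl_step_def Let_def cp z assms less_imp_le del: mem_cball mem_cball_0)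
qed

definition ftrl_loss :: "real \<Rightarrow> 'v::euclidean_space list \<Rightarrow> real" where
  "ftrl_loss D gs = (\<Sum>k<length gs. gs ! k \<bullet> ftrl_proximal D (take k gs))"

lemma ftrl_loss_snoc: "ftrl_loss D (gs @ [g]) = ftrl_loss D gs + g \<bullet> ftrl_proximal D gs"
proof -
  have "(\<Sum>k<length gs. (gs @ [g]) ! k \<bullet> ftrl_proximal D (take k (gs @ [g]))) = ftrl_loss D gs"
    unfolding ftrl_loss_def by (intro sum.cong) (auto simp: nth_append)
  then show ?thesis by (simp add: ftrl_loss_def)
qed

text \<open>One step changes the objective by \<open>g \<bullet> x + \<sigma> / 2 * (norm (x - w))\<^sup>2\<close> up to a constant, which \<open>c\<close>
  accumulates. At points of the ball the regularisers sum to at most \<open>(2 * D)\<^sup>2 / 2\<close> times the total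
  weight. For the lower bound, the new regulariser and the growth around the old output together have
  curvature \<open>1 / \<eta>\<close> for the new step size, so moving away from the old output gains at most
  \<open>\<eta> / 2 * (norm g)\<^sup>2\<close>; these gains telescope with the square roots of the sums of squares.\<close>

lemma ftrl_potential:
  fixes gs :: "'v::euclidean_space list" and D :: real
  assumes D: "0 < D"
  defines "st \<equiv> foldl (ftrl_step D) ftrl_init gs"
  shows "\<exists>c. ftrl_loss D gs \<le> ftrl_objective st (ftrl_output st) + c + sqrt 2 * D * sqrt (sum_squares st)
    \<and> (\<forall>x\<in>cball 0 D. ftrl_objective st x + c \<le> sum_grads st \<bullet> x + 2 * D\<^sup>2 * sum_weights st)"
  unfolding st_def
proof (induction gs rule: rev_induct)
  case Nil
  show ?case
    by (rule exI[of _ 0]) (simp add: ftrl_loss_def ftrl_objective_def ftrl_init_def)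
next
  case (snoc g gs)
  define st where "st = foldl (ftrl_step D) ftrl_init gs"
  define st' where "st' = ftrl_step D st g"
  define w where "w = ftrl_output st"
  define w' where "w' = ftrl_output st'"
  define V where "V = sum_squares st"
  define S where "S = sum_weights st"
  define V' where "V' = V + (norm g)\<^sup>2"
  define S' where "S' = sqrt V' / (sqrt 2 * D)"
  define \<sigma> where "\<sigma> = S' - S"
  have fold: "foldl (ftrl_step D) ftrl_init (gs @ [g]) = st'" by (simp add: st_def st'_def)
  have V_nonneg: "0 \<le> V"
    unfolding V_def st_def ftrl_weights by (intro sum_list_nonneg) auto
  have S: "S = sqrt V / (sqrt 2 * D)" by (simp add: S_def V_def st_def ftrl_weights(3))
  have \<sigma>: "0 \<le> \<sigma>" "S' = S + \<sigma>"
    using D by (auto simp: \<sigma>_def S S'_def V'_def intro!: divide_right_mono)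
  have st': "sum_grads st' = sum_grads st + g" "sum_squares st' = V'" "sum_weights st' = S'"
    "weighted_outputs st' = weighted_outputs st + \<sigma> *\<^sub>R w"
    using D by (auto simp: st'_def ftrl_step_def Let_def ftrl_rate_def V_def V'_def S_def[symmetric] S S'_def
        \<sigma>_def w_def)
  have ball: "w \<in> cball 0 D" "w' \<in> cball 0 D"
    using ftrl_output_in_ball[OF D, of gs] ftrl_output_in_ball[OF D, of "gs @ [g]"] fold
    by (auto simp: ftrl_proximal_def w_def w'_def st_def)
  obtain c where c1: "ftrl_loss D gs \<le> ftrl_objective st w + c + sqrt 2 * D * sqrt V"
    and c2: "\<And>x. x \<in> cball 0 D \<Longrightarrow> ftrl_objective st x + c \<le> sum_grads st \<bullet> x + 2 * D\<^sup>2 * S"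
    using snoc.IH unfolding st_def w_def V_def S_def by blast
  define c' where "c' = c + \<sigma> / 2 * (norm w)\<^sup>2"
  have obj: "ftrl_objective st' y + c' = ftrl_objective st y + c + g \<bullet> y + \<sigma> / 2 * (norm (y - w))\<^sup>2" for y
    unfolding ftrl_objective_def st' c'_def S_def[symmetric] \<sigma>(2) power2_norm_eq_inner
    by (simp add: inner_diff inner_add inner_commute algebra_simps add_divide_distrib diff_divide_distrib)
  have upper: "ftrl_objective st' x + c' \<le> sum_grads st' \<bullet> x + 2 * D\<^sup>2 * S'" if x: "x \<in> cball 0 D" for x
  proof -
    have "norm (x - w) \<le> 2 * D"
      using x ball(1) norm_triangle_ineq4[of x w] by simp
    then have "(norm (x - w))\<^sup>2 \<le> (2 * D)\<^sup>2" by (intro power_mono) auto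
    then have "\<sigma> / 2 * (norm (x - w))\<^sup>2 \<le> \<sigma> / 2 * (2 * D)\<^sup>2"
      using \<sigma>(1) by (intro mult_left_mono) auto
    then show ?thesis
      using c2[OF x] unfolding obj st' \<sigma>(2)
      by (simp add: inner_add_left algebra_simps power2_eq_square)
  qed
  have lower: "ftrl_objective st w + c + g \<bullet> w \<le>
      ftrl_objective st' w' + c' + sqrt 2 * D * (sqrt V' - sqrt V)"
  proof -
    let ?n = "norm (w' - w)"
    have min: "ftrl_objective st w + S / 2 * ?n\<^sup>2 \<le> ftrl_objective st w'"
      using ftrl_objective_min[OF D ball(2), of gs] by (simp add: st_def w_def S_def)
    have cs: "- (norm g * ?n) \<le> g \<bullet> w' - g \<bullet> w"
      using Cauchy_Schwarz_ineq2[of g "w' - w"] by (simp add: inner_diff_right)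
    have defect: "norm g * ?n \<le> S' / 2 * ?n\<^sup>2 + sqrt 2 * D * (sqrt V' - sqrt V)"
    proof (cases "V' = 0")
      case True
      then have "g = 0" "V = 0" using V_nonneg by (auto simp: V'_def add_nonneg_eq_0_iff)
      then show ?thesis using True by (simp add: S'_def)
    next
      case False
      define q where "q = sqrt V'"
      have q: "0 < q" "q\<^sup>2 = V'" using False V_nonneg by (auto simp: q_def V'_def add_nonneg_nonneg order_less_le)
      have v: "(sqrt V)\<^sup>2 = V" using V_nonneg by simp
      have "2 * sqrt V * q \<le> V + V'" using sum_squares_bound[of "sqrt V" q] v q by simp
      then have half: "(norm g)\<^sup>2 / 2 \<le> q * (q - sqrt V)"
        using q by (simp add: V'_def algebra_simps power2_eq_square)
      have S'q: "S' = q / (sqrt 2 * D)" by (simp add: S'_def q_def)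
      have "0 < S'" using q D by (simp add: S'q)
      have "0 \<le> (norm g - S' * ?n)\<^sup>2" by simp
      then have "norm g * ?n * (2 * S') \<le> (norm g)\<^sup>2 + (S' * ?n)\<^sup>2"
        by (simp add: power2_diff algebra_simps)
      then have "norm g * ?n \<le> ((norm g)\<^sup>2 + (S' * ?n)\<^sup>2) / (2 * S')"
        using \<open>0 < S'\<close> by (subst pos_le_divide_eq) auto
      also have "\<dots> = (norm g)\<^sup>2 / (2 * S') + S' / 2 * ?n\<^sup>2"
        using \<open>0 < S'\<close> by (simp add: field_simps power2_eq_square)
      also have "(norm g)\<^sup>2 / (2 * S') \<le> q * (q - sqrt V) / S'"
        using divide_right_mono[OF half, of S'] \<open>0 < S'\<close> by simp
      also have "\<dots> = sqrt 2 * D * (q - sqrt V)" using q D by (simp add: S'q)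
      finally show ?thesis by (simp add: q_def)
    qed
    have "S' / 2 * ?n\<^sup>2 = S / 2 * ?n\<^sup>2 + \<sigma> / 2 * ?n\<^sup>2"
      unfolding \<sigma>(2) by (simp add: algebra_simps add_divide_distrib)
    then show ?thesis using min cs defect unfolding obj by linarith
  qed
  have "ftrl_loss D (gs @ [g]) = ftrl_loss D gs + g \<bullet> w"
    by (simp add: ftrl_loss_snoc ftrl_proximal_def w_def st_def)
  then have "ftrl_loss D (gs @ [g]) \<le> ftrl_objective st' w' + c' + sqrt 2 * D * sqrt V'"
    using c1 lower by (simp add: algebra_simps)
  then show ?case using upper unfolding fold by (auto simp: w'_def st'(2,3))
qed

lemma ftrl_regret:
  fixes gs :: "'v::euclidean_space list"
  assumes D: "0 < D" and x: "norm x \<le> D"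
  shows "ftrl_loss D gs - sum_list gs \<bullet> x \<le> 2 * sqrt 2 * D * sqrt (\<Sum>g\<leftarrow>gs. (norm g)\<^sup>2)"
proof -
  define st where "st = foldl (ftrl_step D) ftrl_init gs"
  note W = ftrl_weights[of D gs, folded st_def]
  obtain c where c1: "ftrl_loss D gs \<le> ftrl_objective st (ftrl_output st) + c + sqrt 2 * D * sqrt (sum_squares st)"
    and c2: "\<And>x. x \<in> cball 0 D \<Longrightarrow> ftrl_objective st x + c \<le> sum_grads st \<bullet> x + 2 * D\<^sup>2 * sum_weights st"
    using ftrl_potential[OF D, of gs] unfolding st_def by blast
  have xb: "x \<in> cball 0 D" using x by simp
  have "0 \<le> sum_squares st" unfolding W by (intro sum_list_nonneg) auto
  then have "0 \<le> sum_weights st / 2 * (norm (x - ftrl_output st))\<^sup>2"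
    unfolding W(3) using D by simp
  then have "ftrl_objective st (ftrl_output st) \<le> ftrl_objective st x"
    using ftrl_objective_min[OF D xb, of gs] unfolding st_def by linarith
  moreover have "2 * D\<^sup>2 * sum_weights st = sqrt 2 * D * sqrt (sum_squares st)"
    unfolding W(3) using D by (simp add: power2_eq_square field_simps)
  ultimately show ?thesis
    using c1 c2[OF xb] unfolding W(1,2) by simp
qed

section \<open>Redrawing one coordinate\<close>

text \<open>The substitute for conditioning on all coordinates but one, also in infinite products: instead of
  taking a conditional expectation, that coordinate is redrawn from its own distribution. Splitting off
  the coordinate \<open>j\<close> on both sides, its original value on the left is overwritten and integrates to \<open>1\<close>.\<close>

lemma nn_integral_PiM_resample:
  assumes prob: "\<And>i. prob_space (M i)" and j: "j \<in> I"
    and [measurable]: "f \<in> borel_measurable (PiM I M)"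
  shows "(\<integral>\<^sup>+X. \<integral>\<^sup>+x. f (X(j := x)) \<partial>M j \<partial>PiM I M) = (\<integral>\<^sup>+X. f X \<partial>PiM I M)"
proof -
  define J where "J = I - {j}"
  have I: "I = insert j J" and j': "j \<notin> J" using j by (auto simp: J_def)
  interpret j: prob_space "M j" by (rule prob)
  interpret J: prob_space "PiM J M" by (intro prob_space_PiM prob)
  interpret pair_sigma_finite "M j" "PiM J M" ..
  interpret I: prob_space "PiM I M" by (intro prob_space_PiM prob)
  have split: "(\<integral>\<^sup>+X. h X \<partial>PiM I M) = (\<integral>\<^sup>+x. \<integral>\<^sup>+X. h (X(j := x)) \<partial>PiM J M \<partial>M j)"
    if [measurable]: "h \<in> borel_measurable (PiM I M)" for h
  proof -
    have merge[measurable]: "(\<lambda>(x, X). X(j := x)) \<in> (M j \<Otimes>\<^sub>M PiM J M) \<rightarrow>\<^sub>M PiM I M"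
      unfolding I by measurable
    have "(\<integral>\<^sup>+X. h X \<partial>PiM I M) =
        (\<integral>\<^sup>+X. h X \<partial>distr (M j \<Otimes>\<^sub>M PiM J M) (PiM I M) (\<lambda>(x, X). X(j := x)))"
      unfolding I using distr_pair_PiM_eq_PiM[of J M j] prob by simp
    also have "\<dots> = (\<integral>\<^sup>+p. h (case p of (x, X) \<Rightarrow> X(j := x)) \<partial>(M j \<Otimes>\<^sub>M PiM J M))"
      by (intro nn_integral_distr) measurable
    also have "\<dots> = (\<integral>\<^sup>+x. \<integral>\<^sup>+X. h (X(j := x)) \<partial>PiM J M \<partial>M j)"
      by (subst J.nn_integral_fst[symmetric]) auto
    finally show ?thesis .
  qed
  have redraw1[measurable]: "(\<lambda>(X, x). X(j := x)) \<in> (PiM I M \<Otimes>\<^sub>M M j) \<rightarrow>\<^sub>M PiM I M"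
    using j by (intro measurable_PiM_single') (auto simp: space_pair_measure space_PiM PiE_iff extensional_def)
  have redraw2[measurable]: "(\<lambda>(X, x). X(j := x)) \<in> (PiM J M \<Otimes>\<^sub>M M j) \<rightarrow>\<^sub>M PiM I M"
    unfolding I by measurable
  have "(\<integral>\<^sup>+X. \<integral>\<^sup>+x. f (X(j := x)) \<partial>M j \<partial>PiM I M) =
      (\<integral>\<^sup>+y. \<integral>\<^sup>+X. \<integral>\<^sup>+x. f (X(j := x)) \<partial>M j \<partial>PiM J M \<partial>M j)"
    by (subst split) (auto intro!: j.borel_measurable_nn_integral simp: fun_upd_upd)
  also have "\<dots> = (\<integral>\<^sup>+X. \<integral>\<^sup>+x. f (X(j := x)) \<partial>M j \<partial>PiM J M)"
    by (simp add: j.emeasure_space_1)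
  also have "\<dots> = (\<integral>\<^sup>+x. \<integral>\<^sup>+X. f (X(j := x)) \<partial>PiM J M \<partial>M j)"
    by (rule Fubini') measurable
  also have "\<dots> = (\<integral>\<^sup>+X. f X \<partial>PiM I M)" by (rule split[symmetric]) measurable
  finally show ?thesis .
qed

definition set_coord :: "'n \<Rightarrow> real \<Rightarrow> real^'n \<Rightarrow> real^'n" where
  "set_coord i c b = (\<chi> j. if j = i then c else b $ j)"

lemma measurable_vec_lambda:
  fixes f :: "'n::finite \<Rightarrow> 'a \<Rightarrow> real"
  assumes "\<And>j. f j \<in> borel_measurable M"
  shows "(\<lambda>x. \<chi> j. f j x) \<in> borel_measurable M"
proof -
  have "(\<lambda>x. (\<chi> j. f j x) \<bullet> b) \<in> borel_measurable M" if b: "b \<in> Basis" for b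
  proof -
    obtain i where "b = axis i 1" using b by (auto simp: Basis_vec_def Basis_real_def)
    then show ?thesis using assms by (simp add: inner_axis)
  qed
  then show ?thesis by (subst borel_measurable_euclidean_space) auto
qed

lemma measurable_vec_nth[measurable (raw)]:
  fixes f :: "'a \<Rightarrow> real^'n"
  assumes "f \<in> borel_measurable M"
  shows "(\<lambda>x. f x $ i) \<in> borel_measurable M"
proof -
  have "(\<lambda>x. f x \<bullet> axis i 1) \<in> borel_measurable M" using assms by measurable
  then show ?thesis by (simp add: inner_axis)
qed

lemma measurable_set_coord[measurable]:
  fixes i :: "'n::finite"
  shows "(\<lambda>(b, c). set_coord i c b) \<in> borel_measurable (borel \<Otimes>\<^sub>M borel)"
proof -
  have "(\<lambda>p. \<chi> j. if j = i then snd p else fst p $ j) \<in> borel_measurable (borel \<Otimes>\<^sub>M borel :: ((real^'n) \<times> real) measure)"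
    by (intro measurable_vec_lambda) measurable
  then show ?thesis by (simp add: set_coord_def split_beta')
qed

abbreviation unit_interval :: "real measure" where
  "unit_interval \<equiv> uniform_measure lborel {-1..1}"

lemma sets_linf_ball[measurable]: "linf_ball u \<nu> \<in> sets borel"
  by (simp add: linf_ball_eq_cbox)

lemma mem_linf_ball: "x \<in> linf_ball u \<nu> \<longleftrightarrow> (\<forall>j. \<bar>x $ j - u $ j\<bar> \<le> \<nu>)"
  by (auto simp: linf_ball_eq_cbox mem_box_cart abs_le_iff algebra_simps)

lemma emeasure_unit_ball:
  "emeasure lborel (linf_ball (0::real^'n) 1) \<noteq> 0" "emeasure lborel (linf_ball (0::real^'n) 1) \<noteq> \<infinity>"
proof -
  define P where "P = (\<Prod>b\<in>Basis. (((\<chi> i. 1) - - (\<chi> i. 1)) :: real^'n) \<bullet> b)"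
  have "emeasure lborel (linf_ball (0::real^'n) 1) = ennreal P"
    unfolding linf_ball_eq_cbox P_def
    by (subst emeasure_lborel_cbox) (auto simp: Basis_vec_def inner_axis)
  moreover have "0 < P"
    unfolding P_def by (intro prod_pos) (auto simp: Basis_vec_def inner_axis)
  ultimately show "emeasure lborel (linf_ball (0::real^'n) 1) \<noteq> 0" "emeasure lborel (linf_ball (0::real^'n) 1) \<noteq> \<infinity>"
    by auto
qed

lemma prob_space_unit_draw: "prob_space unit_draw"
  unfolding unit_draw_def by (rule prob_space_uniform_measure[OF emeasure_unit_ball])

lemma prob_space_unit_interval: "prob_space unit_interval"
  by (rule prob_space_uniform_measure) auto

lemma sets_unit_draw[measurable_cong, simp]: "sets unit_draw = sets borel"
  by (simp add: unit_draw_def)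

lemma space_unit_draw[simp]: "space unit_draw = UNIV"
  by (simp add: unit_draw_def)

lemma AE_unit_draw: "AE b in unit_draw. b \<in> linf_ball 0 1"
  unfolding unit_draw_def by (intro AE_uniform_measureI) auto

text \<open>Fubini for a single coordinate. The outer integral omits the index \<open>axis i 1\<close>, so the sum has an
  unspecified \<open>i\<close>-th coordinate until it is overwritten.\<close>

lemma nn_integral_lborel_split_coord:
  fixes f :: "real^'n \<Rightarrow> ennreal"
  assumes [measurable]: "f \<in> borel_measurable borel"
  shows "(\<integral>\<^sup>+b. f b \<partial>lborel) =
    (\<integral>\<^sup>+x. \<integral>\<^sup>+c. f (set_coord i c (\<Sum>b\<in>Basis. x b *\<^sub>R b)) \<partial>lborel \<partial>(\<Pi>\<^sub>M b\<in>Basis - {axis i 1}. lborel))"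
proof -
  interpret product_sigma_finite "\<lambda>b::real^'n. lborel :: real measure"
    by unfold_locales
  let ?e = "axis i 1 :: real^'n" and ?T = "\<lambda>x. \<Sum>b\<in>Basis. x b *\<^sub>R (b :: real^'n)"
  have e: "?e \<in> Basis" by (auto simp: Basis_vec_def)
  then have ins: "Basis = insert ?e (Basis - {?e})" by auto
  have T[measurable]: "?T \<in> (\<Pi>\<^sub>M b\<in>Basis. lborel) \<rightarrow>\<^sub>M borel" by measurable
  have coord: "?T (x(?e := c)) = set_coord i c (?T x)" for x c
  proof -
    have *: "?T y $ j = y (axis j 1)" for y j
    proof -
      have "?T y $ j = ?T y \<bullet> axis j 1" by (simp add: inner_axis)
      also have "\<dots> = y (axis j 1)"
        by (rule inner_sum_left_Basis) (auto simp: Basis_vec_def)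
      finally show ?thesis .
    qed
    show ?thesis
      unfolding vec_eq_iff * set_coord_def by (auto simp: axis_eq_axis *)
  qed
  have "(\<integral>\<^sup>+b. f b \<partial>lborel) = (\<integral>\<^sup>+x. f (?T x) \<partial>(\<Pi>\<^sub>M b\<in>Basis. lborel))"
    by (subst lborel_eq, subst nn_integral_distr) auto
  also have "\<dots> = (\<integral>\<^sup>+x. f (?T x) \<partial>(\<Pi>\<^sub>M b\<in>insert ?e (Basis - {?e}). lborel))"
    using ins by simp
  also have "\<dots> = (\<integral>\<^sup>+x. \<integral>\<^sup>+c. f (?T (x(?e := c))) \<partial>lborel \<partial>(\<Pi>\<^sub>M b\<in>Basis - {?e}. lborel))"
    using ins[symmetric] by (intro product_nn_integral_insert) auto
  finally show ?thesis unfolding coord .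
qed

lemma set_coord_set_coord: "set_coord i c (set_coord i d b) = set_coord i c b"
  by (auto simp: set_coord_def vec_eq_iff)

text \<open>The cube is a product, so that membership in it splits into a condition on the \<open>i\<close>-th coordinate and
  one on the others.\<close>

lemma nn_integral_unit_draw_resample:
  fixes f :: "real^'n \<Rightarrow> ennreal"
  assumes [measurable]: "f \<in> borel_measurable borel"
  shows "(\<integral>\<^sup>+b. \<integral>\<^sup>+c. f (set_coord i c b) \<partial>unit_interval \<partial>unit_draw) = (\<integral>\<^sup>+b. f b \<partial>unit_draw)"
proof -
  interpret I: prob_space unit_interval by (rule prob_space_unit_interval)
  define H where "H = {b :: real^'n. \<forall>j. j \<noteq> i \<longrightarrow> \<bar>b $ j\<bar> \<le> 1}"
  have [measurable]: "H \<in> sets borel" unfolding H_def by measurable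
  let ?box = "linf_ball 0 1 :: (real^'n) set"
  have box_set_coord: "indicator ?box (set_coord i c b) = (indicator H b * indicator {-1..1} c :: ennreal)" for b c
    by (auto simp: set_coord_def H_def mem_linf_ball abs_le_iff split: split_indicator)
  have lint: "emeasure lborel {-1..1::real} = 2" by simp
  have avg: "(\<integral>\<^sup>+c. h c * indicator {-1..1} c \<partial>lborel) = 2 * (\<integral>\<^sup>+c. h c \<partial>unit_interval)"
    if [measurable]: "h \<in> borel_measurable borel" for h :: "real \<Rightarrow> ennreal"
    by (subst nn_integral_uniform_measure)
      (auto simp: lint ennreal_times_divide mult.commute[of 2] ennreal_mult_divide_eq)
  let ?J = "\<Pi>\<^sub>M b\<in>Basis - {axis i 1 :: real^'n}. lborel :: real measure"
  let ?T = "\<lambda>x. \<Sum>b\<in>Basis. x b *\<^sub>R (b :: real^'n)"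
  have key: "(\<integral>\<^sup>+b. h b * indicator ?box b \<partial>lborel) =
      (\<integral>\<^sup>+x. 2 * (\<integral>\<^sup>+c. h (set_coord i c (?T x)) \<partial>unit_interval) * indicator H (?T x) \<partial>?J)"
    if [measurable]: "h \<in> borel_measurable borel" for h :: "real^'n \<Rightarrow> ennreal"
  proof -
    have "(\<integral>\<^sup>+b. h b * indicator ?box b \<partial>lborel) =
        (\<integral>\<^sup>+x. \<integral>\<^sup>+c. h (set_coord i c (?T x)) * indicator {-1..1} c * indicator H (?T x) \<partial>lborel \<partial>?J)"
      by (subst nn_integral_lborel_split_coord[of _ i]) (auto simp: box_set_coord mult_ac)
    also have "\<dots> = (\<integral>\<^sup>+x. 2 * (\<integral>\<^sup>+c. h (set_coord i c (?T x)) \<partial>unit_interval) * indicator H (?T x) \<partial>?J)"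
      by (intro nn_integral_cong) (simp add: nn_integral_multc avg)
    finally show ?thesis .
  qed
  define g where "g = (\<lambda>b. \<integral>\<^sup>+c. f (set_coord i c b) \<partial>unit_interval)"
  have g[measurable]: "g \<in> borel_measurable borel"
    unfolding g_def by (intro I.borel_measurable_nn_integral) measurable
  have "(\<integral>\<^sup>+c. g (set_coord i c b) \<partial>unit_interval) = g b" for b
    by (simp add: g_def set_coord_set_coord I.emeasure_space_1)
  then have "(\<integral>\<^sup>+b. g b * indicator ?box b \<partial>lborel) = (\<integral>\<^sup>+b. f b * indicator ?box b \<partial>lborel)"
    by (simp add: key) (simp add: g_def)
  then show ?thesis
    unfolding unit_draw_def g_def[symmetric] by (simp add: nn_integral_uniform_measure)
qed

section \<open>Difference quotients across a random cube\<close>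

text \<open>The form in which redrawing is used: a map \<open>T\<close> that overwrites a part of \<open>x\<close> by an independent \<open>y\<close> and
  preserves integrals lets any integral be computed by first averaging over \<open>y\<close> with \<open>x\<close> held fixed.\<close>

lemma resample_distr:
  assumes "prob_space N"
    and T[measurable]: "T \<in> (M \<Otimes>\<^sub>M N) \<rightarrow>\<^sub>M M"
    and eq: "\<And>f. f \<in> borel_measurable M \<Longrightarrow>
      (\<integral>\<^sup>+x. \<integral>\<^sup>+y. f (T (x, y)) \<partial>N \<partial>M) = (\<integral>\<^sup>+x. f x \<partial>M)"
  shows "distr (M \<Otimes>\<^sub>M N) M T = M"
proof (rule measure_eqI)
  interpret N: prob_space N by fact
  fix A assume "A \<in> sets (distr (M \<Otimes>\<^sub>M N) M T)"
  then have [measurable]: "A \<in> sets M" by simp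
  have "emeasure (distr (M \<Otimes>\<^sub>M N) M T) A = (\<integral>\<^sup>+p. indicator A (T p) \<partial>(M \<Otimes>\<^sub>M N))"
    by (simp flip: nn_integral_indicator add: nn_integral_distr)
  also have "\<dots> = (\<integral>\<^sup>+x. \<integral>\<^sup>+y. indicator A (T (x, y)) \<partial>N \<partial>M)"
    by (rule N.nn_integral_fst[symmetric]) measurable
  also have "\<dots> = emeasure M A" by (subst eq) auto
  finally show "emeasure (distr (M \<Otimes>\<^sub>M N) M T) A = emeasure M A" .
qed simp

lemma resample_integral:
  fixes f :: "'a \<Rightarrow> real"
  assumes M: "prob_space M" and N: "prob_space N"
    and T[measurable]: "T \<in> (M \<Otimes>\<^sub>M N) \<rightarrow>\<^sub>M M"
    and eq: "distr (M \<Otimes>\<^sub>M N) M T = M"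
    and f: "integrable M f"
  shows "(\<integral>x. \<integral>y. f (T (x, y)) \<partial>N \<partial>M) = (\<integral>x. f x \<partial>M)"
    and "integrable (M \<Otimes>\<^sub>M N) (\<lambda>p. f (T p))"
    and "integrable M (\<lambda>x. \<integral>y. f (T (x, y)) \<partial>N)"
proof -
  interpret M: prob_space M by fact
  interpret N: prob_space N by fact
  interpret pair_sigma_finite M N ..
  have "integrable (distr (M \<Otimes>\<^sub>M N) M T) f" using f eq by simp
  then show int: "integrable (M \<Otimes>\<^sub>M N) (\<lambda>p. f (T p))"
    by (subst (asm) integrable_distr_eq) (use f in auto)
  have "(\<integral>x. f x \<partial>M) = (\<integral>x. f x \<partial>distr (M \<Otimes>\<^sub>M N) M T)" using eq by simp
  also have "\<dots> = (\<integral>p. f (T p) \<partial>(M \<Otimes>\<^sub>M N))" using f by (intro integral_distr) auto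
  also have "\<dots> = (\<integral>x. \<integral>y. f (T (x, y)) \<partial>N \<partial>M)" using integral_fst'[OF int] by simp
  finally show "(\<integral>x. \<integral>y. f (T (x, y)) \<partial>N \<partial>M) = (\<integral>x. f x \<partial>M)" by simp
  show "integrable M (\<lambda>x. \<integral>y. f (T (x, y)) \<partial>N)" using integrable_fst'[OF int] by simp
qed

lemma integral_unit_draw_resample:
  fixes f :: "real^'n \<Rightarrow> real"
  assumes "integrable unit_draw f"
  shows "(\<integral>b. \<integral>c. f (set_coord i c b) \<partial>unit_interval \<partial>unit_draw) = (\<integral>b. f b \<partial>unit_draw)"
    and "integrable unit_draw (\<lambda>b. \<integral>c. f (set_coord i c b) \<partial>unit_interval)"
proof -
  let ?T = "\<lambda>p :: (real^'n) \<times> real. set_coord i (snd p) (fst p)"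
  have T: "?T \<in> (unit_draw \<Otimes>\<^sub>M unit_interval) \<rightarrow>\<^sub>M unit_draw"
  proof -
    have "(\<lambda>(b, c). set_coord i c b) \<in> (unit_draw \<Otimes>\<^sub>M unit_interval) \<rightarrow>\<^sub>M unit_draw"
      using measurable_set_coord[of i] by (simp cong: measurable_cong_sets)
    then show ?thesis by (simp add: split_beta')
  qed
  have D: "distr (unit_draw \<Otimes>\<^sub>M unit_interval) unit_draw ?T = unit_draw"
    by (rule resample_distr[OF prob_space_unit_interval T])
      (simp add: nn_integral_unit_draw_resample)
  show "(\<integral>b. \<integral>c. f (set_coord i c b) \<partial>unit_interval \<partial>unit_draw) = (\<integral>b. f b \<partial>unit_draw)"
    and "integrable unit_draw (\<lambda>b. \<integral>c. f (set_coord i c b) \<partial>unit_interval)"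
    using resample_integral[OF prob_space_unit_draw prob_space_unit_interval T D assms] by simp_all
qed

lemma integral_unit_interval:
  fixes h :: "real \<Rightarrow> real"
  assumes [measurable]: "h \<in> borel_measurable borel"
  shows "(\<integral>c. h c \<partial>unit_interval) = (\<integral>c. indicator {-1..1} c *\<^sub>R h c \<partial>lborel) / 2"
proof -
  have "unit_interval = density lborel (\<lambda>c. ennreal (indicator {-1..1} c / 2))"
    unfolding uniform_measure_def
    by (intro density_cong) (auto split: split_indicator simp: divide_ennreal[symmetric])
  then have "(\<integral>c. h c \<partial>unit_interval) = (\<integral>c. (indicator {-1..1} c / 2) *\<^sub>R h c \<partial>lborel)"
    by (simp add: integral_density)
  also have "\<dots> = (\<integral>c. (indicator {-1..1} c *\<^sub>R h c) / 2 \<partial>lborel)" by simp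
  finally show ?thesis by (simp only: integral_divide_zero)
qed

lemma face_eq_set_coord: "face u (u + \<nu> *\<^sub>R b) i (\<nu> * c) = u + \<nu> *\<^sub>R set_coord i c b"
  by (auto simp: face_def set_coord_def vec_eq_iff)

text \<open>The difference quotient of \<open>G\<close> across the cube of radius \<open>\<nu>\<close> around \<open>u\<close>, along the line through the
  point \<open>u + \<nu> *\<^sub>R b\<close> in direction \<open>i\<close>.\<close>

definition face_quotient :: "(real^'n \<Rightarrow> real) \<Rightarrow> real^'n \<Rightarrow> real \<Rightarrow> real^'n \<Rightarrow> 'n \<Rightarrow> real" where
  "face_quotient G u \<nu> b i =
     (G (face u (u + \<nu> *\<^sub>R b) i \<nu>) - G (face u (u + \<nu> *\<^sub>R b) i (- \<nu>))) / (2 * \<nu>)"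

lemma face_quotient_set_coord:
  "face_quotient G u \<nu> b i = (G (u + \<nu> *\<^sub>R set_coord i 1 b) - G (u + \<nu> *\<^sub>R set_coord i (- 1) b)) / (2 * \<nu>)"
  using face_eq_set_coord[of u \<nu> b i 1] face_eq_set_coord[of u \<nu> b i "- 1"] by (simp add: face_quotient_def)

lemma set_coord_line: "u + \<nu> *\<^sub>R set_coord i c b = (u + \<nu> *\<^sub>R set_coord i 0 b) + c *\<^sub>R (\<nu> *\<^sub>R axis i 1)"
  by (auto simp: set_coord_def vec_eq_iff axis_def)

context
  fixes F :: "real^'n \<Rightarrow> real" and p :: "real^'n \<Rightarrow> real^'n" and K \<nu> :: real and u :: "real^'n"
  assumes deriv: "\<And>z. (F has_derivative (\<lambda>h. p z \<bullet> h)) (at z)"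
    and cont: "continuous_on UNIV p"
    and bound: "\<And>z. norm (p z) \<le> K"
    and \<nu>: "0 < \<nu>"
begin

lemma measurable_gradient: "p \<in> borel_measurable borel"
  by (rule borel_measurable_continuous_onI[OF cont])

text \<open>By the fundamental theorem of calculus the difference quotient is the average of the partial
  derivative over the line.\<close>

lemma face_quotient_eq_average:
  "face_quotient F u \<nu> b i = (\<integral>c. p (u + \<nu> *\<^sub>R set_coord i c b) $ i \<partial>unit_interval)"
proof -
  let ?z = "\<lambda>c. u + \<nu> *\<^sub>R set_coord i c b" and ?h = "\<lambda>c. \<nu> * (p (u + \<nu> *\<^sub>R set_coord i c b) $ i)"
  define a where "a = u + \<nu> *\<^sub>R set_coord i 0 b"
  have z: "?z = (\<lambda>c. a + c *\<^sub>R (\<nu> *\<^sub>R axis i 1))"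
    unfolding a_def using set_coord_line[of u \<nu> i _ b] by blast
  have cont_z: "continuous_on S ?z" for S
    unfolding z by (intro continuous_intros)
  have cont_h: "continuous_on S ?h" for S
    by (intro continuous_intros continuous_on_component continuous_on_compose2[OF cont cont_z]) auto
  have "((\<lambda>c. F (?z c)) has_vector_derivative ?h c) (at c within {-1..1})" for c
  proof -
    have "(?z has_derivative (\<lambda>d. d *\<^sub>R (\<nu> *\<^sub>R axis i 1))) (at c within {-1..1})"
      unfolding z by (rule derivative_eq_intros refl)+ simp
    from has_derivative_compose[OF this deriv]
    show ?thesis
      by (simp add: has_vector_derivative_def inner_axis mult_ac)
  qed
  then have "(\<integral>c. indicator {-1..1} c *\<^sub>R ?h c \<partial>lborel) = F (?z 1) - F (?z (- 1))"
    using cont_h by (intro integral_FTC_atLeastAtMost) auto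
  moreover have "(\<integral>c. ?h c \<partial>unit_interval) = (\<integral>c. indicator {-1..1} c *\<^sub>R ?h c \<partial>lborel) / 2"
    using borel_measurable_continuous_onI[OF cont_h] by (rule integral_unit_interval)
  ultimately have "\<nu> * (\<integral>c. p (?z c) $ i \<partial>unit_interval) = (F (?z 1) - F (?z (- 1))) / 2"
    by simp
  then show ?thesis using \<nu> by (simp add: face_quotient_set_coord field_simps)
qed

lemma gradient_component_le: "\<bar>p z $ i\<bar> \<le> K"
  using component_le_norm_cart[of "p z" i] bound[of z] by simp

lemma gradient_component_power2_le: "(p z $ i)\<^sup>2 \<le> K\<^sup>2"
  using power_mono[OF gradient_component_le[of z i], of 2] by simp

lemma integrable_gradient_component: "integrable unit_draw (\<lambda>b. p (u + \<nu> *\<^sub>R b) $ i)"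
  and integrable_gradient_component_power2: "integrable unit_draw (\<lambda>b. (p (u + \<nu> *\<^sub>R b) $ i)\<^sup>2)"
proof -
  interpret prob_space "unit_draw :: (real^'n) measure" by (rule prob_space_unit_draw)
  note [measurable] = measurable_gradient
  show "integrable unit_draw (\<lambda>b. p (u + \<nu> *\<^sub>R b) $ i)"
    using gradient_component_le by (intro integrable_const_bound[where B = K]) auto
  show "integrable unit_draw (\<lambda>b. (p (u + \<nu> *\<^sub>R b) $ i)\<^sup>2)"
    using gradient_component_power2_le
    by (intro integrable_const_bound[where B = "K\<^sup>2"]) auto
qed

text \<open>Averaging over the line and then over the cube is averaging over the cube, because the \<open>i\<close>-th
  coordinate of the draw is merely redrawn. Hence the mean of the difference quotients is the mean
  gradient.\<close>

lemma integral_face_quotient: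
  "integrable unit_draw (\<lambda>b. face_quotient F u \<nu> b i)"
  "(\<integral>b. face_quotient F u \<nu> b i \<partial>unit_draw) = (\<integral>b. p (u + \<nu> *\<^sub>R b) $ i \<partial>unit_draw)"
  unfolding face_quotient_eq_average
  using integral_unit_draw_resample[OF integrable_gradient_component, of i i] by auto

text \<open>By Jensen's inequality for the average over the line; summed over \<open>i\<close>, the right-hand sides are
  the mean squared norm of the gradient. This is where the second moment is kept free of a
  factor for the number of coordinates.\<close>

lemma integral_face_quotient_power2:
  "integrable unit_draw (\<lambda>b. (face_quotient F u \<nu> b i)\<^sup>2)"
  "(\<integral>b. (face_quotient F u \<nu> b i)\<^sup>2 \<partial>unit_draw) \<le> (\<integral>b. (p (u + \<nu> *\<^sub>R b) $ i)\<^sup>2 \<partial>unit_draw)"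
proof -
  interpret prob_space "unit_draw :: (real^'n) measure" by (rule prob_space_unit_draw)
  interpret U: prob_space unit_interval by (rule prob_space_unit_interval)
  note [measurable] = measurable_gradient
  let ?q = "\<lambda>b c. p (u + \<nu> *\<^sub>R set_coord i c b) $ i"
  have le: "(face_quotient F u \<nu> b i)\<^sup>2 \<le> (\<integral>c. (?q b c)\<^sup>2 \<partial>unit_interval)" for b
  proof -
    have 1: "integrable unit_interval (?q b)"
      using gradient_component_le by (intro U.integrable_const_bound[where B = K]) auto
    have 2: "integrable unit_interval (\<lambda>c. (?q b c)\<^sup>2)"
      using gradient_component_power2_le by (intro U.integrable_const_bound[where B = "K\<^sup>2"]) auto
    have "0 \<le> U.variance (?q b)" by simp
    then show ?thesis unfolding face_quotient_eq_average U.variance_eq[OF 1 2] by simp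
  qed
  note R = integral_unit_draw_resample[OF integrable_gradient_component_power2, of i i]
  have m: "(\<lambda>b. face_quotient F u \<nu> b i) \<in> borel_measurable unit_draw"
    using integral_face_quotient(1) by (rule borel_measurable_integrable)
  show int: "integrable unit_draw (\<lambda>b. (face_quotient F u \<nu> b i)\<^sup>2)"
    using m le order_trans[OF _ abs_ge_self, OF le]
    by (intro Bochner_Integration.integrable_bound[OF R(2)]) auto
  show "(\<integral>b. (face_quotient F u \<nu> b i)\<^sup>2 \<partial>unit_draw) \<le> (\<integral>b. (p (u + \<nu> *\<^sub>R b) $ i)\<^sup>2 \<partial>unit_draw)"
    unfolding R(1)[symmetric] by (intro integral_mono int R(2) le)
qed

text \<open>In the application \<open>F\<close> is the smoothed gauge and \<open>G\<close> is the approximate gauge, which is accessible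
  through the oracle but has no regularity beyond measurability.\<close>

context
  fixes G :: "real^'n \<Rightarrow> real" and e :: real
  assumes meas_G: "G \<in> borel_measurable borel"
    and close: "\<And>z. z \<in> linf_ball u \<nu> \<Longrightarrow> \<bar>G z - F z\<bar> \<le> e"
begin

lemma face_quotient_close:
  assumes b: "b \<in> linf_ball 0 1"
  shows "\<bar>face_quotient G u \<nu> b i - face_quotient F u \<nu> b i\<bar> \<le> e / \<nu>"
proof -
  have mem: "u + \<nu> *\<^sub>R set_coord i c b \<in> linf_ball u \<nu>" if "\<bar>c\<bar> \<le> 1" for c
    using b that \<nu> by (auto simp: mem_linf_ball set_coord_def abs_mult mult_left_le)
  have "\<bar>(G (u + \<nu> *\<^sub>R set_coord i 1 b) - G (u + \<nu> *\<^sub>R set_coord i (- 1) b))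
      - (F (u + \<nu> *\<^sub>R set_coord i 1 b) - F (u + \<nu> *\<^sub>R set_coord i (- 1) b))\<bar> \<le> 2 * e"
    using close[OF mem, of 1] close[OF mem, of "- 1"] by simp
  then have "\<bar>(G (u + \<nu> *\<^sub>R set_coord i 1 b) - G (u + \<nu> *\<^sub>R set_coord i (- 1) b))
      - (F (u + \<nu> *\<^sub>R set_coord i 1 b) - F (u + \<nu> *\<^sub>R set_coord i (- 1) b))\<bar> / (2 * \<nu>) \<le> 2 * e / (2 * \<nu>)"
    using \<nu> by (intro divide_right_mono) auto
  then show ?thesis
    unfolding face_quotient_set_coord diff_divide_distrib[symmetric] using \<nu> by (simp add: abs_divide)
qed

lemma measurable_face_quotient:
  "(\<lambda>b. face_quotient G u \<nu> b i) \<in> borel_measurable borel"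
proof -
  note [measurable] = meas_G
  show ?thesis unfolding face_quotient_set_coord by measurable
qed

lemma face_quotient_bound:
  assumes "b \<in> linf_ball 0 1"
  shows "\<bar>face_quotient G u \<nu> b i\<bar> \<le> K + e / \<nu>"
proof -
  interpret U: prob_space unit_interval by (rule prob_space_unit_interval)
  note [measurable] = measurable_gradient
  have int: "integrable unit_interval (\<lambda>c. p (u + \<nu> *\<^sub>R set_coord i c b) $ i)"
    using gradient_component_le by (intro U.integrable_const_bound[where B = K]) auto
  have "\<bar>\<integral>c. p (u + \<nu> *\<^sub>R set_coord i c b) $ i \<partial>unit_interval\<bar> \<le> (\<integral>c. \<bar>p (u + \<nu> *\<^sub>R set_coord i c b) $ i\<bar> \<partial>unit_interval)"
    by (rule integral_abs_bound)
  also have "\<dots> \<le> (\<integral>c. K \<partial>unit_interval)"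
    using int gradient_component_le by (intro integral_mono) auto
  finally have "\<bar>face_quotient F u \<nu> b i\<bar> \<le> K"
    by (simp add: face_quotient_eq_average U.prob_space[simplified])
  then show ?thesis using face_quotient_close[OF assms, of i] by linarith
qed

lemma integrable_face_quotient: "integrable unit_draw (\<lambda>b. face_quotient G u \<nu> b i)"
  and integrable_face_quotient_power2: "integrable unit_draw (\<lambda>b. (face_quotient G u \<nu> b i)\<^sup>2)"
proof -
  interpret prob_space "unit_draw :: (real^'n) measure" by (rule prob_space_unit_draw)
  note [measurable] = measurable_face_quotient
  show "integrable unit_draw (\<lambda>b. face_quotient G u \<nu> b i)"
    using AE_unit_draw face_quotient_bound
    by (intro integrable_const_bound[where B = "K + e / \<nu>"]) auto
  have sq: "(face_quotient G u \<nu> b i)\<^sup>2 \<le> (K + e / \<nu>)\<^sup>2" if "b \<in> linf_ball 0 1" for b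
    using power_mono[OF face_quotient_bound[OF that, of i], of 2] by simp
  show "integrable unit_draw (\<lambda>b. (face_quotient G u \<nu> b i)\<^sup>2)"
    using AE_unit_draw sq
    by (intro integrable_const_bound[where B = "(K + e / \<nu>)\<^sup>2"]) auto
qed

lemma face_quotient_mean:
  "(\<integral>b. p (u + \<nu> *\<^sub>R b) \<bullet> v \<partial>unit_draw) - e / \<nu> * (\<Sum>i\<in>UNIV. \<bar>v $ i\<bar>)
    \<le> (\<Sum>i\<in>UNIV. (\<integral>b. face_quotient G u \<nu> b i \<partial>unit_draw) * v $ i)"
proof -
  interpret prob_space "unit_draw :: (real^'n) measure" by (rule prob_space_unit_draw)
  have "(\<integral>b. p (u + \<nu> *\<^sub>R b) \<bullet> v \<partial>unit_draw) = (\<Sum>i\<in>UNIV. (\<integral>b. p (u + \<nu> *\<^sub>R b) $ i \<partial>unit_draw) * v $ i)"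
    unfolding inner_vec_def using integrable_gradient_component
    by (simp add: Bochner_Integration.integral_sum)
  also have "\<dots> \<le> (\<Sum>i\<in>UNIV. (\<integral>b. face_quotient G u \<nu> b i \<partial>unit_draw) * v $ i + e / \<nu> * \<bar>v $ i\<bar>)"
  proof (intro sum_mono)
    fix i
    let ?d = "(\<integral>b. p (u + \<nu> *\<^sub>R b) $ i \<partial>unit_draw) - (\<integral>b. face_quotient G u \<nu> b i \<partial>unit_draw)"
    have "?d = (\<integral>b. face_quotient F u \<nu> b i - face_quotient G u \<nu> b i \<partial>unit_draw)"
      using integral_face_quotient[of i] integrable_face_quotient by simp
    also have "\<bar>\<dots>\<bar> \<le> (\<integral>b. \<bar>face_quotient F u \<nu> b i - face_quotient G u \<nu> b i\<bar> \<partial>unit_draw)"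
      by (rule integral_abs_bound)
    also have "\<dots> \<le> (\<integral>b. e / \<nu> \<partial>(unit_draw :: (real^'n) measure))"
    proof (intro integral_mono_AE)
      show "AE b in unit_draw. \<bar>face_quotient F u \<nu> b i - face_quotient G u \<nu> b i\<bar> \<le> e / \<nu>"
        using AE_unit_draw by eventually_elim (metis face_quotient_close abs_minus_commute)
    qed (use integral_face_quotient[of i] integrable_face_quotient in auto)
    finally have "\<bar>?d\<bar> \<le> e / \<nu>" by (simp add: prob_space[simplified])
    then have "\<bar>?d\<bar> * \<bar>v $ i\<bar> \<le> e / \<nu> * \<bar>v $ i\<bar>" by (intro mult_right_mono) auto
    then have "?d * v $ i \<le> e / \<nu> * \<bar>v $ i\<bar>" using abs_ge_self[of "?d * v $ i"] by (simp add: abs_mult)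
    then show "(\<integral>b. p (u + \<nu> *\<^sub>R b) $ i \<partial>unit_draw) * v $ i
        \<le> (\<integral>b. face_quotient G u \<nu> b i \<partial>unit_draw) * v $ i + e / \<nu> * \<bar>v $ i\<bar>"
      by (simp add: left_diff_distrib)
  qed
  finally show ?thesis by (simp add: sum.distrib sum_distrib_left)
qed

lemma face_quotient_second_moment:
  assumes K: "0 < K" and e: "0 < e"
  shows "(\<Sum>i\<in>UNIV. \<integral>b. (face_quotient G u \<nu> b i)\<^sup>2 \<partial>unit_draw) \<le> (K + sqrt (real CARD('n)) * (e / \<nu>))\<^sup>2"
proof -
  interpret prob_space "unit_draw :: (real^'n) measure" by (rule prob_space_unit_draw)
  define d where "d = real CARD('n)"
  have d: "0 < d" by (simp add: d_def)
  define B where "B = e / \<nu>"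
  have B: "0 < B" using e \<nu> by (simp add: B_def)
  \<comment> \<open>The weights \<open>t / K\<close> and \<open>K / t\<close> in \<open>(x + y)\<^sup>2 \<le> (1 + t / K) * x\<^sup>2 + (1 + K / t) * y\<^sup>2\<close> are the ones for
    which the sum of the bounds over \<open>i\<close> becomes the square of \<open>K + t\<close>.\<close>
  define t where "t = sqrt d * B"
  have tpos: "0 < t" and t: "t\<^sup>2 = d * B\<^sup>2" using B d by (auto simp: t_def power_mult_distrib)
    have P: "(\<Sum>i\<in>UNIV. \<integral>b. (p (u + \<nu> *\<^sub>R b) $ i)\<^sup>2 \<partial>unit_draw) \<le> K\<^sup>2"
    proof -
      have "(\<Sum>i\<in>UNIV. \<integral>b. (p (u + \<nu> *\<^sub>R b) $ i)\<^sup>2 \<partial>unit_draw)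
          = (\<integral>b. (\<Sum>i\<in>UNIV. (p (u + \<nu> *\<^sub>R b) $ i)\<^sup>2) \<partial>unit_draw)"
        using integrable_gradient_component_power2 by (subst Bochner_Integration.integral_sum) auto
      also have "\<dots> \<le> (\<integral>b. K\<^sup>2 \<partial>(unit_draw :: (real^'n) measure))"
      proof (intro integral_mono)
        fix b
        have "(\<Sum>i\<in>UNIV. (p (u + \<nu> *\<^sub>R b) $ i)\<^sup>2) = (norm (p (u + \<nu> *\<^sub>R b)))\<^sup>2"
          unfolding power2_norm_eq_inner inner_vec_def by (simp add: power2_eq_square)
        also have "\<dots> \<le> K\<^sup>2" using bound by (intro power_mono) auto
        finally show "(\<Sum>i\<in>UNIV. (p (u + \<nu> *\<^sub>R b) $ i)\<^sup>2) \<le> K\<^sup>2" .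
      qed (use integrable_gradient_component_power2 in auto)
      finally show ?thesis by (simp add: prob_space[simplified])
    qed
    have "(\<integral>b. (face_quotient G u \<nu> b i)\<^sup>2 \<partial>unit_draw)
        \<le> (1 + t / K) * (\<integral>b. (p (u + \<nu> *\<^sub>R b) $ i)\<^sup>2 \<partial>unit_draw) + (1 + K / t) * B\<^sup>2" for i
    proof -
      have "(\<integral>b. (face_quotient G u \<nu> b i)\<^sup>2 \<partial>unit_draw)
          \<le> (\<integral>b. (1 + t / K) * (face_quotient F u \<nu> b i)\<^sup>2 + (1 + K / t) * B\<^sup>2 \<partial>unit_draw)"
      proof (intro integral_mono_AE)
        show "AE b in unit_draw. (face_quotient G u \<nu> b i)\<^sup>2
            \<le> (1 + t / K) * (face_quotient F u \<nu> b i)\<^sup>2 + (1 + K / t) * B\<^sup>2"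
          using AE_unit_draw
        proof eventually_elim
          fix b :: "real^'n" assume b: "b \<in> linf_ball 0 1"
          define x where "x = face_quotient F u \<nu> b i"
          define y where "y = face_quotient G u \<nu> b i - x"
          have "\<bar>y\<bar> \<le> B" using face_quotient_close[OF b, of i] by (simp add: y_def x_def B_def)
          then have "y\<^sup>2 \<le> B\<^sup>2" using power_mono[of "\<bar>y\<bar>" B 2] by simp
          then have y: "(1 + K / t) * y\<^sup>2 \<le> (1 + K / t) * B\<^sup>2"
            using K tpos by (intro mult_left_mono) auto
          have "0 \<le> (t * x - K * y)\<^sup>2 / (K * t)" using K tpos by simp
          also have "\<dots> = t / K * x\<^sup>2 + K / t * y\<^sup>2 - 2 * (x * y)"
            using K tpos by (simp add: field_simps power2_eq_square)
          finally have "(x + y)\<^sup>2 \<le> (1 + t / K) * x\<^sup>2 + (1 + K / t) * y\<^sup>2"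
            by (simp add: power2_sum algebra_simps)
          then show "(face_quotient G u \<nu> b i)\<^sup>2 \<le> (1 + t / K) * (face_quotient F u \<nu> b i)\<^sup>2 + (1 + K / t) * B\<^sup>2"
            using y by (simp add: x_def y_def)
        qed
      qed (use integral_face_quotient_power2(1) integrable_face_quotient_power2 in auto)
      also have "\<dots> = (1 + t / K) * (\<integral>b. (face_quotient F u \<nu> b i)\<^sup>2 \<partial>unit_draw) + (1 + K / t) * B\<^sup>2"
        using integral_face_quotient_power2(1)[of i] by (simp add: prob_space[simplified])
      also have "\<dots> \<le> (1 + t / K) * (\<integral>b. (p (u + \<nu> *\<^sub>R b) $ i)\<^sup>2 \<partial>unit_draw) + (1 + K / t) * B\<^sup>2"
        using integral_face_quotient_power2(2)[of i] K tpos by (intro add_right_mono mult_left_mono) auto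
      finally show ?thesis .
    qed
    then have "(\<Sum>i\<in>UNIV. \<integral>b. (face_quotient G u \<nu> b i)\<^sup>2 \<partial>unit_draw)
        \<le> (\<Sum>i\<in>UNIV. (1 + t / K) * (\<integral>b. (p (u + \<nu> *\<^sub>R b) $ i)\<^sup>2 \<partial>unit_draw) + (1 + K / t) * B\<^sup>2)"
      by (intro sum_mono)
    also have "\<dots> = (1 + t / K) * (\<Sum>i\<in>UNIV. \<integral>b. (p (u + \<nu> *\<^sub>R b) $ i)\<^sup>2 \<partial>unit_draw) + (1 + K / t) * t\<^sup>2"
      by (simp add: sum.distrib sum_distrib_left t d_def)
    also have "\<dots> \<le> (1 + t / K) * K\<^sup>2 + (1 + K / t) * t\<^sup>2"
      using P K tpos by (intro add_right_mono mult_left_mono) auto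
    also have "(1 + t / K) * K\<^sup>2 + (1 + K / t) * t\<^sup>2 = (K + t)\<^sup>2"
      using K tpos by (simp add: field_simps power2_eq_square)
    finally show ?thesis by (simp add: t_def B_def d_def)
qed

end

end

section \<open>Mean and second moment of the oracle direction\<close>

text \<open>The three parameters of \<^const>\<open>one_d_opt\<close> in dimension \<open>d\<close>: the tolerance of its inner gauge queries and
  the radii of the cubes from which \<open>u\<close> and \<open>z\<close> are drawn.\<close>

definition oracle_tol :: "real \<Rightarrow> real \<Rightarrow> real \<Rightarrow> real \<Rightarrow> real" where
  "oracle_tol d r R \<delta> = r\<^sup>2 * \<delta> ^ 3 / (10 ^ 3 * d powr (7 / 2) * R\<^sup>2)"

definition outer_radius :: "real \<Rightarrow> real \<Rightarrow> real \<Rightarrow> real" where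
  "outer_radius d r \<delta> = r * \<delta> / (10 * d)"

definition inner_radius :: "real \<Rightarrow> real \<Rightarrow> real \<Rightarrow> real \<Rightarrow> real" where
  "inner_radius d r R \<delta> = sqrt (oracle_tol d r R \<delta> * outer_radius d r \<delta> * r / d powr (1 / 2))"

lemma one_d_opt_eq:
  fixes w :: "real^'n"
  shows "one_d_opt MEM r R (i, a, b) w \<delta> = (gau MEM r R w \<delta>, (real CARD('n) *
    face_quotient (\<lambda>x. gau MEM r R x (oracle_tol (real CARD('n)) r R \<delta>)) (w + outer_radius (real CARD('n)) r \<delta> *\<^sub>R a)
      (inner_radius (real CARD('n)) r R \<delta>) b i) *\<^sub>R axis i 1)"
  unfolding one_d_opt_def Let_def face_quotient_def oracle_tol_def outer_radius_def inner_radius_def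
  by (simp only: prod.case)

text \<open>The square root in the inner radius resolves exactly. The ratio in the second clause is, up
  to a constant, the error of a difference quotient caused by inexact gauge values. Even after summing
  over the \<open>d\<close> coordinates and multiplying with the distance \<open>2 * R\<close> to a comparator, it is only a small
  multiple of \<open>\<delta>\<close>.\<close>

lemma inner_radius_eq:
  assumes "0 < r" "0 < R" "0 < \<delta>" and d: "0 < d"
  shows "inner_radius d r R \<delta> = r\<^sup>2 * \<delta>\<^sup>2 / (100 * d\<^sup>2 * sqrt d * R)" (is ?A)
    and "oracle_tol d r R \<delta> / inner_radius d r R \<delta> = \<delta> / (10 * d * R)" (is ?B)
    and "0 < oracle_tol d r R \<delta>" (is ?C) and "0 < inner_radius d r R \<delta>" (is ?D)
proof -
  define q where "q = sqrt d"
  have q: "0 < q" "d = q\<^sup>2" using d by (auto simp: q_def)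
  have half: "d powr (1 / 2) = q" using d by (simp add: powr_half_sqrt q_def)
  have "d powr (7 / 2) = d powr (3 + 1 / 2)" by simp
  also have "\<dots> = d powr 3 * d powr (1 / 2)" by (rule powr_add)
  also have "\<dots> = d ^ 3 * q" using d by (simp add: half)
  finally have tol: "oracle_tol d r R \<delta> = r\<^sup>2 * \<delta> ^ 3 / (10 ^ 3 * (d ^ 3 * q) * R\<^sup>2)"
    by (simp add: oracle_tol_def)
  show ?C unfolding tol using assms d q by simp
  have "oracle_tol d r R \<delta> * outer_radius d r \<delta> * r / d powr (1 / 2)
      = (r\<^sup>2 * \<delta>\<^sup>2 / (100 * d\<^sup>2 * q * R))\<^sup>2"
    unfolding tol half outer_radius_def unfolding q(2) using assms q(1)
    by (simp add: field_simps power2_eq_square eval_nat_numeral)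
  then show A: ?A
    unfolding inner_radius_def q_def[symmetric] using assms d q by simp
  show ?D unfolding A using assms by simp
  show ?B
    unfolding A tol q_def[symmetric] unfolding q(2) using assms q(1)
    by (simp add: field_simps power2_eq_square eval_nat_numeral)
qed

locale vector_oracle = membership_body C r R MEM
  for C :: "(real^'n) set" and r R MEM +
  assumes oracle_meas: "\<And>\<epsilon>. \<epsilon> > 0 \<Longrightarrow> {y. MEM y \<epsilon>} \<in> sets borel"

text \<open>A query at which the approximate gauge is at least \<open>1\<close>, as only there the wrapper uses the direction
  that the oracle returns. The smoothing parameter is chosen such that the smoothed gauge is within
  \<open>tol\<close> of the gauge.\<close>

locale oracle_query = vector_oracle C r R MEM
  for C :: "(real^'n) set" and r R MEM +
  fixes w :: "real^'n" and \<delta> d :: real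
  assumes d_eq: "d = real CARD('n)"
    and w: "norm w \<le> R" and \<delta>: "0 < \<delta>" "\<delta> < 1 / 3"
    and outside: "1 \<le> gau MEM r R w \<delta>"
begin

abbreviation "tol \<equiv> oracle_tol d r R \<delta>"
abbreviation "\<nu>\<^sub>1 \<equiv> outer_radius d r \<delta>"
abbreviation "\<nu>\<^sub>2 \<equiv> inner_radius d r R \<delta>"
abbreviation "quot a b i \<equiv> face_quotient (\<lambda>x. gau MEM r R x tol) (w + \<nu>\<^sub>1 *\<^sub>R a) \<nu>\<^sub>2 b i"
abbreviation "smoothing \<equiv> 2 * r\<^sup>2 * tol"

lemma d_ge_one: "1 \<le> d"
  using zero_less_card_finite[where 'a='n] unfolding d_eq by linarith

lemma d_pos: "0 < d"
  using d_ge_one by linarith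

lemmas radius = inner_radius_eq[OF r_pos R_pos \<delta>(1) d_pos]

lemma smoothing_pos: "0 < smoothing"
  using radius(3) r_pos by simp

lemma tol_le: "tol \<le> \<delta> / 1000"
proof -
  have "1 \<le> d powr (7 / 2)" using d_ge_one by (simp add: ge_one_powr_ge_zero)
  moreover have "r\<^sup>2 \<le> R\<^sup>2" using r_pos r_le_R by (intro power_mono) auto
  ultimately have "1 * r\<^sup>2 \<le> d powr (7 / 2) * R\<^sup>2" by (intro mult_mono) auto
  moreover have "\<delta> ^ 3 \<le> \<delta>" using \<delta> power_decreasing[of 1 3 \<delta>] by simp
  ultimately have "r\<^sup>2 * \<delta> ^ 3 \<le> d powr (7 / 2) * R\<^sup>2 * \<delta>"
    using \<delta> by (intro mult_mono) auto
  then show ?thesis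
    using R_pos d_pos by (simp add: oracle_tol_def divide_le_eq mult_ac)
qed

text \<open>After a factor \<open>sqrt d\<close> for passing to the Euclidean norm, the outer radius contributes at most
  \<open>\<delta> * r / 10\<close> and the inner one at most \<open>\<delta> * r / 100\<close>.\<close>

lemma norm_perturbation_le:
  assumes a: "a \<in> linf_ball 0 1" and x: "x \<in> linf_ball (w + \<nu>\<^sub>1 *\<^sub>R a) \<nu>\<^sub>2"
  shows "norm (x - w) / r \<le> 11 / 100 * \<delta>"
proof -
  define q where "q = sqrt d"
  note d = d_ge_one
  have q: "1 \<le> q" "q\<^sup>2 = d" using d by (auto simp: q_def)
  have \<nu>\<^sub>1: "\<nu>\<^sub>1 = r * \<delta> / (10 * d)" by (simp add: outer_radius_def)
  have \<nu>\<^sub>2: "\<nu>\<^sub>2 = r\<^sup>2 * \<delta>\<^sup>2 / (100 * d\<^sup>2 * q * R)" unfolding radius by (simp add: q_def)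
  have \<nu>\<^sub>1_pos: "0 < \<nu>\<^sub>1" unfolding \<nu>\<^sub>1 using r_pos \<delta> d by simp
  have "\<bar>x $ j - w $ j\<bar> \<le> \<nu>\<^sub>1 + \<nu>\<^sub>2" for j
  proof -
    have "\<nu>\<^sub>1 * \<bar>a $ j\<bar> \<le> \<nu>\<^sub>1 * 1"
      using a \<nu>\<^sub>1_pos by (intro mult_left_mono) (auto simp: mem_linf_ball)
    moreover have "\<bar>x $ j - (w $ j + \<nu>\<^sub>1 * a $ j)\<bar> \<le> \<nu>\<^sub>2" using x by (auto simp: mem_linf_ball)
    moreover have "\<bar>\<nu>\<^sub>1 * a $ j\<bar> = \<nu>\<^sub>1 * \<bar>a $ j\<bar>" using \<nu>\<^sub>1_pos by (simp add: abs_mult)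
    ultimately show ?thesis by linarith
  qed
  then have "x \<in> linf_ball w (\<nu>\<^sub>1 + \<nu>\<^sub>2)" by (simp add: mem_linf_ball)
  then have "infnorm (x - w) \<le> \<nu>\<^sub>1 + \<nu>\<^sub>2" by (simp add: linf_ball_def)
  then have "q * infnorm (x - w) \<le> q * (\<nu>\<^sub>1 + \<nu>\<^sub>2)" using q by (intro mult_left_mono) auto
  moreover have "norm (x - w) \<le> q * infnorm (x - w)"
    using norm_le_infnorm[of "x - w"] by (simp add: q_def d_eq)
  ultimately have "norm (x - w) \<le> q * (\<nu>\<^sub>1 + \<nu>\<^sub>2)" by linarith
  also have "\<dots> = q * \<nu>\<^sub>1 + q * \<nu>\<^sub>2" by (rule distrib_left)
  also have "q * \<nu>\<^sub>1 \<le> r * \<delta> / 10"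
  proof -
    have "q * 1 \<le> d" using q by (simp add: power2_eq_square flip: q(2))
    then have "r * \<delta> * q \<le> r * \<delta> * d" using r_pos \<delta> by (intro mult_left_mono) auto
    then show ?thesis unfolding \<nu>\<^sub>1 using d by (simp add: field_simps)
  qed
  also have "q * \<nu>\<^sub>2 \<le> r * \<delta> / 100"
  proof -
    have "q * \<nu>\<^sub>2 = (r * \<delta> / 100) * ((r / R) * \<delta> / d\<^sup>2)"
      unfolding \<nu>\<^sub>2 using q R_pos d by (simp add: power2_eq_square mult_ac)
    moreover have "(r / R) * \<delta> / d\<^sup>2 \<le> 1"
    proof -
      have "(r / R) * \<delta> \<le> 1 * 1" using r_pos r_le_R \<delta> R_pos by (intro mult_mono) auto
      moreover have "1 \<le> d\<^sup>2" using d by simp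
      ultimately have "(r / R) * \<delta> \<le> d\<^sup>2" by linarith
      then show ?thesis using d by (subst pos_divide_le_eq) auto
    qed
    ultimately show ?thesis
      using mult_left_mono[of "(r / R) * \<delta> / d\<^sup>2" 1 "r * \<delta> / 100"] r_pos \<delta> by simp
  qed
  finally have "norm (x - w) \<le> r * (11 / 100 * \<delta>)" by (simp add: algebra_simps)
  then show ?thesis using r_pos by (simp add: divide_le_eq mult.commute)
qed

lemma gau_query: "gau MEM r R w \<delta> \<le> minkowski C w + \<delta>"
  using gau_accuracy[of w \<delta>] w \<delta> outside R_pos by auto

text \<open>Near a query point whose approximate gauge is at least \<open>1\<close> the gauge exceeds \<open>11 / 20\<close>, so none of the
  inner queries returns the exceptional value \<open>0\<close>. One \<open>tol\<close> is the error of the approximate gauge, the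
  other that of the smoothing.\<close>

lemma gau_close_smooth_gauge:
  assumes a: "a \<in> linf_ball 0 1" and x: "x \<in> linf_ball (w + \<nu>\<^sub>1 *\<^sub>R a) \<nu>\<^sub>2"
  shows "\<bar>gau MEM r R x tol - smooth_gauge smoothing x\<bar> \<le> 2 * tol"
proof -
  have pert: "norm (x - w) / r \<le> 11 / 100 * \<delta>" by (rule norm_perturbation_le[OF a x])
  then have "norm (x - w) \<le> 11 / 100 * \<delta> * r" using r_pos by (simp add: divide_le_eq)
  also have "\<dots> \<le> 1 / 5 * R" using r_pos r_le_R \<delta> by (intro mult_mono) auto
  finally have x_norm: "norm x \<le> 6 / 5 * R"
    using w norm_triangle_ineq[of w "x - w"] by simp
  have "minkowski C w \<le> minkowski C x + 11 / 100 * \<delta>"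
    using minkowski_lipschitz[of w x] pert unfolding norm_minus_commute[of w x] by linarith
  then have big: "11 / 20 < minkowski C x" using gau_query outside \<delta> by linarith
  have tol3: "tol < 1 / 3" using tol_le \<delta> by simp
  have "minkowski C x \<le> gau MEM r R x tol" "gau MEM r R x tol \<le> minkowski C x + tol"
    using gau_accuracy[OF x_norm radius(3) tol3] big by auto
  moreover have "minkowski C x \<le> smooth_gauge smoothing x + tol"
    using minkowski_le_smooth_gauge[OF smoothing_pos, of x] r_pos by simp
  moreover have "smooth_gauge smoothing x \<le> minkowski C x"
    by (rule smooth_gauge_le[OF smoothing_pos])
  ultimately show ?thesis by linarith
qed

lemma smooth_grad_le: "norm (smooth_grad smoothing z) \<le> 1 / r"
  by (rule norm_polar_le[OF smooth_grad_in_polar])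

lemma measurable_gau_tol: "(\<lambda>x. gau MEM r R x tol) \<in> borel_measurable borel"
  by (rule measurable_gau[OF oracle_meas r_pos R_pos radius(3)])

lemmas quot_facts =
  smooth_gauge_has_derivative[OF smoothing_pos] continuous_smooth_grad smooth_grad_le radius(4)
  measurable_gau_tol

lemma quot_bound:
  assumes "a \<in> linf_ball 0 1" "b \<in> linf_ball 0 1"
  shows "\<bar>quot a b i\<bar> \<le> 1 / r + 2 * tol / \<nu>\<^sub>2"
  using face_quotient_bound[OF quot_facts gau_close_smooth_gauge[OF assms(1)] assms(2)] by auto

lemma tol_over_radius: "2 * tol / \<nu>\<^sub>2 = \<delta> / (5 * d * R)"
  unfolding times_divide_eq_right[symmetric] radius(2) by simp

text \<open>The subgradient inequality of the smoothed gauge \<open>F\<close> holds at every sampled point \<open>z\<close>, and it survives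
  averaging. The loss is made up of \<open>\<delta>\<close> for the approximate gauge at \<open>w\<close>, two displacements
  from \<open>w\<close> to \<open>z\<close>, the smoothing error, and \<open>2 / 5 * \<delta>\<close> for inexact gauge values in the
  difference quotients.\<close>

lemma quot_mean:
  assumes a: "a \<in> linf_ball 0 1" and y: "y \<in> C"
  shows "gau MEM r R w \<delta> - 1 - 3 * \<delta> \<le> (\<Sum>i\<in>UNIV. (\<integral>b. quot a b i \<partial>unit_draw) * (w - y) $ i)"
proof -
  interpret prob_space "unit_draw :: (real^'n) measure" by (rule prob_space_unit_draw)
  let ?F = "smooth_gauge smoothing" and ?p = "smooth_grad smoothing"
  let ?z = "\<lambda>b. (w + \<nu>\<^sub>1 *\<^sub>R a) + \<nu>\<^sub>2 *\<^sub>R b"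
  have low: "minkowski C w - 1 - tol - 11 / 50 * \<delta> \<le> ?p (?z b) \<bullet> (w - y)" if b: "b \<in> linf_ball 0 1" for b
  proof -
    define z where "z = ?z b"
    have "z \<in> linf_ball (w + \<nu>\<^sub>1 *\<^sub>R a) \<nu>\<^sub>2"
      using b radius(4) by (auto simp: z_def mem_linf_ball abs_mult mult_left_le)
    then have pert: "norm (z - w) / r \<le> 11 / 100 * \<delta>" by (rule norm_perturbation_le[OF a])
    have "?p z \<bullet> (z - w) \<le> norm (z - w) / r" by (rule polar_inner_le[OF smooth_grad_in_polar])
    moreover have "?F z + ?p z \<bullet> (y - z) \<le> ?F y" by (rule smooth_gauge_subgradient[OF smoothing_pos])
    moreover have "?F y \<le> 1"
      using smooth_gauge_le[OF smoothing_pos, of y] minkowski_le_one[OF y] by linarith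
    moreover have "minkowski C z \<le> ?F z + tol"
      using minkowski_le_smooth_gauge[OF smoothing_pos, of z] r_pos by simp
    moreover have "minkowski C w \<le> minkowski C z + norm (z - w) / r"
      using minkowski_lipschitz[of w z] unfolding norm_minus_commute[of w z] .
    moreover have "?p z \<bullet> (w - y) = - (?p z \<bullet> (y - z)) - ?p z \<bullet> (z - w)"
      by (simp add: inner_diff_right)
    ultimately show ?thesis using pert unfolding z_def by linarith
  qed
  have [measurable]: "?p \<in> borel_measurable borel"
    by (rule borel_measurable_continuous_onI[OF continuous_smooth_grad])
  have int: "integrable unit_draw (\<lambda>b. ?p (?z b) \<bullet> (w - y))"
  proof (rule integrable_const_bound[where B = "1 / r * norm (w - y)"])
    have "\<bar>?p x \<bullet> (w - y)\<bar> \<le> 1 / r * norm (w - y)" for x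
      using Cauchy_Schwarz_ineq2[of "?p x" "w - y"] mult_right_mono[OF smooth_grad_le[of x], of "norm (w - y)"]
      by simp
    then show "AE b in unit_draw. norm (?p (?z b) \<bullet> (w - y)) \<le> 1 / r * norm (w - y)" by simp
  qed measurable
  have "minkowski C w - 1 - tol - 11 / 50 * \<delta>
      = (\<integral>b. minkowski C w - 1 - tol - 11 / 50 * \<delta> \<partial>(unit_draw :: (real^'n) measure))"
    by (simp add: prob_space[simplified])
  also have "\<dots> \<le> (\<integral>b. ?p (?z b) \<bullet> (w - y) \<partial>unit_draw)"
    using AE_unit_draw low int by (intro integral_mono_AE) auto
  also have "\<dots> - 2 * tol / \<nu>\<^sub>2 * (\<Sum>i\<in>UNIV. \<bar>(w - y) $ i\<bar>)
      \<le> (\<Sum>i\<in>UNIV. (\<integral>b. quot a b i \<partial>unit_draw) * (w - y) $ i)"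
    by (rule face_quotient_mean[OF quot_facts gau_close_smooth_gauge[OF a]])
  finally have main: "minkowski C w - 1 - tol - 11 / 50 * \<delta> - 2 * tol / \<nu>\<^sub>2 * (\<Sum>i\<in>UNIV. \<bar>(w - y) $ i\<bar>)
      \<le> (\<Sum>i\<in>UNIV. (\<integral>b. quot a b i \<partial>unit_draw) * (w - y) $ i)" by simp
  have "norm (w - y) \<le> 2 * R"
    using w y outer_ball norm_triangle_ineq4[of w y] by auto
  then have "\<bar>(w - y) $ i\<bar> \<le> 2 * R" for i
    using component_le_norm_cart[of "w - y" i] by linarith
  then have "(\<Sum>i\<in>UNIV. \<bar>(w - y) $ i\<bar>) \<le> d * (2 * R)"
    using sum_bounded_above[of UNIV "\<lambda>i. \<bar>(w - y) $ i\<bar>" "2 * R"] by (simp add: d_eq)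
  then have "2 * tol / \<nu>\<^sub>2 * (\<Sum>i\<in>UNIV. \<bar>(w - y) $ i\<bar>) \<le> \<delta> / (5 * d * R) * (d * (2 * R))"
    unfolding tol_over_radius using \<delta> d_pos R_pos by (intro mult_left_mono) auto
  also have "\<dots> = 2 / 5 * \<delta>" using d_pos R_pos by (simp add: field_simps)
  finally show ?thesis using main gau_query tol_le \<delta> by linarith
qed

lemma quot_second_moment:
  assumes a: "a \<in> linf_ball 0 1"
  shows "(\<Sum>i\<in>UNIV. \<integral>b. (quot a b i)\<^sup>2 \<partial>unit_draw) \<le> (1 / r + \<delta> / R)\<^sup>2"
proof -
  have "(\<Sum>i\<in>UNIV. \<integral>b. (quot a b i)\<^sup>2 \<partial>unit_draw) \<le> (1 / r + sqrt (real CARD('n)) * (2 * tol / \<nu>\<^sub>2))\<^sup>2"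
    by (rule face_quotient_second_moment[OF quot_facts gau_close_smooth_gauge[OF a]]) (use r_pos radius(3) in auto)
  also have "\<dots> \<le> (1 / r + \<delta> / R)\<^sup>2"
  proof (intro power_mono add_left_mono)
    have "sqrt d \<le> d" using d_ge_one by (simp add: real_sqrt_le_iff' power2_eq_square real_le_lsqrt)
    then have "sqrt d * (\<delta> / (5 * d * R)) \<le> d * (\<delta> / (5 * d * R))"
      using \<delta> d_pos R_pos by (intro mult_right_mono) auto
    also have "\<dots> \<le> \<delta> / R" using \<delta> d_pos R_pos by (simp add: field_simps)
    finally show "sqrt (real CARD('n)) * (2 * tol / \<nu>\<^sub>2) \<le> \<delta> / R"
      unfolding d_eq[symmetric] tol_over_radius .
    show "0 \<le> 1 / r + sqrt (real CARD('n)) * (2 * tol / \<nu>\<^sub>2)"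
      unfolding tol_over_radius using \<delta> d_pos R_pos r_pos by simp
  qed
  finally show ?thesis .
qed

end

lemma prob_space_draw_measure: "prob_space (draw_measure :: ('n::finite \<times> (real^'n) \<times> (real^'n)) measure)"
proof -
  interpret A: prob_space "unit_draw :: (real^'n) measure" by (rule prob_space_unit_draw)
  interpret AA: pair_prob_space "unit_draw :: (real^'n) measure" "unit_draw :: (real^'n) measure" ..
  interpret U: prob_space "uniform_count_measure (UNIV :: 'n set)"
    by (rule prob_space_uniform_count_measure) auto
  interpret pair_prob_space "uniform_count_measure (UNIV :: 'n set)"
    "(unit_draw :: (real^'n) measure) \<Otimes>\<^sub>M (unit_draw :: (real^'n) measure)" ..
  show ?thesis unfolding draw_measure_def by unfold_locales
qed

lemma sets_draw_measure[measurable_cong]: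
  "sets (draw_measure :: ('n::finite \<times> (real^'n) \<times> (real^'n)) measure) = sets (count_space UNIV \<Otimes>\<^sub>M (borel \<Otimes>\<^sub>M borel))"
  unfolding draw_measure_def by (intro sets_pair_measure_cong) (auto simp: sets_uniform_count_measure)

lemma AE_draw_measure:
  "AE (i, a, b) in (draw_measure :: ('n::finite \<times> (real^'n) \<times> (real^'n)) measure).
     a \<in> linf_ball 0 1 \<and> b \<in> linf_ball 0 1"
proof -
  interpret A: prob_space "unit_draw :: (real^'n) measure" by (rule prob_space_unit_draw)
  interpret AA: pair_prob_space "unit_draw :: (real^'n) measure" "unit_draw :: (real^'n) measure" ..
  interpret U: prob_space "uniform_count_measure (UNIV :: 'n set)"
    by (rule prob_space_uniform_count_measure) auto
  interpret pair_prob_space "uniform_count_measure (UNIV :: 'n set)"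
    "(unit_draw :: (real^'n) measure) \<Otimes>\<^sub>M (unit_draw :: (real^'n) measure)" ..
  have "AE q in unit_draw \<Otimes>\<^sub>M unit_draw. fst q \<in> (linf_ball 0 1 :: (real^'n) set) \<and> snd q \<in> (linf_ball 0 1 :: (real^'n) set)"
  proof (rule AA.AE_pair_measure)
    show "{q \<in> space (unit_draw \<Otimes>\<^sub>M unit_draw). fst q \<in> (linf_ball 0 1 :: (real^'n) set)
        \<and> snd q \<in> (linf_ball 0 1 :: (real^'n) set)} \<in> sets (unit_draw \<Otimes>\<^sub>M unit_draw)"
      by measurable
  qed (use AE_unit_draw in auto)
  then have "AE p in draw_measure. fst (snd p) \<in> (linf_ball 0 1 :: (real^'n) set) \<and> snd (snd p) \<in> (linf_ball 0 1 :: (real^'n) set)"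
    unfolding draw_measure_def
  proof (intro AE_pair_measure)
    show "{p \<in> space (uniform_count_measure (UNIV :: 'n set) \<Otimes>\<^sub>M (unit_draw \<Otimes>\<^sub>M unit_draw)).
        fst (snd p) \<in> (linf_ball 0 1 :: (real^'n) set) \<and> snd (snd p) \<in> (linf_ball 0 1 :: (real^'n) set)}
        \<in> sets (uniform_count_measure UNIV \<Otimes>\<^sub>M (unit_draw \<Otimes>\<^sub>M unit_draw))"
      by measurable
  qed auto
  then show ?thesis by (simp add: split_beta)
qed

text \<open>The order of integration matters: the estimates for the difference quotients hold for each fixed \<open>a\<close>,
  after summation over \<open>i\<close> and averaging over \<open>b\<close>.\<close>

lemma integral_draw_measure:
  fixes f :: "'n::finite \<times> (real^'n) \<times> (real^'n) \<Rightarrow> real"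
  assumes "integrable draw_measure f"
  shows "integrable unit_draw (\<lambda>a. \<Sum>i\<in>UNIV. \<integral>b. f (i, a, b) \<partial>unit_draw)"
    and "(\<integral>\<eta>. f \<eta> \<partial>draw_measure) =
      (\<integral>a. (\<Sum>i\<in>UNIV. \<integral>b. f (i, a, b) \<partial>unit_draw) \<partial>unit_draw) / real CARD('n)"
proof -
  interpret A: prob_space "unit_draw :: (real^'n) measure" by (rule prob_space_unit_draw)
  interpret AA: pair_prob_space "unit_draw :: (real^'n) measure" "unit_draw :: (real^'n) measure" ..
  interpret U: prob_space "uniform_count_measure (UNIV :: 'n set)"
    by (rule prob_space_uniform_count_measure) auto
  interpret P: pair_prob_space "uniform_count_measure (UNIV :: 'n set)"
    "(unit_draw :: (real^'n) measure) \<Otimes>\<^sub>M (unit_draw :: (real^'n) measure)" ..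
  note f = assms[unfolded draw_measure_def]
  have "AE i in uniform_count_measure (UNIV :: 'n set). integrable (unit_draw \<Otimes>\<^sub>M unit_draw) (\<lambda>q. f (i, q))"
    by (rule P.AE_integrable_fst'[OF f])
  moreover have "(0 :: ennreal) < ennreal (1 / real CARD('n))" by simp
  ultimately have slice: "integrable (unit_draw \<Otimes>\<^sub>M unit_draw) (\<lambda>q. f (i, q))" for i
    unfolding uniform_count_measure_def AE_point_measure by blast
  have inner: "integrable unit_draw (\<lambda>a. \<integral>b. f (i, a, b) \<partial>unit_draw)" for i
    using AA.integrable_fst'[OF slice[of i]] .
  then show "integrable unit_draw (\<lambda>a. \<Sum>i\<in>UNIV. \<integral>b. f (i, a, b) \<partial>unit_draw)"
    by (intro Bochner_Integration.integrable_sum)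
  have "(\<integral>\<eta>. f \<eta> \<partial>draw_measure) = (\<integral>i. \<integral>q. f (i, q) \<partial>(unit_draw \<Otimes>\<^sub>M unit_draw) \<partial>uniform_count_measure UNIV)"
    unfolding draw_measure_def by (rule P.integral_fst'[OF f, symmetric])
  also have "\<dots> = (\<Sum>i\<in>UNIV. \<integral>q. f (i, q) \<partial>(unit_draw \<Otimes>\<^sub>M unit_draw)) / real CARD('n)"
    by (rule integral_uniform_count_measure) simp
  also have "(\<Sum>i\<in>UNIV. \<integral>q. f (i, q) \<partial>(unit_draw \<Otimes>\<^sub>M unit_draw))
      = (\<Sum>i\<in>UNIV. \<integral>a. \<integral>b. f (i, a, b) \<partial>unit_draw \<partial>unit_draw)"
    using AA.integral_fst'[OF slice] by simp
  also have "\<dots> = (\<integral>a. (\<Sum>i\<in>UNIV. \<integral>b. f (i, a, b) \<partial>unit_draw) \<partial>unit_draw)"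
    using inner by (subst Bochner_Integration.integral_sum) auto
  finally show "(\<integral>\<eta>. f \<eta> \<partial>draw_measure) =
      (\<integral>a. (\<Sum>i\<in>UNIV. \<integral>b. f (i, a, b) \<partial>unit_draw) \<partial>unit_draw) / real CARD('n)" .
qed

lemma measurable_face:
  fixes u z :: "'a \<Rightarrow> real^'n"
  assumes [measurable]: "u \<in> borel_measurable M" "z \<in> borel_measurable M"
  shows "(\<lambda>x. face (u x) (z x) i c) \<in> borel_measurable M"
  unfolding face_def by (intro measurable_vec_lambda) measurable

context vector_oracle
begin

lemma measurable_one_d_opt:
  assumes "0 < \<delta>"
  shows "(\<lambda>(\<eta>, w). snd (one_d_opt MEM r R \<eta> w \<delta>)) \<in> borel_measurable (draw_measure \<Otimes>\<^sub>M borel)"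
proof -
  have tol: "0 < oracle_tol (real CARD('n)) r R \<delta>"
    by (rule inner_radius_eq(3)[OF r_pos R_pos assms]) simp
  note [measurable] = measurable_compose[OF _ measurable_gau[OF oracle_meas r_pos R_pos tol]] measurable_face
  define H where "H i p = snd (one_d_opt MEM r R (i, fst (snd (fst p)), snd (snd (fst p))) (snd p) \<delta>)"
    for i :: 'n and p :: "('n \<times> (real^'n) \<times> (real^'n)) \<times> (real^'n)"
  have "(\<lambda>p. H (fst (fst p)) p) \<in> borel_measurable ((count_space UNIV \<Otimes>\<^sub>M (borel \<Otimes>\<^sub>M borel)) \<Otimes>\<^sub>M borel)"
  proof (rule measurable_compose_countable)
    fix i
    show "H i \<in> borel_measurable ((count_space UNIV \<Otimes>\<^sub>M (borel \<Otimes>\<^sub>M borel)) \<Otimes>\<^sub>M borel)"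
      unfolding H_def one_d_opt_eq snd_conv face_quotient_def by measurable
  qed measurable
  then have "(\<lambda>p. H (fst (fst p)) p) \<in> borel_measurable (draw_measure \<Otimes>\<^sub>M borel)"
    by (simp cong: measurable_cong_sets sets_pair_measure_cong add: sets_draw_measure)
  then show ?thesis by (simp add: H_def split_beta)
qed

end

context oracle_query
begin

abbreviation "sample \<eta> \<equiv> snd (one_d_opt MEM r R \<eta> w \<delta>)"

lemma sample_eq: "sample (i, a, b) = (d * quot a b i) *\<^sub>R axis i 1"
  unfolding one_d_opt_eq d_eq by simp

lemma measurable_sample: "(\<lambda>\<eta>. sample \<eta>) \<in> borel_measurable draw_measure"
  using measurable_compose[OF measurable_Pair[OF measurable_ident measurable_const] measurable_one_d_opt[OF \<delta>(1)], of w]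
  by simp

lemma AE_norm_sample_le: "AE \<eta> in draw_measure. norm (sample \<eta>) \<le> d * (1 / r + 2 * tol / \<nu>\<^sub>2)"
  using AE_draw_measure
proof eventually_elim
  fix \<eta> :: "'n \<times> (real^'n) \<times> (real^'n)"
  obtain i a b where \<eta>: "\<eta> = (i, a, b)" by (cases \<eta>)
  assume "case \<eta> of (i, a, b) \<Rightarrow> a \<in> linf_ball 0 1 \<and> b \<in> linf_ball 0 1"
  then show "norm (sample \<eta>) \<le> d * (1 / r + 2 * tol / \<nu>\<^sub>2)"
    unfolding \<eta> sample_eq using quot_bound[of a b i] d_pos
    by (simp add: abs_mult norm_axis_1 mult_left_mono)
qed

lemma integrable_sample: "integrable draw_measure (\<lambda>\<eta>. (norm (sample \<eta>))\<^sup>2)" "integrable draw_measure (\<lambda>\<eta>. sample \<eta> \<bullet> v)"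
proof -
  interpret prob_space "draw_measure :: ('n \<times> (real^'n) \<times> (real^'n)) measure"
    by (rule prob_space_draw_measure)
  note [measurable] = measurable_sample
  let ?B = "d * (1 / r + 2 * tol / \<nu>\<^sub>2)"
  show "integrable draw_measure (\<lambda>\<eta>. (norm (sample \<eta>))\<^sup>2)"
  proof (rule integrable_const_bound[where B = "?B\<^sup>2"])
    show "AE \<eta> in draw_measure. norm ((norm (sample \<eta>))\<^sup>2) \<le> ?B\<^sup>2"
      using AE_norm_sample_le by eventually_elim (auto intro!: power_mono)
  qed measurable
  show "integrable draw_measure (\<lambda>\<eta>. sample \<eta> \<bullet> v)"
  proof (rule integrable_const_bound[where B = "?B * norm v"])
    show "AE \<eta> in draw_measure. norm (sample \<eta> \<bullet> v) \<le> ?B * norm v"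
      using AE_norm_sample_le
    proof eventually_elim
      fix \<eta> :: "'n \<times> (real^'n) \<times> (real^'n)" assume "norm (sample \<eta>) \<le> ?B"
      then have "norm (sample \<eta>) * norm v \<le> ?B * norm v" by (intro mult_right_mono) auto
      then show "norm (sample \<eta> \<bullet> v) \<le> ?B * norm v"
        using Cauchy_Schwarz_ineq2[of "sample \<eta>" v] by simp
    qed
  qed measurable
qed

text \<open>Sampling one of \<open>d\<close> coordinates and scaling by \<open>d\<close> costs a factor \<open>d\<close> in the second moment.\<close>

lemma sample_second_moment: "(\<integral>\<eta>. (norm (sample \<eta>))\<^sup>2 \<partial>draw_measure) \<le> d * (1 / r + \<delta> / R)\<^sup>2"
proof -
  interpret prob_space "unit_draw :: (real^'n) measure" by (rule prob_space_unit_draw)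
  have sq: "(norm (sample (i, a, b)))\<^sup>2 = d\<^sup>2 * (quot a b i)\<^sup>2" for i a b
    unfolding sample_eq by (simp add: norm_axis_1 power_mult_distrib)
  have le: "(\<Sum>i\<in>UNIV. \<integral>b. (norm (sample (i, a, b)))\<^sup>2 \<partial>unit_draw) \<le> d\<^sup>2 * (1 / r + \<delta> / R)\<^sup>2"
    if a: "a \<in> linf_ball 0 1" for a
  proof -
    have "(\<Sum>i\<in>UNIV. \<integral>b. (norm (sample (i, a, b)))\<^sup>2 \<partial>unit_draw)
        = d\<^sup>2 * (\<Sum>i\<in>UNIV. \<integral>b. (quot a b i)\<^sup>2 \<partial>unit_draw)"
      unfolding sq by (simp add: sum_distrib_left)
    also have "\<dots> \<le> d\<^sup>2 * (1 / r + \<delta> / R)\<^sup>2"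
      by (intro mult_left_mono quot_second_moment[OF a]) simp
    finally show ?thesis .
  qed
  have "(\<integral>a. (\<Sum>i\<in>UNIV. \<integral>b. (norm (sample (i, a, b)))\<^sup>2 \<partial>unit_draw) \<partial>unit_draw)
      \<le> (\<integral>a. d\<^sup>2 * (1 / r + \<delta> / R)\<^sup>2 \<partial>(unit_draw :: (real^'n) measure))"
  proof (intro integral_mono_AE)
    show "AE a in unit_draw. (\<Sum>i\<in>UNIV. \<integral>b. (norm (sample (i, a, b)))\<^sup>2 \<partial>unit_draw) \<le> d\<^sup>2 * (1 / r + \<delta> / R)\<^sup>2"
      using AE_unit_draw by eventually_elim (rule le)
  qed (use integral_draw_measure(1)[OF integrable_sample(1)] in auto)
  then have "(\<integral>a. (\<Sum>i\<in>UNIV. \<integral>b. (norm (sample (i, a, b)))\<^sup>2 \<partial>unit_draw) \<partial>unit_draw) / d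
      \<le> d\<^sup>2 * (1 / r + \<delta> / R)\<^sup>2 / d"
    using d_pos by (intro divide_right_mono) (auto simp: prob_space[simplified])
  then show ?thesis
    unfolding integral_draw_measure(2)[OF integrable_sample(1)] d_eq[symmetric]
    using d_pos by (simp add: power2_eq_square)
qed

lemma sample_mean:
  assumes y: "y \<in> C"
  shows "gau MEM r R w \<delta> - 1 - 3 * \<delta> \<le> (\<integral>\<eta>. sample \<eta> \<bullet> (w - y) \<partial>draw_measure)"
proof -
  interpret prob_space "unit_draw :: (real^'n) measure" by (rule prob_space_unit_draw)
  let ?L = "gau MEM r R w \<delta> - 1 - 3 * \<delta>"
  have sq: "sample (i, a, b) \<bullet> (w - y) = d * (quot a b i * (w - y) $ i)" for i a b
    unfolding sample_eq by (simp add: inner_commute[of "axis i 1"] inner_axis)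
  have le: "d * ?L \<le> (\<Sum>i\<in>UNIV. \<integral>b. sample (i, a, b) \<bullet> (w - y) \<partial>unit_draw)" if a: "a \<in> linf_ball 0 1" for a
  proof -
    have "(\<Sum>i\<in>UNIV. \<integral>b. sample (i, a, b) \<bullet> (w - y) \<partial>unit_draw)
        = d * (\<Sum>i\<in>UNIV. (\<integral>b. quot a b i \<partial>unit_draw) * (w - y) $ i)"
      unfolding sq by (simp add: sum_distrib_left)
    then show ?thesis using mult_left_mono[OF quot_mean[OF a y], of d] d_pos by simp
  qed
  have "(\<integral>a. d * ?L \<partial>(unit_draw :: (real^'n) measure))
      \<le> (\<integral>a. (\<Sum>i\<in>UNIV. \<integral>b. sample (i, a, b) \<bullet> (w - y) \<partial>unit_draw) \<partial>unit_draw)"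
  proof (intro integral_mono_AE)
    show "AE a in unit_draw. d * ?L \<le> (\<Sum>i\<in>UNIV. \<integral>b. sample (i, a, b) \<bullet> (w - y) \<partial>unit_draw)"
      using AE_unit_draw by eventually_elim (rule le)
  qed (use integral_draw_measure(1)[OF integrable_sample(2)] in auto)
  then have "d * ?L / d \<le> (\<integral>a. (\<Sum>i\<in>UNIV. \<integral>b. sample (i, a, b) \<bullet> (w - y) \<partial>unit_draw) \<partial>unit_draw) / d"
    using d_pos by (intro divide_right_mono) (auto simp: prob_space[simplified])
  then show ?thesis
    unfolding integral_draw_measure(2)[OF integrable_sample(2)] d_eq[symmetric] using d_pos by simp
qed

end

section \<open>Reduction to the subroutine along a run\<close>

lemma prob_space_run_measure:
  assumes "prob_space N"
  shows "prob_space (run_measure N :: ('a \<times> (nat \<Rightarrow> 'n::finite \<times> (real^'n) \<times> (real^'n))) measure)"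
proof -
  interpret N: prob_space N by fact
  interpret D: prob_space "\<Pi>\<^sub>M t\<in>(UNIV :: nat set). (draw_measure :: ('n \<times> (real^'n) \<times> (real^'n)) measure)"
    by (intro prob_space_PiM prob_space_draw_measure)
  interpret pair_prob_space N "\<Pi>\<^sub>M t\<in>(UNIV :: nat set). (draw_measure :: ('n \<times> (real^'n) \<times> (real^'n)) measure)" ..
  show ?thesis unfolding run_measure_def by unfold_locales
qed

definition redraw :: "nat \<Rightarrow> ('a \<times> (nat \<Rightarrow> 's)) \<times> 's \<Rightarrow> 'a \<times> (nat \<Rightarrow> 's)" where
  "redraw t = (\<lambda>(\<omega>, \<eta>). (fst \<omega>, (snd \<omega>)(t := \<eta>)))"

lemma measurable_redraw: "redraw t \<in> (run_measure N \<Otimes>\<^sub>M draw_measure) \<rightarrow>\<^sub>M run_measure N"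
proof -
  have "(\<lambda>p. (fst (fst p), (snd (fst p))(t := snd p))) \<in> (run_measure N \<Otimes>\<^sub>M draw_measure) \<rightarrow>\<^sub>M run_measure N"
    unfolding run_measure_def
    by (intro measurable_Pair measurable_fun_upd[where J = UNIV]) measurable
  then show ?thesis by (simp add: redraw_def split_beta')
qed

lemma distr_redraw:
  fixes N :: "'a measure"
  assumes N: "prob_space N"
  shows "distr (run_measure N \<Otimes>\<^sub>M draw_measure) (run_measure N) (redraw t) =
    (run_measure N :: ('a \<times> (nat \<Rightarrow> 'n::finite \<times> (real^'n) \<times> (real^'n))) measure)"
proof (rule resample_distr[OF prob_space_draw_measure measurable_redraw])
  fix f :: "'a \<times> (nat \<Rightarrow> 'n \<times> (real^'n) \<times> (real^'n)) \<Rightarrow> ennreal"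
  assume f: "f \<in> borel_measurable (run_measure N)"
  let ?D = "draw_measure :: ('n \<times> (real^'n) \<times> (real^'n)) measure"
  let ?P = "\<Pi>\<^sub>M t\<in>(UNIV :: nat set). ?D"
  interpret N: prob_space N by fact
  interpret D: prob_space ?D by (rule prob_space_draw_measure)
  interpret P: prob_space ?P by (intro prob_space_PiM prob_space_draw_measure)
  have f'[measurable]: "f \<in> borel_measurable (N \<Otimes>\<^sub>M ?P)" using f by (simp add: run_measure_def)
  have T: "(\<lambda>p. f (redraw t p)) \<in> borel_measurable ((N \<Otimes>\<^sub>M ?P) \<Otimes>\<^sub>M ?D)"
    using measurable_compose[OF measurable_redraw f, of t] by (simp add: run_measure_def)
  have "(\<lambda>\<omega>. \<integral>\<^sup>+\<eta>. f (redraw t (\<omega>, \<eta>)) \<partial>?D) \<in> borel_measurable (N \<Otimes>\<^sub>M ?P)"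
    using D.borel_measurable_nn_integral_fst[OF T] .
  then have "(\<integral>\<^sup>+\<omega>. \<integral>\<^sup>+\<eta>. f (redraw t (\<omega>, \<eta>)) \<partial>?D \<partial>run_measure N)
      = (\<integral>\<^sup>+a. \<integral>\<^sup>+\<xi>. \<integral>\<^sup>+\<eta>. f (redraw t ((a, \<xi>), \<eta>)) \<partial>?D \<partial>?P \<partial>N)"
    unfolding run_measure_def by (rule P.nn_integral_fst[symmetric])
  also have "\<dots> = (\<integral>\<^sup>+a. \<integral>\<^sup>+\<xi>. f (a, \<xi>) \<partial>?P \<partial>N)"
  proof (rule nn_integral_cong)
    fix a assume [measurable]: "a \<in> space N"
    have "(\<lambda>\<xi>. f (a, \<xi>)) \<in> borel_measurable ?P" by measurable
    from nn_integral_PiM_resample[OF prob_space_draw_measure UNIV_I this, of t]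
    show "(\<integral>\<^sup>+\<xi>. \<integral>\<^sup>+\<eta>. f (redraw t ((a, \<xi>), \<eta>)) \<partial>?D \<partial>?P) = (\<integral>\<^sup>+\<xi>. f (a, \<xi>) \<partial>?P)"
      by (simp add: redraw_def)
  qed
  also have "\<dots> = (\<integral>\<^sup>+\<omega>. f \<omega> \<partial>run_measure N)"
    unfolding run_measure_def by (rule P.nn_integral_fst) measurable
  finally show "(\<integral>\<^sup>+\<omega>. \<integral>\<^sup>+\<eta>. f (redraw t (\<omega>, \<eta>)) \<partial>?D \<partial>run_measure N) = (\<integral>\<^sup>+\<omega>. f \<omega> \<partial>run_measure N)" .
qed

text \<open>The draw of a round is read by the oracle call of that round only.\<close>

lemma wrapper_rounds_cong:
  assumes "\<And>s. 1 \<le> s \<Longrightarrow> s \<le> t \<Longrightarrow> \<xi> s = \<xi>' s"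
  shows "wrapper_rounds A orac \<delta> adv sg \<xi> t = wrapper_rounds A orac \<delta> adv sg \<xi>' t"
  using assms by (induction t) (simp_all add: Let_def)

lemma (in prob_space) integral_sqrt_le:
  assumes Y: "integrable M Y" and nonneg: "\<And>x. 0 \<le> Y x"
  shows "integrable M (\<lambda>x. sqrt (Y x))" and "(\<integral>x. sqrt (Y x) \<partial>M) \<le> sqrt (\<integral>x. Y x \<partial>M)"
proof -
  have [measurable]: "Y \<in> borel_measurable M" using Y by (rule borel_measurable_integrable)
  have sq: "(\<lambda>x. (sqrt (Y x))\<^sup>2) = Y" using nonneg by auto
  show int: "integrable M (\<lambda>x. sqrt (Y x))"
    by (rule square_integrable_imp_integrable) (use Y sq in auto)
  have "0 \<le> variance (\<lambda>x. sqrt (Y x))" by simp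
  also have "\<dots> = (\<integral>x. Y x \<partial>M) - (\<integral>x. sqrt (Y x) \<partial>M)\<^sup>2"
    using variance_eq[OF int] Y by (simp add: sq nonneg)
  finally show "(\<integral>x. sqrt (Y x) \<partial>M) \<le> sqrt (\<integral>x. Y x \<partial>M)"
    by (intro real_le_rsqrt) simp
qed

lemma (in prob_space) integrable_inner:
  fixes h v :: "'a \<Rightarrow> 'v::euclidean_space"
  assumes [measurable]: "h \<in> borel_measurable M" "v \<in> borel_measurable M"
    and h: "integrable M (\<lambda>x. (norm (h x))\<^sup>2)" and v: "\<And>x. norm (v x) \<le> B"
  shows "integrable M (\<lambda>x. h x \<bullet> v x)"
proof (rule Bochner_Integration.integrable_bound)
  have "integrable M (\<lambda>x. norm (h x))"
    by (rule square_integrable_imp_integrable) (use h in auto)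
  then show "integrable M (\<lambda>x. norm (h x) * B)" by simp
  have "norm (h x \<bullet> v x) \<le> norm (norm (h x) * B)" for x
  proof -
    have "\<bar>h x \<bullet> v x\<bar> \<le> norm (h x) * norm (v x)" by (rule Cauchy_Schwarz_ineq2)
    also have "\<dots> \<le> norm (h x) * B" by (intro mult_left_mono v) simp
    finally show ?thesis by simp
  qed
  then show "AE x in M. norm (h x \<bullet> v x) \<le> norm (norm (h x) * B)" by simp
qed measurable

lemma sum_inverse_squares_le: "(\<Sum>k<n. 1 / (real (Suc k))\<^sup>2) \<le> 2"
proof -
  have "(\<Sum>k<n. 1 / (real (Suc k))\<^sup>2) \<le> 2 - 1 / real n" if "1 \<le> n"
    using that
  proof (induction n rule: dec_induct)
    case base
    then show ?case by simp
  next
    case (step n)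
    have "1 / (real (Suc n))\<^sup>2 \<le> 1 / (real n * real (Suc n))"
      using step by (intro divide_left_mono) (auto simp: power2_eq_square)
    also have "\<dots> = 1 / real n - 1 / real (Suc n)"
      using step by (simp add: field_simps)
    finally show ?case using step.IH by simp
  qed
  then show ?thesis by (cases "n = 0") (auto intro: order_trans)
qed

locale projection_free_run = vector_oracle C r R MEM
  for C :: "(real^'n) set" and r R MEM +
  fixes \<delta> :: real and N :: "'a measure"
    and adv :: "'a \<Rightarrow> ((real^'n) \<times> (real^'n \<Rightarrow> real)) list \<Rightarrow> real^'n \<Rightarrow> (real^'n \<Rightarrow> real)"
    and sg :: "(real^'n \<Rightarrow> real) \<Rightarrow> real^'n \<Rightarrow> real^'n"
  assumes \<delta>: "0 < \<delta>" "\<delta> < 1 / 3" and N: "prob_space N"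
begin

text \<open>From here on rounds are counted from \<open>0\<close>: index \<open>k\<close> stands for round \<open>k + 1\<close>, whose draw is
  \<open>snd \<omega> (Suc k)\<close>.\<close>

abbreviation M :: "('a \<times> (nat \<Rightarrow> 'n \<times> (real^'n) \<times> (real^'n))) measure" where
  "M \<equiv> run_measure N"

definition rounds :: "nat \<Rightarrow> 'a \<times> (nat \<Rightarrow> 'n \<times> (real^'n) \<times> (real^'n)) \<Rightarrow> (real^'n) round list" where
  "rounds t \<omega> = wrapper_rounds (ftrl_proximal R) (one_d_opt MEM r R) (\<lambda>t. \<delta> / (real t)\<^sup>2) (adv (fst \<omega>)) sg (snd \<omega>) t"

definition tolerance :: "nat \<Rightarrow> real" where
  "tolerance k = \<delta> / (real (Suc k))\<^sup>2"

definition query :: "nat \<Rightarrow> 'a \<times> (nat \<Rightarrow> 'n \<times> (real^'n) \<times> (real^'n)) \<Rightarrow> real^'n" where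
  "query k \<omega> = ftrl_proximal R (map surrogate (rounds k \<omega>))"

definition gauge_est :: "nat \<Rightarrow> 'a \<times> (nat \<Rightarrow> 'n \<times> (real^'n) \<times> (real^'n)) \<Rightarrow> real" where
  "gauge_est k \<omega> = gau MEM r R (query k \<omega>) (tolerance k)"

text \<open>The draw \<open>\<eta>\<close> is an argument of its own, so that it can be averaged while the past \<open>\<omega>\<close> is held fixed.\<close>

definition direction :: "nat \<Rightarrow> 'n \<times> (real^'n) \<times> (real^'n) \<Rightarrow> 'a \<times> (nat \<Rightarrow> 'n \<times> (real^'n) \<times> (real^'n)) \<Rightarrow> real^'n" where
  "direction k \<eta> \<omega> = snd (one_d_opt MEM r R \<eta> (query k \<omega>) (tolerance k))"

definition play :: "nat \<Rightarrow> 'a \<times> (nat \<Rightarrow> 'n \<times> (real^'n) \<times> (real^'n)) \<Rightarrow> real^'n" where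
  "play k \<omega> = (if 1 \<le> gauge_est k \<omega> then (1 / gauge_est k \<omega>) *\<^sub>R query k \<omega> else query k \<omega>)"

definition grad :: "nat \<Rightarrow> 'a \<times> (nat \<Rightarrow> 'n \<times> (real^'n) \<times> (real^'n)) \<Rightarrow> real^'n" where
  "grad k \<omega> = sg (adv (fst \<omega>) (map (\<lambda>\<rho>. (iterate \<rho>, loss \<rho>)) (rounds k \<omega>)) (play k \<omega>)) (play k \<omega>)"

text \<open>The factor with which the sampled direction enters the modified gradient. It is nonnegative, and
  like the play it is determined before the direction is drawn.\<close>

definition weight :: "nat \<Rightarrow> 'a \<times> (nat \<Rightarrow> 'n \<times> (real^'n) \<times> (real^'n)) \<Rightarrow> real" where
  "weight k \<omega> = (if 1 \<le> gauge_est k \<omega> \<and> grad k \<omega> \<bullet> query k \<omega> < 0 then - (grad k \<omega> \<bullet> play k \<omega>) else 0)"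

definition modified_grad :: "nat \<Rightarrow> 'a \<times> (nat \<Rightarrow> 'n \<times> (real^'n) \<times> (real^'n)) \<Rightarrow> real^'n" where
  "modified_grad k \<omega> = grad k \<omega> + weight k \<omega> *\<^sub>R direction k (snd \<omega> (Suc k)) \<omega>"

lemma fst_one_d_opt: "fst (one_d_opt MEM r R \<eta> w e) = gau MEM r R w e"
  by (cases \<eta>) (simp add: one_d_opt_eq)

lemma rounds_Suc:
  "rounds (Suc k) \<omega> = rounds k \<omega> @ [\<lparr>iterate = play k \<omega>,
     loss = adv (fst \<omega>) (map (\<lambda>\<rho>. (iterate \<rho>, loss \<rho>)) (rounds k \<omega>)) (play k \<omega>),
     subgrad = grad k \<omega>, surrogate = modified_grad k \<omega>\<rparr>]"
  unfolding rounds_def wrapper_rounds.simps Let_def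
  unfolding rounds_def[symmetric] query_def[symmetric] tolerance_def[symmetric]
  by (simp add: split_beta fst_one_d_opt flip: gauge_est_def direction_def)
    (auto simp: play_def grad_def weight_def modified_grad_def)

lemma run_round_Suc:
  "iterate (run_round MEM r R \<delta> adv sg (Suc k) \<omega>) = play k \<omega>"
  "subgrad (run_round MEM r R \<delta> adv sg (Suc k) \<omega>) = grad k \<omega>"
  using rounds_Suc[of k \<omega>] unfolding run_round_def rounds_def by simp_all

lemma query_norm: "norm (query k \<omega>) \<le> R"
  using ftrl_output_in_ball[OF R_pos] by (simp add: query_def)

lemma tolerance_bounds: "0 < tolerance k" "tolerance k \<le> \<delta>" "tolerance k < 1 / 3"
proof -
  have "1 \<le> (real (Suc k))\<^sup>2" by simp
  then have "\<delta> / (real (Suc k))\<^sup>2 \<le> \<delta> / 1" using \<delta> by (intro divide_left_mono) auto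
  then show "tolerance k \<le> \<delta>" by (simp add: tolerance_def)
  then show "tolerance k < 1 / 3" using \<delta> by simp
  show "0 < tolerance k" using \<delta> by (simp add: tolerance_def)
qed

lemma gauge_est_accuracy:
  "gauge_est k \<omega> = 0 \<and> minkowski C (query k \<omega>) \<le> 11 / 20 \<or>
    0 < gauge_est k \<omega> \<and> gauge_est k \<omega> \<le> minkowski C (query k \<omega>) + tolerance k \<and>
      (minkowski C (query k \<omega>) \<le> 1 / 2 \<or> minkowski C (query k \<omega>) \<le> gauge_est k \<omega>) \<and>
      (gauge_est k \<omega> < 1 \<longrightarrow> minkowski C (query k \<omega>) \<le> 1)"
  unfolding gauge_est_def
  by (rule gau_accuracy) (use query_norm[of k \<omega>] R_pos tolerance_bounds in auto)

lemma play_in_C: "play k \<omega> \<in> C"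
proof (rule mem_if_minkowski_le_one)
  let ?m = "minkowski C (query k \<omega>)"
  show "minkowski C (play k \<omega>) \<le> 1"
  proof (cases "1 \<le> gauge_est k \<omega>")
    case True
    then have "?m \<le> gauge_est k \<omega>" using gauge_est_accuracy[of k \<omega>] by auto
    moreover have "minkowski C ((1 / gauge_est k \<omega>) *\<^sub>R query k \<omega>) = 1 / gauge_est k \<omega> * ?m"
      using True by (intro minkowski_scale) auto
    ultimately show ?thesis using True by (simp add: play_def)
  next
    case False
    then show ?thesis using gauge_est_accuracy[of k \<omega>] by (auto simp: play_def)
  qed
qed

lemma play_norm: "norm (play k \<omega>) \<le> R"
  using play_in_C[of k \<omega>] outer_ball by auto

lemma gauge_est_le: "gauge_est k \<omega> \<le> R / r + \<delta>"
proof -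
  have "minkowski C (query k \<omega>) \<le> norm (query k \<omega>) / r" by (rule minkowski_le_norm)
  also have "\<dots> \<le> R / r" using query_norm r_pos by (intro divide_right_mono) auto
  finally show ?thesis
    using gauge_est_accuracy[of k \<omega>] tolerance_bounds[of k] r_pos R_pos \<delta> by (auto intro: add_nonneg_nonneg)
qed

lemma weight_bounds: "0 \<le> weight k \<omega>" "weight k \<omega> \<le> R * norm (grad k \<omega>)"
proof -
  show "0 \<le> weight k \<omega>"
    by (auto simp: weight_def play_def divide_nonpos_nonneg)
  have "- (grad k \<omega> \<bullet> play k \<omega>) \<le> norm (grad k \<omega>) * norm (play k \<omega>)"
    using Cauchy_Schwarz_ineq2[of "grad k \<omega>" "play k \<omega>"] by simp
  also have "\<dots> \<le> norm (grad k \<omega>) * R" by (intro mult_left_mono play_norm) simp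
  finally show "weight k \<omega> \<le> R * norm (grad k \<omega>)"
    using R_pos by (auto simp: weight_def mult.commute)
qed

text \<open>The draw of a round enters only the direction, since the approximate gauge, which fixes the play, is
  deterministic. So redrawing it changes nothing up to and including the observed gradient of this
  round.\<close>

lemma rounds_redraw: "rounds k (redraw (Suc k) (\<omega>, \<eta>)) = rounds k \<omega>"
  unfolding rounds_def by (auto simp: redraw_def intro!: wrapper_rounds_cong)

lemma redraw_simps:
  "query k (redraw (Suc k) (\<omega>, \<eta>)) = query k \<omega>"
  "gauge_est k (redraw (Suc k) (\<omega>, \<eta>)) = gauge_est k \<omega>"
  "grad k (redraw (Suc k) (\<omega>, \<eta>)) = grad k \<omega>"
  "weight k (redraw (Suc k) (\<omega>, \<eta>)) = weight k \<omega>"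
  "direction k \<eta>' (redraw (Suc k) (\<omega>, \<eta>)) = direction k \<eta>' \<omega>"
  "snd (redraw (Suc k) (\<omega>, \<eta>)) (Suc k) = \<eta>"
proof -
  show q: "query k (redraw (Suc k) (\<omega>, \<eta>)) = query k \<omega>"
    by (simp add: query_def rounds_redraw)
  show g: "gauge_est k (redraw (Suc k) (\<omega>, \<eta>)) = gauge_est k \<omega>" by (simp add: gauge_est_def q)
  have x: "play k (redraw (Suc k) (\<omega>, \<eta>)) = play k \<omega>" by (simp add: play_def q g)
  show gr: "grad k (redraw (Suc k) (\<omega>, \<eta>)) = grad k \<omega>"
    by (simp add: grad_def x rounds_redraw) (simp add: redraw_def)
  show "weight k (redraw (Suc k) (\<omega>, \<eta>)) = weight k \<omega>" by (simp add: weight_def q g gr x)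
  show "direction k \<eta>' (redraw (Suc k) (\<omega>, \<eta>)) = direction k \<eta>' \<omega>" by (simp add: direction_def q)
  show "snd (redraw (Suc k) (\<omega>, \<eta>)) (Suc k) = \<eta>" by (simp add: redraw_def)
qed

text \<open>The only loss of the reduction is the second summand. If the sampled direction were a subgradient of
  the gauge at the query point and the estimated gauge were exact, then that summand would be at most
  \<open>0\<close> for \<open>y\<close> in \<open>C\<close>, as the gauge of \<open>y\<close> is at most \<open>1\<close>.\<close>

lemma inner_play_le:
  "grad k \<omega> \<bullet> (play k \<omega> - y) \<le> modified_grad k \<omega> \<bullet> (query k \<omega> - y)
    + weight k \<omega> * (gauge_est k \<omega> - 1 - direction k (snd \<omega> (Suc k)) \<omega> \<bullet> (query k \<omega> - y))"
proof -
  let ?g = "grad k \<omega>" and ?w = "query k \<omega>" and ?x = "play k \<omega>"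
  have "?g \<bullet> ?x \<le> ?g \<bullet> ?w + weight k \<omega> * (gauge_est k \<omega> - 1)"
  proof (cases "1 \<le> gauge_est k \<omega>")
    case False
    then show ?thesis by (simp add: play_def weight_def)
  next
    case True
    then have x: "?g \<bullet> ?x = ?g \<bullet> ?w / gauge_est k \<omega>" by (simp add: play_def)
    show ?thesis
    proof (cases "?g \<bullet> ?w < 0")
      case False
      then have "(?g \<bullet> ?w) / gauge_est k \<omega> \<le> (?g \<bullet> ?w) / 1" using True by (intro divide_left_mono) auto
      then show ?thesis using False by (simp add: x weight_def)
    next
      case neg: True
      then have "weight k \<omega> = - (?g \<bullet> ?w / gauge_est k \<omega>)" using True by (simp add: weight_def x)
      then show ?thesis using True by (simp add: x field_simps)
    qed
  qed
  then show ?thesis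
    by (simp add: modified_grad_def inner_add_left inner_diff_right algebra_simps)
qed

lemma surrogates: "map surrogate (rounds T \<omega>) = map (\<lambda>k. modified_grad k \<omega>) [0..<T]"
  by (induction T) (simp_all add: rounds_Suc, simp add: rounds_def)

lemma surrogate_regret:
  assumes "norm y \<le> R"
  shows "(\<Sum>k<T. modified_grad k \<omega> \<bullet> (query k \<omega> - y)) \<le> 2 * sqrt 2 * R * sqrt (\<Sum>k<T. (norm (modified_grad k \<omega>))\<^sup>2)"
proof -
  have "ftrl_loss R (map surrogate (rounds T \<omega>)) = (\<Sum>k<T. modified_grad k \<omega> \<bullet> query k \<omega>)"
    by (induction T)
      (simp_all add: rounds_Suc ftrl_loss_snoc query_def, simp add: ftrl_loss_def rounds_def)
  moreover have "sum_list (map surrogate (rounds T \<omega>)) = (\<Sum>k<T. modified_grad k \<omega>)"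
    by (simp add: surrogates sum_list_sum_nth atLeast0LessThan)
  moreover have "(\<Sum>g\<leftarrow>map surrogate (rounds T \<omega>). (norm g)\<^sup>2) = (\<Sum>k<T. (norm (modified_grad k \<omega>))\<^sup>2)"
    by (simp add: surrogates sum_list_sum_nth atLeast0LessThan o_def)
  ultimately show ?thesis
    using ftrl_regret[OF R_pos assms, of "map surrogate (rounds T \<omega>)"]
    by (simp add: inner_diff_right sum_subtractf inner_sum_left)
qed

end

section \<open>Expectations along a run\<close>

context projection_free_run
begin

sublocale M: prob_space M
  by (rule prob_space_run_measure[OF N])

context
  assumes grad_meas: "\<And>k. grad k \<in> borel_measurable M"
begin

definition state :: "nat \<Rightarrow> 'a \<times> (nat \<Rightarrow> 'n \<times> (real^'n) \<times> (real^'n)) \<Rightarrow> (real^'n) ftrl_state" where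
  "state k \<omega> = foldl (ftrl_step R) ftrl_init (map surrogate (rounds k \<omega>))"

lemma measurable_direction_of_query:
  assumes "query k \<in> borel_measurable M"
  shows "(\<lambda>p. direction k (snd p) (fst p)) \<in> borel_measurable (M \<Otimes>\<^sub>M draw_measure)"
    and "(\<lambda>\<omega>. direction k (snd \<omega> (Suc k)) \<omega>) \<in> borel_measurable M"
proof -
  have comp: "(\<lambda>p. direction k (f p) (h p)) \<in> borel_measurable L"
    if "f \<in> L \<rightarrow>\<^sub>M draw_measure" "h \<in> L \<rightarrow>\<^sub>M M" for f h and L :: "'b measure"
    using measurable_compose[OF measurable_Pair[OF that(1) measurable_compose[OF that(2) assms]]
        measurable_one_d_opt[OF tolerance_bounds(1)[of k]]]
    by (simp add: direction_def)
  show "(\<lambda>p. direction k (snd p) (fst p)) \<in> borel_measurable (M \<Otimes>\<^sub>M draw_measure)"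
    by (rule comp) measurable
  have "(\<lambda>\<omega>. snd \<omega> (Suc k)) \<in> M \<rightarrow>\<^sub>M draw_measure"
    unfolding run_measure_def by measurable
  then show "(\<lambda>\<omega>. direction k (snd \<omega> (Suc k)) \<omega>) \<in> borel_measurable M"
    by (rule comp) simp
qed

lemma measurable_round_of_query:
  assumes [measurable]: "query k \<in> borel_measurable M"
  shows "gauge_est k \<in> borel_measurable M" "play k \<in> borel_measurable M" "weight k \<in> borel_measurable M"
    "modified_grad k \<in> borel_measurable M"
proof -
  note [measurable] = grad_meas[of k] measurable_direction_of_query(2)[OF assms]
  show g[measurable]: "gauge_est k \<in> borel_measurable M"
    unfolding gauge_est_def[abs_def]
    by (rule measurable_compose[OF assms measurable_gau[OF oracle_meas r_pos R_pos tolerance_bounds(1)]])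
  show [measurable]: "play k \<in> borel_measurable M" unfolding play_def[abs_def] by measurable
  show [measurable]: "weight k \<in> borel_measurable M" unfolding weight_def[abs_def] by measurable
  show "modified_grad k \<in> borel_measurable M" unfolding modified_grad_def[abs_def] by measurable
qed

text \<open>The adversary is an arbitrary function, so measurability does not follow by composing the steps of
  the protocol. But the learner sees the adversary only through the observed gradients, and these are
  random variables by assumption.\<close>

lemma measurable_state:
  "(\<lambda>\<omega>. sum_grads (state k \<omega>)) \<in> borel_measurable M"
  "(\<lambda>\<omega>. sum_squares (state k \<omega>)) \<in> borel_measurable M"
  "(\<lambda>\<omega>. sum_weights (state k \<omega>)) \<in> borel_measurable M"
  "(\<lambda>\<omega>. weighted_outputs (state k \<omega>)) \<in> borel_measurable M"
  "(\<lambda>\<omega>. ftrl_output (state k \<omega>)) \<in> borel_measurable M"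
proof (induction k)
  case 0
  {
    case 1 show ?case by (simp add: state_def rounds_def)
  next
    case 2 show ?case by (simp add: state_def rounds_def)
  next
    case 3 show ?case by (simp add: state_def rounds_def)
  next
    case 4 show ?case by (simp add: state_def rounds_def)
  next
    case 5 show ?case by (simp add: state_def rounds_def)
  }
next
  case (Suc k)
  have step: "state (Suc k) \<omega> = ftrl_step R (state k \<omega>) (modified_grad k \<omega>)" for \<omega>
    by (simp add: state_def rounds_Suc)
  have "query k \<in> borel_measurable M"
    using Suc.IH(5) by (simp add: query_def[abs_def] ftrl_proximal_def state_def)
  note [measurable] = Suc.IH measurable_round_of_query(4)[OF this]
  have "continuous_on UNIV (closest_point (cball 0 R :: (real^'n) set))"
    using R_pos by (intro continuous_on_closest_point) auto
  then have [measurable]: "closest_point (cball 0 R :: (real^'n) set) \<in> borel_measurable borel"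
    by (rule borel_measurable_continuous_onI)
  {
    case 1 show ?case unfolding step ftrl_step_def Let_def by simp
  next
    case 2 show ?case unfolding step ftrl_step_def Let_def by simp
  next
    case 3 show ?case unfolding step ftrl_step_def Let_def ftrl_rate_def by simp
  next
    case 4 show ?case unfolding step ftrl_step_def Let_def ftrl_rate_def by simp
  next
    case 5 show ?case unfolding step ftrl_step_def Let_def ftrl_rate_def by simp
  }
qed

lemma measurable_query: "query k \<in> borel_measurable M"
  using measurable_state(5)[of k] by (simp add: query_def[abs_def] ftrl_proximal_def state_def)

lemmas measurable_round = measurable_query measurable_round_of_query[OF measurable_query] grad_meas
  measurable_direction_of_query[OF measurable_query]

lemma query_oracle:
  assumes "weight k \<omega> \<noteq> 0"
  shows "oracle_query C r R MEM (query k \<omega>) (tolerance k) (real CARD('n))"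
proof (unfold_locales)
  show "1 \<le> gau MEM r R (query k \<omega>) (tolerance k)"
    using assms by (auto simp: weight_def gauge_est_def split: if_splits)
qed (use query_norm tolerance_bounds in auto)

context
  fixes k :: nat
  assumes grad_int: "integrable M (\<lambda>\<omega>. (norm (grad k \<omega>))\<^sup>2)"
begin

lemma integrable_norm_grad: "integrable M (\<lambda>\<omega>. norm (grad k \<omega>))"
  by (rule M.square_integrable_imp_integrable) (use grad_meas[of k] grad_int in auto)

text \<open>Weight and query point are unchanged when the draw of their round is redrawn, so the squared norm of
  the direction can first be averaged over that draw. Working with nonnegative integrals yields
  integrability at the same time.\<close>

lemma correction_second_moment:
  "integrable M (\<lambda>\<omega>. (weight k \<omega>)\<^sup>2 * (norm (direction k (snd \<omega> (Suc k)) \<omega>))\<^sup>2)"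
  "(\<integral>\<omega>. (weight k \<omega>)\<^sup>2 * (norm (direction k (snd \<omega> (Suc k)) \<omega>))\<^sup>2 \<partial>M)
    \<le> real CARD('n) * (R / r + \<delta>)\<^sup>2 * (\<integral>\<omega>. (norm (grad k \<omega>))\<^sup>2 \<partial>M)"
proof -
  note [measurable] = measurable_round
  let ?f = "\<lambda>\<omega>. (weight k \<omega>)\<^sup>2 * (norm (direction k (snd \<omega> (Suc k)) \<omega>))\<^sup>2"
  let ?B = "real CARD('n) * (R / r + \<delta>)\<^sup>2"
  interpret D: prob_space "draw_measure :: ('n \<times> (real^'n) \<times> (real^'n)) measure"
    by (rule prob_space_draw_measure)
  have f: "?f \<in> borel_measurable M" by measurable
  have inner: "(\<integral>\<^sup>+\<eta>. ennreal ((weight k \<omega>)\<^sup>2 * (norm (direction k \<eta> \<omega>))\<^sup>2) \<partial>draw_measure)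
      \<le> ennreal (?B * (norm (grad k \<omega>))\<^sup>2)" for \<omega>
  proof (cases "weight k \<omega> = 0")
    case True
    then show ?thesis by simp
  next
    case False
    interpret Q: oracle_query C r R MEM "query k \<omega>" "tolerance k" "real CARD('n)"
      by (rule query_oracle[OF False])
    have int: "integrable draw_measure (\<lambda>\<eta>. (norm (direction k \<eta> \<omega>))\<^sup>2)"
      using Q.integrable_sample(1) by (simp add: direction_def)
    have "(\<integral>\<eta>. (norm (direction k \<eta> \<omega>))\<^sup>2 \<partial>draw_measure) \<le> real CARD('n) * (1 / r + tolerance k / R)\<^sup>2"
      using Q.sample_second_moment by (simp add: direction_def)
    then have "(weight k \<omega>)\<^sup>2 * (\<integral>\<eta>. (norm (direction k \<eta> \<omega>))\<^sup>2 \<partial>draw_measure)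
        \<le> (R * norm (grad k \<omega>))\<^sup>2 * (real CARD('n) * (1 / r + tolerance k / R)\<^sup>2)"
      using weight_bounds[of k \<omega>] by (intro mult_mono power_mono) auto
    also have "\<dots> = real CARD('n) * (R / r + tolerance k)\<^sup>2 * (norm (grad k \<omega>))\<^sup>2"
    proof -
      have "R * (1 / r + tolerance k / R) = R / r + tolerance k"
        using R_pos by (simp add: distrib_left)
      then have "R\<^sup>2 * (1 / r + tolerance k / R)\<^sup>2 = (R / r + tolerance k)\<^sup>2"
        by (simp flip: power_mult_distrib)
      then show ?thesis by (simp add: power_mult_distrib mult_ac)
    qed
    also have "\<dots> \<le> ?B * (norm (grad k \<omega>))\<^sup>2"
      using tolerance_bounds[of k] R_pos r_pos
      by (intro mult_right_mono mult_left_mono power_mono) auto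
    finally have "(\<integral>\<eta>. (weight k \<omega>)\<^sup>2 * (norm (direction k \<eta> \<omega>))\<^sup>2 \<partial>draw_measure) \<le> ?B * (norm (grad k \<omega>))\<^sup>2"
      by simp
    then show ?thesis
      using int by (subst nn_integral_eq_integral) (auto intro!: ennreal_leI)
  qed
  have "(\<integral>\<^sup>+\<omega>. ennreal (?f \<omega>) \<partial>M) = (\<integral>\<^sup>+\<omega>. ennreal (?f \<omega>) \<partial>distr (M \<Otimes>\<^sub>M draw_measure) M (redraw (Suc k)))"
    by (simp add: distr_redraw[OF N])
  also have "\<dots> = (\<integral>\<^sup>+p. ennreal (?f (redraw (Suc k) p)) \<partial>(M \<Otimes>\<^sub>M draw_measure))"
    by (rule nn_integral_distr[OF measurable_redraw]) (use f in simp)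
  also have "\<dots> = (\<integral>\<^sup>+\<omega>. \<integral>\<^sup>+\<eta>. ennreal (?f (redraw (Suc k) (\<omega>, \<eta>))) \<partial>draw_measure \<partial>M)"
  proof (rule D.nn_integral_fst[symmetric])
    show "(\<lambda>p. ennreal (?f (redraw (Suc k) p))) \<in> borel_measurable (M \<Otimes>\<^sub>M draw_measure)"
      by (rule measurable_compose[OF measurable_redraw]) (use f in simp)
  qed
  also have "\<dots> \<le> (\<integral>\<^sup>+\<omega>. ennreal (?B * (norm (grad k \<omega>))\<^sup>2) \<partial>M)"
    using inner by (intro nn_integral_mono) (simp add: redraw_simps)
  also have "\<dots> = ennreal (\<integral>\<omega>. ?B * (norm (grad k \<omega>))\<^sup>2 \<partial>M)"
    using grad_int by (intro nn_integral_eq_integral) auto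
  finally have le: "(\<integral>\<^sup>+\<omega>. ennreal (?f \<omega>) \<partial>M) \<le> ennreal (?B * (\<integral>\<omega>. (norm (grad k \<omega>))\<^sup>2 \<partial>M))"
    by simp
  show int: "integrable M ?f"
    using f le_less_trans[OF le ennreal_less_top] by (intro integrableI_bounded) auto
  have "ennreal (\<integral>\<omega>. ?f \<omega> \<partial>M) = (\<integral>\<^sup>+\<omega>. ennreal (?f \<omega>) \<partial>M)"
    by (rule nn_integral_eq_integral[OF int, symmetric]) simp
  then have "ennreal (\<integral>\<omega>. ?f \<omega> \<partial>M) \<le> ennreal (?B * (\<integral>\<omega>. (norm (grad k \<omega>))\<^sup>2 \<partial>M))"
    using le by simp
  moreover have "0 \<le> ?B * (\<integral>\<omega>. (norm (grad k \<omega>))\<^sup>2 \<partial>M)" by simp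
  ultimately show "(\<integral>\<omega>. ?f \<omega> \<partial>M) \<le> ?B * (\<integral>\<omega>. (norm (grad k \<omega>))\<^sup>2 \<partial>M)"
    by (simp only: ennreal_le_iff)
qed

lemma modified_grad_second_moment:
  "integrable M (\<lambda>\<omega>. (norm (modified_grad k \<omega>))\<^sup>2)"
  "(\<integral>\<omega>. (norm (modified_grad k \<omega>))\<^sup>2 \<partial>M) \<le> 2 * (1 + real CARD('n) * (R / r + \<delta>)\<^sup>2) * (\<integral>\<omega>. (norm (grad k \<omega>))\<^sup>2 \<partial>M)"
proof -
  note [measurable] = measurable_round
  let ?f = "\<lambda>\<omega>. (weight k \<omega>)\<^sup>2 * (norm (direction k (snd \<omega> (Suc k)) \<omega>))\<^sup>2"
  have le: "(norm (modified_grad k \<omega>))\<^sup>2 \<le> 2 * (norm (grad k \<omega>))\<^sup>2 + 2 * ?f \<omega>" for \<omega>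
  proof -
    let ?s = "weight k \<omega> *\<^sub>R direction k (snd \<omega> (Suc k)) \<omega>"
    have "(norm (modified_grad k \<omega>))\<^sup>2 \<le> (norm (grad k \<omega>) + norm ?s)\<^sup>2"
      unfolding modified_grad_def by (intro power_mono norm_triangle_ineq) auto
    also have "\<dots> \<le> 2 * (norm (grad k \<omega>))\<^sup>2 + 2 * (norm ?s)\<^sup>2"
      using sum_squares_bound[of "norm (grad k \<omega>)" "norm ?s"] by (simp add: power2_sum)
    finally show ?thesis by (simp add: power_mult_distrib)
  qed
  have int: "integrable M (\<lambda>\<omega>. 2 * (norm (grad k \<omega>))\<^sup>2 + 2 * ?f \<omega>)"
    using grad_int correction_second_moment(1) by auto
  show int': "integrable M (\<lambda>\<omega>. (norm (modified_grad k \<omega>))\<^sup>2)"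
    by (rule Bochner_Integration.integrable_bound[OF int]) (use le in \<open>auto intro!: AE_I2 order_trans[OF le abs_ge_self]\<close>)
  have "(\<integral>\<omega>. (norm (modified_grad k \<omega>))\<^sup>2 \<partial>M) \<le> (\<integral>\<omega>. 2 * (norm (grad k \<omega>))\<^sup>2 + 2 * ?f \<omega> \<partial>M)"
    using int int' le by (intro integral_mono) auto
  also have "\<dots> = 2 * (\<integral>\<omega>. (norm (grad k \<omega>))\<^sup>2 \<partial>M) + 2 * (\<integral>\<omega>. ?f \<omega> \<partial>M)"
    using grad_int correction_second_moment(1) by simp
  finally show "(\<integral>\<omega>. (norm (modified_grad k \<omega>))\<^sup>2 \<partial>M) \<le> 2 * (1 + real CARD('n) * (R / r + \<delta>)\<^sup>2) * (\<integral>\<omega>. (norm (grad k \<omega>))\<^sup>2 \<partial>M)"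
    using correction_second_moment(2) by (simp add: algebra_simps)
qed

context
  fixes y :: "real^'n"
  assumes y: "y \<in> C"
begin

lemma y_norm: "norm y \<le> R"
  using y outer_ball by auto

lemma norm_diff_y: "norm x \<le> R \<Longrightarrow> norm (x - y) \<le> 2 * R"
  using y_norm norm_triangle_ineq4[of x y] by linarith

text \<open>Redrawing again: with the past held fixed, the mean direction satisfies the subgradient inequality up
  to three tolerances.\<close>

lemma correction_mean:
  defines "Z \<equiv> \<lambda>\<omega>. weight k \<omega> * (gauge_est k \<omega> - 1 - direction k (snd \<omega> (Suc k)) \<omega> \<bullet> (query k \<omega> - y))"
  shows "integrable M Z" "(\<integral>\<omega>. Z \<omega> \<partial>M) \<le> 3 * tolerance k * R * (\<integral>\<omega>. norm (grad k \<omega>) \<partial>M)"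
proof -
  note [measurable] = measurable_round
  interpret D: prob_space "draw_measure :: ('n \<times> (real^'n) \<times> (real^'n)) measure"
    by (rule prob_space_draw_measure)
  have Zeq: "Z = (\<lambda>\<omega>. weight k \<omega> * (gauge_est k \<omega> - 1) - (weight k \<omega> *\<^sub>R direction k (snd \<omega> (Suc k)) \<omega>) \<bullet> (query k \<omega> - y))"
    by (auto simp: Z_def right_diff_distrib)
  have "integrable M (\<lambda>\<omega>. weight k \<omega> * (gauge_est k \<omega> - 1))"
  proof (rule Bochner_Integration.integrable_bound)
    show "integrable M (\<lambda>\<omega>. norm (grad k \<omega>) * (R * (R / r + \<delta>)))"
      using integrable_norm_grad by simp
    have "norm (weight k \<omega> * (gauge_est k \<omega> - 1)) \<le> norm (norm (grad k \<omega>) * (R * (R / r + \<delta>)))" for \<omega>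
    proof (cases "1 \<le> gauge_est k \<omega>")
      case False
      then show ?thesis by (simp add: weight_def)
    next
      case True
      have "weight k \<omega> * (gauge_est k \<omega> - 1) \<le> (R * norm (grad k \<omega>)) * (R / r + \<delta>)"
        using True weight_bounds[of k \<omega>] gauge_est_le[of k \<omega>] by (intro mult_mono) auto
      then show ?thesis
        using True weight_bounds(1)[of k \<omega>] R_pos r_pos \<delta> by (simp add: mult_ac abs_mult add_pos_pos abs_of_pos)
    qed
    then show "AE \<omega> in M. norm (weight k \<omega> * (gauge_est k \<omega> - 1)) \<le> norm (norm (grad k \<omega>) * (R * (R / r + \<delta>)))"
      by simp
  qed measurable
  moreover have "integrable M (\<lambda>\<omega>. (weight k \<omega> *\<^sub>R direction k (snd \<omega> (Suc k)) \<omega>) \<bullet> (query k \<omega> - y))"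
    using correction_second_moment(1) query_norm norm_diff_y
    by (intro M.integrable_inner[where B = "2 * R"]) (auto simp: power_mult_distrib)
  ultimately show Z: "integrable M Z" unfolding Zeq by (rule Bochner_Integration.integrable_diff)
  note R = resample_integral[OF M.prob_space_axioms prob_space_draw_measure measurable_redraw distr_redraw[OF N] Z, of "Suc k"]
  have inner: "(\<integral>\<eta>. Z (redraw (Suc k) (\<omega>, \<eta>)) \<partial>draw_measure) \<le> 3 * tolerance k * R * norm (grad k \<omega>)" for \<omega>
  proof (cases "weight k \<omega> = 0")
    case True
    then show ?thesis
      using tolerance_bounds(1)[of k] R_pos by (simp add: Z_def redraw_simps)
  next
    case False
    interpret Q: oracle_query C r R MEM "query k \<omega>" "tolerance k" "real CARD('n)"
      by (rule query_oracle[OF False])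
    have int: "integrable draw_measure (\<lambda>\<eta>. direction k \<eta> \<omega> \<bullet> (query k \<omega> - y))"
      using Q.integrable_sample(2) by (simp add: direction_def)
    have "gauge_est k \<omega> - 1 - 3 * tolerance k \<le> (\<integral>\<eta>. direction k \<eta> \<omega> \<bullet> (query k \<omega> - y) \<partial>draw_measure)"
      using Q.sample_mean[OF y] by (simp add: direction_def gauge_est_def)
    then have "weight k \<omega> * (gauge_est k \<omega> - 1 - (\<integral>\<eta>. direction k \<eta> \<omega> \<bullet> (query k \<omega> - y) \<partial>draw_measure))
        \<le> weight k \<omega> * (3 * tolerance k)"
      using weight_bounds(1)[of k \<omega>] by (intro mult_left_mono) auto
    also have "\<dots> \<le> (R * norm (grad k \<omega>)) * (3 * tolerance k)"
      using weight_bounds(2)[of k \<omega>] tolerance_bounds(1)[of k] by (intro mult_right_mono) auto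
    finally show ?thesis
      using int by (simp add: Z_def redraw_simps D.prob_space[simplified] mult_ac)
  qed
  have "(\<integral>\<omega>. Z \<omega> \<partial>M) = (\<integral>\<omega>. \<integral>\<eta>. Z (redraw (Suc k) (\<omega>, \<eta>)) \<partial>draw_measure \<partial>M)"
    by (rule R(1)[symmetric])
  also have "\<dots> \<le> (\<integral>\<omega>. 3 * tolerance k * R * norm (grad k \<omega>) \<partial>M)"
    using inner R(3) integrable_norm_grad by (intro integral_mono) auto
  finally show "(\<integral>\<omega>. Z \<omega> \<partial>M) \<le> 3 * tolerance k * R * (\<integral>\<omega>. norm (grad k \<omega>) \<partial>M)" by simp
qed

lemma integrable_modified_grad: "integrable M (\<lambda>\<omega>. modified_grad k \<omega> \<bullet> (query k \<omega> - y))"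
proof -
  note [measurable] = measurable_round
  show ?thesis
    using modified_grad_second_moment(1) query_norm norm_diff_y
    by (intro M.integrable_inner[where B = "2 * R"]) auto
qed

lemma round_mean:
  "(\<integral>\<omega>. grad k \<omega> \<bullet> (play k \<omega> - y) \<partial>M)
    \<le> (\<integral>\<omega>. modified_grad k \<omega> \<bullet> (query k \<omega> - y) \<partial>M) + 3 * tolerance k * R * (\<integral>\<omega>. norm (grad k \<omega>) \<partial>M)"
proof -
  note [measurable] = measurable_round
  have int: "integrable M (\<lambda>\<omega>. grad k \<omega> \<bullet> (play k \<omega> - y))"
    using grad_int play_norm norm_diff_y by (intro M.integrable_inner[where B = "2 * R"]) auto
  have "(\<integral>\<omega>. grad k \<omega> \<bullet> (play k \<omega> - y) \<partial>M) \<le> (\<integral>\<omega>. modified_grad k \<omega> \<bullet> (query k \<omega> - y)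
      + weight k \<omega> * (gauge_est k \<omega> - 1 - direction k (snd \<omega> (Suc k)) \<omega> \<bullet> (query k \<omega> - y)) \<partial>M)"
    using int integrable_modified_grad correction_mean(1) inner_play_le by (intro integral_mono) auto
  also have "\<dots> = (\<integral>\<omega>. modified_grad k \<omega> \<bullet> (query k \<omega> - y) \<partial>M)
      + (\<integral>\<omega>. weight k \<omega> * (gauge_est k \<omega> - 1 - direction k (snd \<omega> (Suc k)) \<omega> \<bullet> (query k \<omega> - y)) \<partial>M)"
    by (intro Bochner_Integration.integral_add integrable_modified_grad correction_mean(1))
  finally show ?thesis using correction_mean(2) by linarith
qed

end

end

text \<open>The constant \<open>4\<close> is \<open>2 * sqrt 2\<close> from the regret of the subroutine times \<open>sqrt 2\<close> from splitting the
  squared norm of the modified gradient; the constant \<open>6\<close> is three tolerances times a bound \<open>2\<close> for the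
  sum of the inverse squares.\<close>

lemma expected_regret:
  assumes T: "1 \<le> T" and int: "\<And>k. k < T \<Longrightarrow> integrable M (\<lambda>\<omega>. (norm (grad k \<omega>))\<^sup>2)" and y: "y \<in> C"
  shows "(\<Sum>k<T. \<integral>\<omega>. grad k \<omega> \<bullet> (play k \<omega> - y) \<partial>M)
    \<le> 4 * R * sqrt ((1 + real CARD('n) * (R / r + \<delta>)\<^sup>2) * (\<Sum>k<T. \<integral>\<omega>. (norm (grad k \<omega>))\<^sup>2 \<partial>M))
      + 6 * \<delta> * R * (\<integral>\<omega>. (MAX k\<in>{..<T}. norm (grad k \<omega>)) \<partial>M)"
proof -
  note [measurable] = measurable_round
  let ?max = "\<lambda>\<omega>. MAX k\<in>{..<T}. norm (grad k \<omega>)"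
  let ?Y = "\<lambda>\<omega>. \<Sum>k<T. (norm (modified_grad k \<omega>))\<^sup>2"
  let ?A = "1 + real CARD('n) * (R / r + \<delta>)\<^sup>2"
  let ?S = "\<Sum>k<T. \<integral>\<omega>. (norm (grad k \<omega>))\<^sup>2 \<partial>M"
  have le_max: "norm (grad k \<omega>) \<le> ?max \<omega>" if "k < T" for k \<omega>
    using that by (intro Max_ge) auto
  have zero: "0 \<in> {..<T}" using T by simp
  have int_max: "integrable M ?max"
  proof (rule Bochner_Integration.integrable_bound)
    show "integrable M (\<lambda>\<omega>. \<Sum>k<T. norm (grad k \<omega>))"
      using int integrable_norm_grad by auto
    have "norm (?max \<omega>) \<le> norm (\<Sum>k<T. norm (grad k \<omega>))" for \<omega>
    proof -
      have "?max \<omega> \<in> (\<lambda>k. norm (grad k \<omega>)) ` {..<T}" using zero by (intro Max_in) auto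
      then obtain k where "k < T" "?max \<omega> = norm (grad k \<omega>)" by auto
      moreover have "norm (grad k \<omega>) \<le> (\<Sum>k<T. norm (grad k \<omega>))" using \<open>k < T\<close> by (intro member_le_sum) auto
      ultimately show ?thesis by (simp add: sum_nonneg)
    qed
    then show "AE \<omega> in M. norm (?max \<omega>) \<le> norm (\<Sum>k<T. norm (grad k \<omega>))" by simp
    show "?max \<in> borel_measurable M" by (intro borel_measurable_Max) auto
  qed
  have ftrl_part: "(\<Sum>k<T. \<integral>\<omega>. modified_grad k \<omega> \<bullet> (query k \<omega> - y) \<partial>M) \<le> 4 * R * sqrt (?A * ?S)"
  proof -
    have yR: "norm y \<le> R" using y outer_ball by auto
    have intY: "integrable M ?Y" using int modified_grad_second_moment(1) by auto
    have Y_nonneg: "0 \<le> ?Y \<omega>" for \<omega> by (intro sum_nonneg) auto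
    have "(\<Sum>k<T. \<integral>\<omega>. modified_grad k \<omega> \<bullet> (query k \<omega> - y) \<partial>M) = (\<integral>\<omega>. (\<Sum>k<T. modified_grad k \<omega> \<bullet> (query k \<omega> - y)) \<partial>M)"
      using integrable_modified_grad[OF int y] by (subst Bochner_Integration.integral_sum) auto
    also have "\<dots> \<le> (\<integral>\<omega>. 2 * sqrt 2 * R * sqrt (?Y \<omega>) \<partial>M)"
      using integrable_modified_grad[OF int y] M.integral_sqrt_le(1)[OF intY Y_nonneg] surrogate_regret[OF yR]
      by (intro integral_mono) auto
    also have "\<dots> = 2 * sqrt 2 * R * (\<integral>\<omega>. sqrt (?Y \<omega>) \<partial>M)" by simp
    also have "\<dots> \<le> 2 * sqrt 2 * R * sqrt (\<integral>\<omega>. ?Y \<omega> \<partial>M)"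
      using M.integral_sqrt_le(2)[OF intY Y_nonneg] R_pos by (intro mult_left_mono) auto
    also have "\<dots> \<le> 2 * sqrt 2 * R * sqrt (2 * (?A * ?S))"
    proof (intro mult_left_mono real_sqrt_le_mono)
      have "(\<integral>\<omega>. ?Y \<omega> \<partial>M) = (\<Sum>k<T. \<integral>\<omega>. (norm (modified_grad k \<omega>))\<^sup>2 \<partial>M)"
        using int modified_grad_second_moment(1) by (intro Bochner_Integration.integral_sum) auto
      also have "\<dots> \<le> (\<Sum>k<T. 2 * ?A * (\<integral>\<omega>. (norm (grad k \<omega>))\<^sup>2 \<partial>M))"
        using int modified_grad_second_moment(2) by (intro sum_mono) auto
      finally show "(\<integral>\<omega>. ?Y \<omega> \<partial>M) \<le> 2 * (?A * ?S)" by (simp only: sum_distrib_left mult.assoc)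
    qed (use R_pos in auto)
    also have "\<dots> = 4 * R * sqrt (?A * ?S)" by (simp add: real_sqrt_mult)
    finally show ?thesis .
  qed
  have "(\<Sum>k<T. 3 * tolerance k * R * (\<integral>\<omega>. norm (grad k \<omega>) \<partial>M)) \<le> (\<Sum>k<T. 3 * tolerance k * R * (\<integral>\<omega>. ?max \<omega> \<partial>M))"
    using le_max int_max int integrable_norm_grad tolerance_bounds(1) R_pos
    by (intro sum_mono mult_left_mono integral_mono) (auto simp: less_imp_le)
  also have "\<dots> = 3 * \<delta> * R * (\<integral>\<omega>. ?max \<omega> \<partial>M) * (\<Sum>k<T. 1 / (real (Suc k))\<^sup>2)"
    unfolding sum_distrib_left by (intro sum.cong) (simp_all add: tolerance_def)
  also have "\<dots> \<le> 3 * \<delta> * R * (\<integral>\<omega>. ?max \<omega> \<partial>M) * 2"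
  proof (intro mult_left_mono sum_inverse_squares_le)
    have "0 \<le> ?max \<omega>" for \<omega> using T by (intro order_trans[OF norm_ge_zero le_max[of 0]]) simp
    then have "0 \<le> (\<integral>\<omega>. ?max \<omega> \<partial>M)" by (rule Bochner_Integration.integral_nonneg)
    then show "0 \<le> 3 * \<delta> * R * (\<integral>\<omega>. ?max \<omega> \<partial>M)"
      using \<delta> R_pos by simp
  qed
  finally have correction_part: "(\<Sum>k<T. 3 * tolerance k * R * (\<integral>\<omega>. norm (grad k \<omega>) \<partial>M)) \<le> 6 * \<delta> * R * (\<integral>\<omega>. ?max \<omega> \<partial>M)"
    by simp
  have "(\<Sum>k<T. \<integral>\<omega>. grad k \<omega> \<bullet> (play k \<omega> - y) \<partial>M)
      \<le> (\<Sum>k<T. (\<integral>\<omega>. modified_grad k \<omega> \<bullet> (query k \<omega> - y) \<partial>M) + 3 * tolerance k * R * (\<integral>\<omega>. norm (grad k \<omega>) \<partial>M))"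
    using int y by (intro sum_mono round_mean) auto
  then show ?thesis using ftrl_part correction_part by (simp add: sum.distrib)
qed

end

end

theorem theorem6:
  fixes C :: "(real^'n) set"
    and MEM :: "real^'n \<Rightarrow> real \<Rightarrow> bool"
    and r R \<kappa> \<delta> :: real
    and N :: "'a measure"
    and adv :: "'a \<Rightarrow> ((real^'n) \<times> (real^'n \<Rightarrow> real)) list \<Rightarrow> real^'n \<Rightarrow> (real^'n \<Rightarrow> real)"
    and sg :: "(real^'n \<Rightarrow> real) \<Rightarrow> real^'n \<Rightarrow> real^'n"
    and M :: "('a \<times> (nat \<Rightarrow> 'n \<times> (real^'n) \<times> (real^'n))) measure"
    and x g :: "nat \<Rightarrow> 'a \<times> (nat \<Rightarrow> 'n \<times> (real^'n) \<times> (real^'n)) \<Rightarrow> real^'n"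
    and l :: "nat \<Rightarrow> 'a \<times> (nat \<Rightarrow> 'n \<times> (real^'n) \<times> (real^'n)) \<Rightarrow> (real^'n \<Rightarrow> real)"
  assumes C: "closed C" "convex C" "cball 0 r \<subseteq> C" "C \<subseteq> cball 0 R"
    and params: "0 < r" "r \<le> R" "0 < \<delta>" "\<delta> < 1 / 3" "\<kappa> = R / r"
    and oracle_approx: "approx_membership_oracle C MEM"
    and oracle_meas: "\<And>\<epsilon>. \<epsilon> > 0 \<Longrightarrow> {y. MEM y \<epsilon>} \<in> sets borel"
    and adversary: "prob_space N"
    and M_eq: "M = run_measure N"
    and x_eq: "\<And>t \<omega>. x t \<omega> = iterate (run_round MEM r R \<delta> adv sg t \<omega>)"
    and l_eq: "\<And>t \<omega>. l t \<omega> = loss (run_round MEM r R \<delta> adv sg t \<omega>)"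
    and g_eq: "\<And>t \<omega>. g t \<omega> = subgrad (run_round MEM r R \<delta> adv sg t \<omega>)"
    and convex_losses: "\<And>t. 1 \<le> t \<Longrightarrow> AE \<omega> in M. convex_on C (l t \<omega>)"
    and subgradients: "\<And>t. 1 \<le> t \<Longrightarrow> AE \<omega> in M. g t \<omega> \<in> subdifferential C (l t \<omega>) (x t \<omega>)"
    and g_meas: "\<And>t. 1 \<le> t \<Longrightarrow> g t \<in> borel_measurable M"
  shows "(\<forall>t\<ge>1. \<forall>\<omega>\<in>space M. x t \<omega> \<in> C) \<and>
    (\<forall>T\<ge>1. (\<forall>t\<in>{1..T}. integrable M (\<lambda>\<omega>. (norm (g t \<omega>))\<^sup>2)) \<longrightarrow>
      (\<forall>y\<in>C. (\<Sum>t=1..T. \<integral>\<omega>. g t \<omega> \<bullet> (x t \<omega> - y) \<partial>M)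
        \<le> 4 * R * sqrt ((1 + real CARD('n) * (\<kappa> + \<delta>)\<^sup>2) * (\<Sum>t=1..T. \<integral>\<omega>. (norm (g t \<omega>))\<^sup>2 \<partial>M))
          + 6 * \<delta> * R * (\<integral>\<omega>. (MAX t\<in>{1..T}. norm (g t \<omega>)) \<partial>M)))"
proof -
  interpret N: prob_space N by (rule adversary)
  interpret projection_free_run C r R MEM \<delta> N adv sg
  proof unfold_locales
    fix \<epsilon> :: real assume "0 < \<epsilon>"
    then show "{y. MEM y \<epsilon>} \<in> sets borel" by (rule oracle_meas)
  qed (fact C params(1-4) oracle_approx)+
  have x_Suc: "x (Suc k) = play k" and g_Suc: "g (Suc k) = grad k" for k
    by (auto simp: x_eq g_eq run_round_Suc)
  have meas: "grad k \<in> borel_measurable (run_measure N)" for k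
    using g_meas[of "Suc k"] by (simp add: g_Suc M_eq)
  show ?thesis
  proof (intro conjI allI impI ballI)
    fix t :: nat and \<omega> assume "1 \<le> t"
    then obtain k where "t = Suc k" by (cases t) auto
    then show "x t \<omega> \<in> C" by (simp add: x_Suc play_in_C)
  next
    fix T :: nat and y
    assume T: "1 \<le> T" and int: "\<forall>t\<in>{1..T}. integrable M (\<lambda>\<omega>. (norm (g t \<omega>))\<^sup>2)" and y: "y \<in> C"
    have shift: "(\<Sum>t=1..T. f t) = (\<Sum>k<T. f (Suc k))" for f :: "nat \<Rightarrow> real"
      using sum.atLeast1_atMost_eq[of f T] by simp
    have image: "(\<lambda>t. norm (g t \<omega>)) ` {1..T} = (\<lambda>k. norm (grad k \<omega>)) ` {..<T}" for \<omega>
      unfolding image_Suc_lessThan[symmetric] image_image g_Suc ..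
    have "integrable (run_measure N) (\<lambda>\<omega>. (norm (grad k \<omega>))\<^sup>2)" if "k < T" for k
      using int that by (auto simp: M_eq g_Suc dest: bspec[of _ _ "Suc k"])
    from expected_regret[OF meas T this y]
    show "(\<Sum>t=1..T. \<integral>\<omega>. g t \<omega> \<bullet> (x t \<omega> - y) \<partial>M)
        \<le> 4 * R * sqrt ((1 + real CARD('n) * (\<kappa> + \<delta>)\<^sup>2) * (\<Sum>t=1..T. \<integral>\<omega>. (norm (g t \<omega>))\<^sup>2 \<partial>M))
          + 6 * \<delta> * R * (\<integral>\<omega>. (MAX t\<in>{1..T}. norm (g t \<omega>)) \<partial>M)"
      unfolding shift x_Suc g_Suc image M_eq params(5) .
  qed
qed

end
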